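(* Let $n$ be an odd integer, $m\geq 2$ an integer with $2m<n$, and let $f\in\mathbb{C}\{x,y\}$ be a product $f=f_1g$ where $f_1$ is regular (multiplicity 1), $g$ is irreducible of multiplicity 2 with value semigroup $\langle 2,n\rangle$, the curves $f_1=0$ and $g=0$ have the same tangent line, and $I(f_1,g)=2m$. Then, up to an analytic change of coordinates (and multiplication by a unit), $f=y\big((y-x^m)^2-x^n\big)$, a Saito basis for $S(f)$ for this $f$ is $\{\eta_1,\eta_2\}$ with $$\eta_1=y\,(n^2x^{n-m-1}-4m^2x^{m-1})\,dx+2\big((2m-n)y+nx^m-nx^{n-m}\big)\,dy,$$ $$\eta_2=2xy\,dy-y\big(ny+(2m-n)x^m\big)\,dx,$$ and $\tau(f)=n+3m-1$.
   Context: $\Omega^1=\mathbb{C}\{x,y\}dx+\mathbb{C}\{x,y\}dy$; for reduced non-unit $f$, $F(f)=\{p\,df+f\eta:\ p\in\mathbb{C}\{x,y\},\eta\in\Omega^1\}$ and the Saito module is $S(f)=\{\omega\in\Omega^1:\ g\omega\in F(f)\text{ for some }g\in\mathbb{C}\{x,y\}\text{ with }\gcd(g,f)=1\}$; equivalently $\omega\wedge df\in f\,\mathbb{C}\{x,y\}\,dx\wedge dy$. It is free of rank 2 over $\mathbb{C}\{x,y\}$; a Saito basis is a basis $\{\omega_1,\omega_2\}$ (Saito's criterion: $\omega_1,\omega_2\in S(f)$ form a basis iff $\omega_1\wedge\omega_2=uf\,dx\wedge dy$ with $u$ a unit). $\tau(f)=\dim_{\mathbb{C}}\mathbb{C}\{x,y\}/\langle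 f,f_x,f_y\rangle$ is the Tjurina number; $I(p,q)=\dim_{\mathbb{C}}\mathbb{C}\{x,y\}/\langle p,q\rangle$. The value semigroup of an irreducible $g$ is the set of orders in $t$ of $h(x(t),y(t))$, $h\in\mathbb{C}\{x,y\}\setminus\langle g\rangle$, for a primitive parametrization $(x(t),y(t))$ of $g=0$. *)

theory Defs
  imports
    "HOL-Analysis.Analysis"
    "HOL-Computational_Algebra.Computational_Algebra"
    "HOL-Library.Extended_Nat"
begin

section \<open>The ring of convergent power series in two variables\<close>

text \<open>
  A formal series in \<open>x, y\<close> is encoded as an element of \<open>complex fps fps\<close>: the outer variable is
  \<open>x\<close>, the inner one is \<open>y\<close>, so the coefficient of \<open>x\<^sup>i y\<^sup>j\<close> is \<open>fps_nth (fps_nth F i) j\<close>.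
\<close>

definition convergent2 :: "complex fps fps \<Rightarrow> bool" where
  "convergent2 F \<longleftrightarrow>
     (\<exists>r>0. (\<lambda>(i, j). norm (fps_nth (fps_nth F i) j) * r ^ (i + j)) summable_on UNIV)"

lemma convergent2_iff_bound:
  "convergent2 F \<longleftrightarrow> (\<exists>C R. C \<ge> 0 \<and> R \<ge> 1 \<and>
     (\<forall>i j. norm (fps_nth (fps_nth F i) j) \<le> C * R ^ (i + j)))"
proof
  assume "convergent2 F"
  then obtain r where r: "r > 0"
    and s: "(\<lambda>(i, j). norm (fps_nth (fps_nth F i) j) * r ^ (i + j)) summable_on UNIV"
    unfolding convergent2_def by blast
  define C where
    "C = infsum (\<lambda>(i, j). norm (fps_nth (fps_nth F i) j) * r ^ (i + j)) (UNIV :: (nat \<times> nat) set)"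
  define R where "R = max 1 (1 / r)"
  have C0: "C \<ge> 0"
    unfolding C_def using r by (intro infsum_nonneg) auto
  have "norm (fps_nth (fps_nth F i) j) \<le> C * R ^ (i + j)" for i j
  proof -
    have "sum (\<lambda>(i, j). norm (fps_nth (fps_nth F i) j) * r ^ (i + j)) {(i, j)} \<le> C"
      unfolding C_def using r by (intro finite_sum_le_infsum[OF s]) auto
    then have "norm (fps_nth (fps_nth F i) j) * r ^ (i + j) \<le> C" by simp
    then have "norm (fps_nth (fps_nth F i) j) \<le> C * (1 / r) ^ (i + j)"
      using r by (simp add: field_simps)
    also have "\<dots> \<le> C * R ^ (i + j)"
      using r C0 by (intro mult_left_mono power_mono) (auto simp: R_def)
    finally show ?thesis .
  qed
  then show "\<exists>C R. C \<ge> 0 \<and> R \<ge> 1 \<and>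
     (\<forall>i j. norm (fps_nth (fps_nth F i) j) \<le> C * R ^ (i + j))"
    using C0 by (intro exI[of _ C] exI[of _ R]) (auto simp: R_def)
next
  assume "\<exists>C R. C \<ge> 0 \<and> R \<ge> 1 \<and>
     (\<forall>i j. norm (fps_nth (fps_nth F i) j) \<le> C * R ^ (i + j))"
  then obtain C R where C: "C \<ge> 0" and R: "R \<ge> 1"
    and b: "\<And>i j. norm (fps_nth (fps_nth F i) j) \<le> C * R ^ (i + j)" by blast
  define r where "r = 1 / (2 * R)"
  have r: "r > 0" using R by (simp add: r_def)
  let ?t = "\<lambda>p :: nat \<times> nat. case p of (i, j) \<Rightarrow> norm (fps_nth (fps_nth F i) j) * r ^ (i + j)"
  have t: "?t (i, j) \<le> C * ((1/2) ^ i * (1/2) ^ j)" for i j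
  proof -
    have "?t (i, j) \<le> C * R ^ (i + j) * r ^ (i + j)"
      using b[of i j] r by (simp add: mult_right_mono)
    also have "\<dots> = C * ((1/2) ^ i * (1/2) ^ j)"
      using R by (simp add: r_def power_add power_divide power_mult_distrib)
    finally show ?thesis .
  qed
  have g: "(\<Sum>i\<le>N. (1/2 :: real) ^ i) \<le> 2" for N :: nat
  proof -
    have "(\<Sum>i\<le>N. (1/2 :: real) ^ i) = 2 - (1/2) ^ N"
      by (induction N) (simp_all add: field_simps)
    then show ?thesis by simp
  qed
  have "?t summable_on UNIV"
  proof (rule nonneg_bdd_above_summable_on)
    show "?t p \<ge> 0" for p using r by (auto split: prod.splits)
    show "bdd_above (sum ?t ` {S. S \<subseteq> UNIV \<and> finite S})"
    proof (rule bdd_aboveI2)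
      fix S :: "(nat \<times> nat) set" assume "S \<in> {S. S \<subseteq> UNIV \<and> finite S}"
      then have fS: "finite S" by simp
      define N where "N = Max (insert 0 (fst ` S \<union> snd ` S))"
      have "S \<subseteq> {..N} \<times> {..N}"
      proof
        fix p assume p: "p \<in> S"
        have "fst p \<le> N" "snd p \<le> N"
          unfolding N_def using fS p by (auto intro!: Max_ge)
        then show "p \<in> {..N} \<times> {..N}" by (cases p) auto
      qed
      then have "sum ?t S \<le> sum ?t ({..N} \<times> {..N})"
        using r by (intro sum_mono2) (auto split: prod.splits)
      also have "\<dots> \<le> (\<Sum>(i, j)\<in>{..N} \<times> {..N}. C * ((1/2) ^ i * (1/2) ^ j))"
        using t by (intro sum_mono) auto
      also have "\<dots> = C * ((\<Sum>i\<le>N. (1/2) ^ i) * (\<Sum>j\<le>N. (1/2) ^ j))"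
        unfolding sum_product sum.cartesian_product by (simp add: sum_distrib_left case_prod_beta)
      also have "\<dots> \<le> C * (2 * 2)"
        using C g by (intro mult_left_mono mult_mono) (auto intro: sum_nonneg)
      finally show "sum ?t S \<le> C * (2 * 2)" .
    qed
  qed
  then show "convergent2 F" unfolding convergent2_def using r by blast
qed

lemma convergent2I:
  assumes "C \<ge> 0" "R \<ge> 1" "\<And>i j. norm (fps_nth (fps_nth F i) j) \<le> C * R ^ (i + j)"
  shows "convergent2 F"
  using assms unfolding convergent2_iff_bound by blast

lemma convergent2E:
  assumes "convergent2 F"
  obtains C R where "C \<ge> 0" "R \<ge> 1" "\<And>i j. norm (fps_nth (fps_nth F i) j) \<le> C * R ^ (i + j)"
  using assms unfolding convergent2_iff_bound by blast

lemma convergent2_const: "convergent2 (fps_const (fps_const c))"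
  by (rule convergent2I[of "norm c" 1]) auto

lemma convergent2_add:
  assumes "convergent2 F" "convergent2 G"
  shows "convergent2 (F + G)"
proof -
  obtain C R where F: "C \<ge> 0" "R \<ge> 1" "\<And>i j. norm (fps_nth (fps_nth F i) j) \<le> C * R ^ (i + j)"
    by (rule convergent2E[OF assms(1)]) blast
  obtain D S where G: "D \<ge> 0" "S \<ge> 1" "\<And>i j. norm (fps_nth (fps_nth G i) j) \<le> D * S ^ (i + j)"
    by (rule convergent2E[OF assms(2)]) blast
  show ?thesis
  proof (rule convergent2I[of "C + D" "max R S"])
    fix i j
    have "norm (fps_nth (fps_nth (F + G) i) j) \<le> C * R ^ (i + j) + D * S ^ (i + j)"
      using F(3)[of i j] G(3)[of i j] by (simp add: norm_triangle_mono)
    also have "\<dots> \<le> C * max R S ^ (i + j) + D * max R S ^ (i + j)"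
      using F G by (intro add_mono mult_left_mono power_mono) auto
    finally show "norm (fps_nth (fps_nth (F + G) i) j) \<le> (C + D) * max R S ^ (i + j)"
      by (simp add: algebra_simps)
  qed (use F G in auto)
qed

lemma convergent2_uminus:
  assumes "convergent2 F"
  shows "convergent2 (- F)"
  using assms unfolding convergent2_def by simp

lemma fps_nth2_mult:
  "fps_nth (fps_nth (F * G) i) j =
     (\<Sum>k\<le>i. \<Sum>l\<le>j. fps_nth (fps_nth F k) l * fps_nth (fps_nth G (i - k)) (j - l))"
  by (simp add: fps_mult_nth fps_sum_nth atLeast0AtMost)

lemma Suc_le_two_power: "real (Suc i) \<le> 2 ^ i"
  by (induction i) auto

lemma convergent2_mult:
  assumes "convergent2 F" "convergent2 G"
  shows "convergent2 (F * G)"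
proof -
  obtain C R where F: "C \<ge> 0" "R \<ge> 1" "\<And>i j. norm (fps_nth (fps_nth F i) j) \<le> C * R ^ (i + j)"
    by (rule convergent2E[OF assms(1)]) blast
  obtain D S where G: "D \<ge> 0" "S \<ge> 1" "\<And>i j. norm (fps_nth (fps_nth G i) j) \<le> D * S ^ (i + j)"
    by (rule convergent2E[OF assms(2)]) blast
  define T where "T = max R S"
  have T: "T \<ge> 1" "R \<le> T" "S \<le> T" using F G by (auto simp: T_def)
  show ?thesis
  proof (rule convergent2I[of "C * D" "2 * T"])
    fix i j
    have "norm (fps_nth (fps_nth (F * G) i) j) \<le>
        (\<Sum>k\<le>i. \<Sum>l\<le>j. C * D * T ^ (i + j))"
      unfolding fps_nth2_mult
    proof (intro sum_norm_le)
      fix k l assume kl: "k \<in> {..i}" "l \<in> {..j}"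
      have "norm (fps_nth (fps_nth F k) l * fps_nth (fps_nth G (i - k)) (j - l))
          \<le> (C * R ^ (k + l)) * (D * S ^ (i - k + (j - l)))"
        unfolding norm_mult using F G by (intro mult_mono) auto
      also have "\<dots> \<le> (C * T ^ (k + l)) * (D * T ^ (i - k + (j - l)))"
        using F G T by (intro mult_mono mult_left_mono power_mono) auto
      also have "\<dots> = C * D * T ^ (k + l + (i - k + (j - l)))"
        by (simp add: power_add)
      also have "k + l + (i - k + (j - l)) = i + j" using kl by auto
      finally show "norm (fps_nth (fps_nth F k) l * fps_nth (fps_nth G (i - k)) (j - l))
          \<le> C * D * T ^ (i + j)" .
    qed
    also have "\<dots> = (real (Suc i) * real (Suc j)) * (C * D * T ^ (i + j))"
      by simp
    also have "\<dots> \<le> (2 ^ i * 2 ^ j) * (C * D * T ^ (i + j))"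
      using F G T by (intro mult_right_mono mult_mono Suc_le_two_power) auto
    also have "\<dots> = C * D * (2 * T) ^ (i + j)"
      by (simp add: power_add power_mult_distrib)
    finally show "norm (fps_nth (fps_nth (F * G) i) j) \<le> C * D * (2 * T) ^ (i + j)" .
  qed (use F G T in auto)
qed

definition fps2_dx :: "complex fps fps \<Rightarrow> complex fps fps" where
  "fps2_dx F = fps_deriv F"

definition fps2_dy :: "complex fps fps \<Rightarrow> complex fps fps" where
  "fps2_dy F = Abs_fps (\<lambda>i. fps_deriv (fps_nth F i))"

lemma fps_nth2_of_nat_mult:
  "fps_nth (of_nat k * f) j = of_nat k * fps_nth (f :: complex fps) j"
  by (metis fps_mult_left_const_nth fps_of_nat)

lemma convergent2_dx:
  assumes "convergent2 F"
  shows "convergent2 (fps2_dx F)"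
proof -
  obtain C R where F: "C \<ge> 0" "R \<ge> 1" "\<And>i j. norm (fps_nth (fps_nth F i) j) \<le> C * R ^ (i + j)"
    by (rule convergent2E[OF assms]) blast
  show ?thesis
  proof (rule convergent2I[of "C * R" "2 * R"])
    fix i j
    have "norm (fps_nth (fps_nth (fps2_dx F) i) j) =
        real (Suc i) * norm (fps_nth (fps_nth F (Suc i)) j)"
      unfolding fps2_dx_def fps_deriv_nth Suc_eq_plus1[symmetric] fps_nth2_of_nat_mult norm_mult
        norm_of_nat ..
    also have "\<dots> \<le> 2 ^ i * (C * R ^ (Suc i + j))"
      using F(1,2) by (intro mult_mono Suc_le_two_power F(3)) auto
    also have "\<dots> \<le> 2 ^ (i + j) * (C * R ^ (Suc i + j))"
      using F by (intro mult_right_mono power_increasing) auto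
    also have "\<dots> = C * R * (2 * R) ^ (i + j)" by (simp add: power_mult_distrib)
    finally show "norm (fps_nth (fps_nth (fps2_dx F) i) j) \<le> C * R * (2 * R) ^ (i + j)" .
  qed (use F in auto)
qed

lemma convergent2_dy:
  assumes "convergent2 F"
  shows "convergent2 (fps2_dy F)"
proof -
  obtain C R where F: "C \<ge> 0" "R \<ge> 1" "\<And>i j. norm (fps_nth (fps_nth F i) j) \<le> C * R ^ (i + j)"
    by (rule convergent2E[OF assms]) blast
  show ?thesis
  proof (rule convergent2I[of "C * R" "2 * R"])
    fix i j
    have "norm (fps_nth (fps_nth (fps2_dy F) i) j) =
        real (Suc j) * norm (fps_nth (fps_nth F i) (Suc j))"
      unfolding fps2_dy_def fps_nth_Abs_fps fps_deriv_nth Suc_eq_plus1[symmetric] norm_mult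
        norm_of_nat ..
    also have "\<dots> \<le> 2 ^ j * (C * R ^ (i + Suc j))"
      using F(1,2) by (intro mult_mono Suc_le_two_power F(3)) auto
    also have "\<dots> \<le> 2 ^ (i + j) * (C * R ^ (i + Suc j))"
      using F by (intro mult_right_mono power_increasing) auto
    also have "\<dots> = C * R * (2 * R) ^ (i + j)" by (simp add: power_mult_distrib)
    finally show "norm (fps_nth (fps_nth (fps2_dy F) i) j) \<le> C * R * (2 * R) ^ (i + j)" .
  qed (use F in auto)
qed

lemma convergent2_x: "convergent2 fps_X"
  by (rule convergent2I[of 1 1]) (auto simp: fps_X_def)

lemma convergent2_y: "convergent2 (fps_const fps_X)"
  by (rule convergent2I[of 1 1]) (auto simp: fps_X_def)

typedef cps2 = "{F. convergent2 F}" morphisms series Abs_cps2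
  using convergent2_const by blast

setup_lifting type_definition_cps2

instantiation cps2 :: idom
begin

lift_definition zero_cps2 :: cps2 is 0
  using convergent2_const[of 0] by simp

lift_definition one_cps2 :: cps2 is 1
  using convergent2_const[of 1] by simp

lift_definition plus_cps2 :: "cps2 \<Rightarrow> cps2 \<Rightarrow> cps2" is "(+)"
  by (rule convergent2_add)

lift_definition uminus_cps2 :: "cps2 \<Rightarrow> cps2" is uminus
  by (rule convergent2_uminus)

lift_definition minus_cps2 :: "cps2 \<Rightarrow> cps2 \<Rightarrow> cps2" is "(-)"
  by (metis convergent2_add convergent2_uminus diff_conv_add_uminus)

lift_definition times_cps2 :: "cps2 \<Rightarrow> cps2 \<Rightarrow> cps2" is "(*)"
  by (rule convergent2_mult)

instance
  by standard (transfer, simp add: algebra_simps; fail)+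

end

text \<open>
  Exact division (with an arbitrary value when the quotient does not exist); it is only needed to
  make the notions of the class \<^class>\<open>algebraic_semidom\<close>, such as \<^const>\<open>coprime\<close>, available.
\<close>

instantiation cps2 :: idom_divide
begin

definition divide_cps2 :: "cps2 \<Rightarrow> cps2 \<Rightarrow> cps2" where
  "divide_cps2 a b = (if b = 0 then 0 else (THE q. a = q * b))"

instance
  by standard (auto simp: divide_cps2_def)

end

instance cps2 :: algebraic_semidom ..

lift_definition const :: "complex \<Rightarrow> cps2" is "\<lambda>c. fps_const (fps_const c)"
  by (rule convergent2_const)

lift_definition var_x :: cps2 is fps_X
  by (rule convergent2_x)

lift_definition var_y :: cps2 is "fps_const fps_X"
  by (rule convergent2_y)

lift_definition coef :: "cps2 \<Rightarrow> nat \<Rightarrow> nat \<Rightarrow> complex" is "\<lambda>F i j. fps_nth (fps_nth F i) j" .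

lift_definition pdx :: "cps2 \<Rightarrow> cps2" is fps2_dx
  by (rule convergent2_dx)

lift_definition pdy :: "cps2 \<Rightarrow> cps2" is fps2_dy
  by (rule convergent2_dy)


section \<open>Multiplicity, tangent lines, and colengths of ideals\<close>

text \<open>The infimum of the empty set is \<open>\<infinity>\<close>, so the zero series has infinite multiplicity.\<close>

definition multiplicity_at_0 :: "cps2 \<Rightarrow> enat" where
  "multiplicity_at_0 p = Inf {enat (i + j) | i j. coef p i j \<noteq> 0}"

text \<open>
  The zero set of the initial form. For a regular or, more generally, irreducible \<open>p\<close> the initial
  form is a constant times a power of a linear form, and this zero set is the tangent line.
\<close>

definition tangent_cone :: "cps2 \<Rightarrow> (complex \<times> complex) set" where
  "tangent_cone p =
     (let k = the_enat (multiplicity_at_0 p)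
      in {(a, b). (\<Sum>i\<le>k. coef p i (k - i) * a ^ i * b ^ (k - i)) = 0})"

definition ideal_of :: "cps2 set \<Rightarrow> cps2 set" where
  "ideal_of A = module.span (*) A"

definition basis_modulo :: "cps2 set \<Rightarrow> cps2 set \<Rightarrow> bool" where
  "basis_modulo I B \<longleftrightarrow> finite B \<and>
     (\<forall>c :: cps2 \<Rightarrow> complex. (\<Sum>b\<in>B. const (c b) * b) \<in> I \<longrightarrow> (\<forall>b\<in>B. c b = 0)) \<and>
     (\<forall>h. \<exists>c :: cps2 \<Rightarrow> complex. h - (\<Sum>b\<in>B. const (c b) * b) \<in> I)"

text \<open>The complex dimension of the quotient by an ideal, computed on lifts of a basis.\<close>

definition quotient_dim :: "cps2 set \<Rightarrow> enat" where
  "quotient_dim I =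
     (if \<exists>B. basis_modulo I B then enat (card (SOME B. basis_modulo I B)) else \<infinity>)"

definition intersection_number :: "cps2 \<Rightarrow> cps2 \<Rightarrow> enat" where
  "intersection_number p q = quotient_dim (ideal_of {p, q})"

definition tjurina :: "cps2 \<Rightarrow> enat" where
  "tjurina f = quotient_dim (ideal_of {f, pdx f, pdy f})"


section \<open>Substitution, parametrizations and value semigroups\<close>

text \<open>
  The composite \<open>h(x(t), y(t))\<close>. The sum over all \<open>i, j\<close> is truncated: if \<open>x(0) = y(0) = 0\<close>, then
  \<open>x(t)\<^sup>i y(t)\<^sup>j\<close> has order at least \<open>i + j\<close>, and larger \<open>i\<close> or \<open>j\<close> do not contribute to the
  coefficient of \<open>t\<^sup>k\<close>. The same remark applies to the composite \<open>h(X(x,y), Y(x,y))\<close>.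
\<close>

definition pullback :: "cps2 \<Rightarrow> complex fps \<Rightarrow> complex fps \<Rightarrow> complex fps" where
  "pullback h x y = Abs_fps (\<lambda>k. \<Sum>i\<le>k. \<Sum>j\<le>k. coef h i j * fps_nth (x ^ i * y ^ j) k)"

definition substitute :: "cps2 \<Rightarrow> cps2 \<Rightarrow> cps2 \<Rightarrow> complex fps fps" where
  "substitute h X Y = Abs_fps (\<lambda>a. Abs_fps (\<lambda>b.
     \<Sum>i\<le>a + b. \<Sum>j\<le>a + b. coef h i j * coef (X ^ i * Y ^ j) a b))"

definition coordinate_change :: "cps2 \<Rightarrow> cps2 \<Rightarrow> bool" where
  "coordinate_change X Y \<longleftrightarrow> coef X 0 0 = 0 \<and> coef Y 0 0 = 0 \<and>
     coef X 1 0 * coef Y 0 1 - coef X 0 1 * coef Y 1 0 \<noteq> 0"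

definition parametrization :: "cps2 \<Rightarrow> complex fps \<Rightarrow> complex fps \<Rightarrow> bool" where
  "parametrization g x y \<longleftrightarrow> fps_conv_radius x > 0 \<and> fps_conv_radius y > 0 \<and>
     fps_nth x 0 = 0 \<and> fps_nth y 0 = 0 \<and> (x, y) \<noteq> (0, 0) \<and> pullback g x y = 0"

text \<open>Primitive: not obtained from another pair by a substitution \<open>t \<mapsto> s(t)\<close> of order above \<open>1\<close>.\<close>

definition primitive_parametrization :: "cps2 \<Rightarrow> complex fps \<Rightarrow> complex fps \<Rightarrow> bool" where
  "primitive_parametrization g x y \<longleftrightarrow> parametrization g x y \<and>
     (\<forall>a b s. fps_conv_radius a > 0 \<and> fps_conv_radius b > 0 \<and> fps_conv_radius s > 0 \<and>
        fps_nth s 0 = 0 \<and> x = fps_compose a s \<and> y = fps_compose b s \<longrightarrow> subdegree s = 1)"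

text \<open>
  A relation between \<open>g\<close> and its value semigroup: the set of orders does not depend on the
  primitive parametrization.
\<close>

definition has_value_semigroup :: "cps2 \<Rightarrow> nat set \<Rightarrow> bool" where
  "has_value_semigroup g \<Gamma> \<longleftrightarrow>
     (\<exists>x y. primitive_parametrization g x y \<and>
        \<Gamma> = {subdegree (pullback h x y) | h. h \<notin> ideal_of {g}})"

definition semigroup_gen2 :: "nat \<Rightarrow> nat \<Rightarrow> nat set" where
  "semigroup_gen2 p q = {a * p + b * q | a b. True}"


section \<open>Differential forms and the Saito module\<close>

text \<open>The pair \<open>(A, B)\<close> stands for \<open>A dx + B dy\<close>.\<close>

type_synonym form = "cps2 \<times> cps2"

definition form_scale :: "cps2 \<Rightarrow> form \<Rightarrow> form" where
  "form_scale h \<omega> = (h * fst \<omega>, h * snd \<omega>)"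

global_interpretation forms: module form_scale
  by standard (auto simp: form_scale_def algebra_simps plus_prod_def)

definition differential :: "cps2 \<Rightarrow> form" where
  "differential f = (pdx f, pdy f)"

definition F_module :: "cps2 \<Rightarrow> form set" where
  "F_module f = {form_scale p (differential f) + form_scale f \<eta> | p \<eta>. True}"

definition saito_module :: "cps2 \<Rightarrow> form set" where
  "saito_module f = {\<omega>. \<exists>g. coprime g f \<and> form_scale g \<omega> \<in> F_module f}"

definition saito_basis :: "cps2 \<Rightarrow> form \<Rightarrow> form \<Rightarrow> bool" where
  "saito_basis f \<omega>\<^sub>1 \<omega>\<^sub>2 \<longleftrightarrow> \<omega>\<^sub>1 \<noteq> \<omega>\<^sub>2 \<and> forms.independent {\<omega>\<^sub>1, \<omega>\<^sub>2} \<and>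
     forms.span {\<omega>\<^sub>1, \<omega>\<^sub>2} = saito_module f"

end

theory Submission
  imports Defs
begin

text \<open>
  By Weierstrass division \<open>f\<^sub>1\<close> is a unit times \<open>y - r(x)\<close> and \<open>g\<close> is a unit times
  \<open>(y - A(x))\<^sup>2 - D(x)\<close>. Irreducibility says that \<open>D\<close> is not a square, so it has odd order, and the
  value semigroup says that this order is \<open>n\<close>. After the shift \<open>y \<mapsto> y + r\<close> the two curves meet in
  \<open>\<alpha>\<^sup>2 - D = 0\<close> on the line \<open>y = 0\<close>, where \<open>\<alpha> = A - r\<close>, so \<open>I(f\<^sub>1, g) = 2m < n\<close> forces \<open>\<alpha>\<close> to
  have order \<open>m\<close>.
  Now \<open>D / \<alpha>\<^sup>2\<close> has order \<open>n - 2m > 0\<close>; choosing \<open>x\<close> to be its \<open>(n - 2m)\<close>-th root, and rescaling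
  \<open>y\<close> by \<open>\<alpha> / x\<^sup>m\<close>, turns \<open>(y - \<alpha>)\<^sup>2 - D\<close> into a unit times \<open>(y - x\<^sup>m)\<^sup>2 - x\<^sup>n\<close>.

  For the normal form, \<open>\<eta>\<^sub>1 \<and> \<eta>\<^sub>2 = 2n(2m - n) f\<^sub>0 dx \<and> dy\<close>, and Saito's criterion applies because
  both factors of \<open>f\<^sub>0\<close> are prime, being kernels of pullbacks to parametrized curves. The Tjurina
  number is computed modulo \<open>\<partial>f\<^sub>0/\<partial>y\<close>, where the quotient becomes a module of rank two over the series
  in \<open>x\<close>.
\<close>


section \<open>Coefficient calculus\<close>

text \<open>The series have to converge, so every construction must come with a bound. The
  substantial estimates are two majorant arguments, one for substitution and one for Weierstrass
  division. Units come from substituting into the geometric series; the implicit function theorem,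
  roots and compositional inverses come from division of order one. The invariants are defined by
  ideals and divisibility in two variables. A coordinate change is therefore always carried together
  with an explicit inverse, so that substitution is a ring automorphism and moves ideals, colengths
  and irreducibility. Series in x alone are not a separate type: they are the kernel of
  \<open>pdy\<close> in the same ring, and remainders of Weierstrass division are polynomials in y
  over this kernel. The common tangent line ensures that one coordinate is regular for both factors,
  possibly after exchanging x and y.\<close>

lemma cps2_eqI: "(\<And>i j. coef F i j = coef G i j) \<Longrightarrow> F = G"
  by transfer (simp add: fps_eq_iff)

lemma coef_0 [simp]: "coef 0 i j = 0"
  by transfer simp

lemma coef_1: "coef 1 i j = (if i = 0 \<and> j = 0 then 1 else 0)"
  by transfer simp

lemma coef_add [simp]: "coef (F + G) i j = coef F i j + coef G i j"
  by transfer simp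

lemma coef_diff [simp]: "coef (F - G) i j = coef F i j - coef G i j"
  by transfer simp

lemma coef_uminus [simp]: "coef (- F) i j = - coef F i j"
  by transfer simp

lemma coef_sum [simp]: "coef (sum F A) i j = (\<Sum>a\<in>A. coef (F a) i j)"
  by (induction A rule: infinite_finite_induct) auto

lemma coef_mult:
  "coef (F * G) i j = (\<Sum>k\<le>i. \<Sum>l\<le>j. coef F k l * coef G (i - k) (j - l))"
  by transfer (rule fps_nth2_mult)

lemma coef_const: "coef (const c) i j = (if i = 0 \<and> j = 0 then c else 0)"
  by transfer simp

lemma coef_const_mult [simp]: "coef (const c * F) i j = c * coef F i j"
  by transfer simp

lemma coef_x_mult: "coef (var_x * F) i j = (if i = 0 then 0 else coef F (i - 1) j)"
  by transfer simp

lemma coef_y_mult: "coef (var_y * F) i j = (if j = 0 then 0 else coef F i (j - 1))"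
  by transfer simp

lemma coef_x_power_mult: "coef (var_x ^ k * F) i j = (if i < k then 0 else coef F (i - k) j)"
proof (induction k arbitrary: i)
  case (Suc k)
  then show ?case by (auto simp: coef_x_mult mult.assoc)
qed simp

lemma coef_y_power_mult: "coef (var_y ^ k * F) i j = (if j < k then 0 else coef F i (j - k))"
proof (induction k arbitrary: j)
  case (Suc k)
  then show ?case by (auto simp: coef_y_mult mult.assoc)
qed simp

lemma coef_var_x: "coef var_x i j = (if i = 1 \<and> j = 0 then 1 else 0)"
  using coef_x_mult[of 1 i j] by (auto simp: coef_1)

lemma coef_var_y: "coef var_y i j = (if i = 0 \<and> j = 1 then 1 else 0)"
  using coef_y_mult[of 1 i j] by (auto simp: coef_1)

lemma coef_x_power: "coef (var_x ^ k) i j = (if i = k \<and> j = 0 then 1 else 0)"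
  using coef_x_power_mult[of k 1 i j] by (auto simp: coef_1)

lemma coef_mult_00: "coef (F * G) 0 0 = coef F 0 0 * coef G 0 0"
  by (simp add: coef_mult)

lemma coef_power_00: "coef (F ^ k) 0 0 = coef F 0 0 ^ k"
  by (induction k) (auto simp: coef_mult_00 coef_1)

lemma const_0 [simp]: "const 0 = 0"
  by transfer simp

lemma const_1 [simp]: "const 1 = 1"
  by transfer simp

lemma const_add: "const (a + b) = const a + const b"
  by (rule cps2_eqI) (auto simp: coef_const)

lemma const_mult: "const (a * b) = const a * const b"
  by (rule cps2_eqI) (auto simp: coef_const)

lemma const_uminus: "const (- a) = - const a"
  by (rule cps2_eqI) (auto simp: coef_const)

lemma const_of_nat: "const (of_nat k) = of_nat k"
  by (induction k) (auto simp: const_add)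

lemma const_numeral: "const (numeral k) = numeral k"
  using const_of_nat[of "numeral k"] by simp

lemma const_eq_0_iff [simp]: "const c = 0 \<longleftrightarrow> c = 0"
  by (metis coef_const coef_0 const_0)

lemma is_unit_const: "c \<noteq> 0 \<Longrightarrow> is_unit (const c)"
  by (rule dvdI[of _ _ "const (inverse c)"]) (simp flip: const_mult)

instance cps2 :: ring_char_0
proof
  show "inj (of_nat :: nat \<Rightarrow> cps2)"
    unfolding const_of_nat[symmetric]
    by (rule injI) (metis coef_const of_nat_eq_iff)
qed

subsection \<open>The filtration by total degree\<close>

definition ord_ge :: "nat \<Rightarrow> cps2 \<Rightarrow> bool" where
  "ord_ge N F \<longleftrightarrow> (\<forall>i j. i + j < N \<longrightarrow> coef F i j = 0)"

lemma ord_ge_mult: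
  assumes "ord_ge M F" "ord_ge N G"
  shows "ord_ge (M + N) (F * G)"
  unfolding ord_ge_def
proof (intro allI impI)
  fix i j assume ij: "i + j < M + N"
  have "coef F k l * coef G (i - k) (j - l) = 0" if "k \<le> i" "l \<le> j" for k l
  proof (cases "k + l < M")
    case False
    then have "(i - k) + (j - l) < N" using ij that by linarith
    then show ?thesis using assms(2) by (simp add: ord_ge_def)
  qed (use assms(1) in \<open>simp add: ord_ge_def\<close>)
  then show "coef (F * G) i j = 0"
    unfolding coef_mult by (intro sum.neutral ballI) auto
qed

lemma ord_ge_0 [simp]: "ord_ge 0 F"
  by (simp add: ord_ge_def)

lemma ord_ge_mult_right: "ord_ge M F \<Longrightarrow> ord_ge M (F * G)"
  using ord_ge_mult[of M F 0 G] by simp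

lemma ord_ge_mult_left: "ord_ge M G \<Longrightarrow> ord_ge M (F * G)"
  using ord_ge_mult[of 0 F M G] by simp

lemma ord_ge_power: "coef F 0 0 = 0 \<Longrightarrow> ord_ge k (F ^ k)"
proof (induction k)
  case (Suc k)
  have "ord_ge 1 F" using Suc.prems by (simp add: ord_ge_def)
  then show ?case using ord_ge_mult[of 1 F k "F ^ k"] Suc by simp
qed simp

lemma coef_monomial:
  "coef (const c * (var_x ^ k * var_y ^ l)) i j = (if i = k \<and> j = l then c else 0)"
  using coef_y_power_mult[of l 1 "i - k" j]
  by (auto simp: coef_x_power_mult coef_1)

text \<open>Polynomials are dense for the filtration, so a continuous additive map that vanishes on all
  monomials vanishes. All the functorial properties of substitution are proved this way.\<close>

lemma additive_eq_0_by_density: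
  fixes T :: "cps2 \<Rightarrow> 'a::ab_group_add"
  assumes add: "\<And>F G. T (F + G) = T F + T G"
    and monomial: "\<And>c i j. T (const c * (var_x ^ i * var_y ^ j)) = 0"
    and continuous: "\<And>F. ord_ge N F \<Longrightarrow> T F = 0"
  shows "T F = 0"
proof -
  have T0: "T 0 = 0" using monomial[of 0 0 0] by simp
  have Tsum: "T (sum g A) = (\<Sum>a\<in>A. T (g a))" for g and A :: "nat set"
    by (induction A rule: infinite_finite_induct) (auto simp: T0 add)
  define P where "P = (\<Sum>i<N. \<Sum>j<N. const (coef F i j) * (var_x ^ i * var_y ^ j))"
  have "coef P i j = coef F i j" if "i + j < N" for i j
  proof -
    have "coef P i j = (\<Sum>k<N. if i = k then (\<Sum>l<N. if j = l then coef F k l else 0) else 0)"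
      unfolding P_def coef_sum coef_monomial by (intro sum.cong refl) auto
    then show ?thesis using that by simp
  qed
  then have "T (F - P) = 0" by (intro continuous) (simp add: ord_ge_def)
  moreover have "T P = 0" by (simp add: P_def Tsum monomial)
  ultimately show ?thesis using add[of "F - P" P] by simp
qed

subsection \<open>Derivations\<close>

lemma coef_pdx: "coef (pdx F) i j = of_nat (i + 1) * coef F (i + 1) j"
  by transfer (simp only: fps2_dx_def fps_deriv_nth fps_nth2_of_nat_mult)

lemma coef_pdy: "coef (pdy F) i j = of_nat (j + 1) * coef F i (j + 1)"
  by transfer (simp add: fps2_dy_def)

lemma pdx_add [simp]: "pdx (F + G) = pdx F + pdx G"
  by (rule cps2_eqI) (simp add: coef_pdx algebra_simps)

lemma pdy_add [simp]: "pdy (F + G) = pdy F + pdy G"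
  by (rule cps2_eqI) (simp add: coef_pdy algebra_simps)

lemma pdx_diff [simp]: "pdx (F - G) = pdx F - pdx G"
  by (rule cps2_eqI) (simp add: coef_pdx algebra_simps)

lemma pdy_diff [simp]: "pdy (F - G) = pdy F - pdy G"
  by (rule cps2_eqI) (simp add: coef_pdy algebra_simps)

lemma pdx_mult: "pdx (F * G) = pdx F * G + F * pdx G"
  by transfer (simp add: fps2_dx_def add.commute)

lemma pdy_mult: "pdy (F * G) = pdy F * G + F * pdy G"
proof (transfer)
  fix F G :: "complex fps fps"
  show "fps2_dy (F * G) = fps2_dy F * G + F * fps2_dy G"
  proof (rule fps_ext)
    fix i
    have "fps_nth (fps2_dy (F * G)) i = (\<Sum>k=0..i. fps_deriv (fps_nth F k * fps_nth G (i - k)))"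
      by (simp add: fps2_dy_def fps_mult_nth fps_deriv_sum)
    then show "fps_nth (fps2_dy (F * G)) i = fps_nth (fps2_dy F * G + F * fps2_dy G) i"
      by (simp add: fps2_dy_def fps_mult_nth sum.distrib)
  qed
qed

lemma pdx_const [simp]: "pdx (const c) = 0" and pdy_const [simp]: "pdy (const c) = 0"
  by (rule cps2_eqI; simp add: coef_pdx coef_pdy coef_const)+

lemma pdx_of_nat [simp]: "pdx (of_nat k) = 0" and pdy_of_nat [simp]: "pdy (of_nat k) = 0"
  by (simp_all flip: const_of_nat)

lemma pdx_numeral [simp]: "pdx (numeral k) = 0" and pdy_numeral [simp]: "pdy (numeral k) = 0"
  by (simp_all flip: const_numeral)

lemma pdx_0 [simp]: "pdx 0 = 0" and pdy_0 [simp]: "pdy 0 = 0"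
  using pdx_const[of 0] pdy_const[of 0] by simp_all

lemma pdx_1 [simp]: "pdx 1 = 0" and pdy_1 [simp]: "pdy 1 = 0"
  using pdx_const[of 1] pdy_const[of 1] by simp_all

lemma pdx_uminus [simp]: "pdx (- F) = - pdx F" and pdy_uminus [simp]: "pdy (- F) = - pdy F"
  using pdx_diff[of 0 F] pdy_diff[of 0 F] by simp_all

lemma pd_var [simp]: "pdx var_x = 1" "pdx var_y = 0" "pdy var_x = 0" "pdy var_y = 1"
  by (rule cps2_eqI; simp add: coef_pdx coef_pdy coef_var_x coef_var_y coef_1; fail)+

lemma pdx_power: "pdx (F ^ k) = of_nat k * F ^ (k - 1) * pdx F"
proof (induction k)
  case (Suc k)
  then show ?case by (cases k) (simp_all add: pdx_mult algebra_simps)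
qed simp

lemma pdy_power: "pdy (F ^ k) = of_nat k * F ^ (k - 1) * pdy F"
proof (induction k)
  case (Suc k)
  then show ?case by (cases k) (simp_all add: pdy_mult algebra_simps)
qed simp

lemma ord_ge_pdx: "ord_ge (Suc N) F \<Longrightarrow> ord_ge N (pdx F)"
  and ord_ge_pdy: "ord_ge (Suc N) F \<Longrightarrow> ord_ge N (pdy F)"
  by (auto simp: ord_ge_def coef_pdx coef_pdy)

section \<open>Substitution\<close>

subsection \<open>Convergence\<close>

text \<open>The pairs with i + j \<le> n lie in the square with both indices at most n, and all
  terms are nonnegative. This makes the weighted norms below submultiplicative already on partial
  sums.\<close>

lemma Cauchy_product_partial_sums_le:
  fixes a b :: "nat \<Rightarrow> real"
  assumes "\<And>i. a i \<ge> 0" "\<And>i. b i \<ge> 0"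
  shows "(\<Sum>j\<le>n. \<Sum>k\<le>j. a k * b (j - k)) \<le> (\<Sum>k\<le>n. a k) * (\<Sum>k\<le>n. b k)"
proof -
  have "(\<Sum>j\<le>n. \<Sum>k\<le>j. a k * b (j - k)) = (\<Sum>(i,j)\<in>{(i,j). i + j \<le> n}. a i * b j)"
    by (rule sum.triangle_reindex_eq[symmetric])
  also have "\<dots> \<le> (\<Sum>(i,j)\<in>{..n} \<times> {..n}. a i * b j)"
    using assms by (intro sum_mono2) auto
  also have "\<dots> = (\<Sum>k\<le>n. a k) * (\<Sum>k\<le>n. b k)"
    by (simp add: sum_product sum.cartesian_product)
  finally show ?thesis .
qed

text \<open>An upper bound on a submultiplicative weighted norm, stated through partial sums so that no
  summability has to be proved.\<close>

definition norm_le2 :: "real \<Rightarrow> cps2 \<Rightarrow> real \<Rightarrow> bool" where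
  "norm_le2 r F B \<longleftrightarrow> (\<forall>n. (\<Sum>a\<le>n. \<Sum>b\<le>n. norm (coef F a b) * r ^ (a + b)) \<le> B)"

lemma norm_le2_mult:
  assumes r: "r > 0" and F: "norm_le2 r F B" and G: "norm_le2 r G C"
  shows "norm_le2 r (F * G) (B * C)"
  unfolding norm_le2_def
proof
  fix n
  define u v where "u a b = norm (coef F a b) * r ^ (a + b)"
    and "v a b = norm (coef G a b) * r ^ (a + b)" for a b
  have nonneg: "u a b \<ge> 0" "v a b \<ge> 0" for a b using r by (auto simp: u_def v_def)
  have "norm (coef (F * G) a b) * r ^ (a + b) \<le> (\<Sum>k\<le>a. \<Sum>l\<le>b. u k l * v (a - k) (b - l))" for a b
  proof -
    have "norm (coef (F * G) a b) \<le> (\<Sum>k\<le>a. \<Sum>l\<le>b. norm (coef F k l * coef G (a - k) (b - l)))"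
      unfolding coef_mult by (intro sum_norm_le) simp
    then have "norm (coef (F * G) a b) * r ^ (a + b)
        \<le> (\<Sum>k\<le>a. \<Sum>l\<le>b. norm (coef F k l * coef G (a - k) (b - l))) * r ^ (a + b)"
      using r by (intro mult_right_mono) auto
    also have "\<dots> = (\<Sum>k\<le>a. \<Sum>l\<le>b. u k l * v (a - k) (b - l))"
      unfolding sum_distrib_right
    proof (intro sum.cong refl)
      fix k l assume "k \<in> {..a}" "l \<in> {..b}"
      then have "a + b = (k + l) + ((a - k) + (b - l))" by auto
      then have "r ^ (a + b) = r ^ (k + l) * r ^ ((a - k) + (b - l))" by (metis power_add)
      then show "norm (coef F k l * coef G (a - k) (b - l)) * r ^ (a + b)
          = u k l * v (a - k) (b - l)"
        by (simp add: u_def v_def norm_mult)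
    qed
    finally show ?thesis .
  qed
  then have "(\<Sum>a\<le>n. \<Sum>b\<le>n. norm (coef (F * G) a b) * r ^ (a + b))
      \<le> (\<Sum>a\<le>n. \<Sum>b\<le>n. \<Sum>k\<le>a. \<Sum>l\<le>b. u k l * v (a - k) (b - l))"
    by (intro sum_mono)
  also have "\<dots> = (\<Sum>a\<le>n. \<Sum>k\<le>a. \<Sum>b\<le>n. \<Sum>l\<le>b. u k l * v (a - k) (b - l))"
    by (intro sum.cong refl sum.swap)
  also have "\<dots> \<le> (\<Sum>a\<le>n. \<Sum>k\<le>a. (\<Sum>l\<le>n. u k l) * (\<Sum>l\<le>n. v (a - k) l))"
    using nonneg by (intro sum_mono Cauchy_product_partial_sums_le) auto
  also have "\<dots> \<le> (\<Sum>k\<le>n. \<Sum>l\<le>n. u k l) * (\<Sum>k\<le>n. \<Sum>l\<le>n. v k l)"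
    using nonneg by (intro Cauchy_product_partial_sums_le sum_nonneg) auto
  also have "\<dots> \<le> B * C"
  proof (intro mult_mono)
    show "(\<Sum>k\<le>n. \<Sum>l\<le>n. u k l) \<le> B" "(\<Sum>k\<le>n. \<Sum>l\<le>n. v k l) \<le> C"
      using F G by (auto simp: norm_le2_def u_def v_def)
    then show "0 \<le> B" "0 \<le> (\<Sum>k\<le>n. \<Sum>l\<le>n. v k l)"
      using nonneg by (meson order_trans sum_nonneg)+
  qed
  finally show "(\<Sum>a\<le>n. \<Sum>b\<le>n. norm (coef (F * G) a b) * r ^ (a + b)) \<le> B * C" .
qed

lemma norm_le2_power:
  assumes "r > 0" "norm_le2 r F B"
  shows "norm_le2 r (F ^ k) (B ^ k)"
proof (induction k)
  case 0
  have "(\<Sum>a\<le>n. \<Sum>b\<le>n. norm (coef 1 a b) * r ^ (a + b)) = 1" for n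
  proof -
    have "norm (coef 1 a b) * r ^ (a + b) = (if a = 0 then if b = 0 then 1 else 0 else 0)" for a b
      by (simp add: coef_1)
    then have "(\<Sum>a\<le>n. \<Sum>b\<le>n. norm (coef 1 a b) * r ^ (a + b))
        = (\<Sum>a\<le>n. if a = 0 then (\<Sum>b\<le>n. if b = 0 then 1 else 0) else 0)"
      by (intro sum.cong refl) simp
    then show ?thesis by simp
  qed
  then show ?case by (simp add: norm_le2_def)
qed (use assms in \<open>auto intro: norm_le2_mult\<close>)

lemma norm_le2_coef:
  assumes "r > 0" "norm_le2 r F B"
  shows "norm (coef F a b) * r ^ (a + b) \<le> B"
proof -
  define n where "n = max a b"
  have "norm (coef F a b) * r ^ (a + b) \<le> (\<Sum>b\<le>n. norm (coef F a b) * r ^ (a + b))"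
    using assms(1) by (intro member_le_sum) (auto simp: n_def)
  also have "\<dots> \<le> (\<Sum>a\<le>n. \<Sum>b\<le>n. norm (coef F a b) * r ^ (a + b))"
    using assms(1)
    by (intro member_le_sum[where f = "\<lambda>a. \<Sum>b\<le>n. norm (coef F a b) * r ^ (a + b)"] sum_nonneg)
      (auto simp: n_def)
  also have "\<dots> \<le> B" using assms(2) by (simp add: norm_le2_def)
  finally show ?thesis .
qed

lemma sum_sum_mult_left:
  fixes c :: "'a::comm_semiring_0"
  shows "(\<Sum>i\<in>A. \<Sum>j\<in>B. c * (f i * g j)) = c * ((\<Sum>i\<in>A. f i) * (\<Sum>j\<in>B. g j))"
  unfolding sum_distrib_left[symmetric] sum_distrib_right[symmetric] ..

lemma sum_sum_delta:
  fixes c :: "'a::semiring_0" and k l n :: nat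
  shows "(\<Sum>i\<le>n. \<Sum>j\<le>n. (if i = k \<and> j = l then c else 0) * f i j)
    = (if k \<le> n \<and> l \<le> n then c * f k l else 0)"
proof -
  have "(\<Sum>i\<le>n. \<Sum>j\<le>n. (if i = k \<and> j = l then c else 0) * f i j)
      = (\<Sum>i\<le>n. \<Sum>j\<le>n. if j = l then if i = k then c * f i j else 0 else 0)"
    by (intro sum.cong refl) simp
  then show ?thesis by (cases "l \<le> n") auto
qed

lemma geometric_half_sum_le: "(\<Sum>i\<le>n. (1 / 2 :: real) ^ i) \<le> 2"
proof -
  have "(\<Sum>i\<le>n. (1 / 2 :: real) ^ i) = 2 - (1 / 2) ^ n"
    by (induction n) (simp_all add: field_simps)
  then show ?thesis by simp
qed

lemma convergent2_series: "convergent2 (series F)"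
  using series[of F] by simp

lemma coef_bound:
  obtains C R where "C \<ge> 0" "R \<ge> 1" "\<And>i j. norm (coef F i j) \<le> C * R ^ (i + j)"
  by (rule convergent2E[OF convergent2_series[of F]]) (auto simp: coef.rep_eq)

lemma coef_series: "fps_nth (fps_nth (series F) i) j = coef F i j"
  by (simp add: coef.rep_eq)

text \<open>Without a constant term, shrinking the radius by a factor \<epsilon> \<le> 1 multiplies
  every term by at most \<epsilon>. The bound is stated for all smaller radii so that one radius can
  serve two series at once.\<close>

lemma norm_le2_small:
  assumes X0: "coef X 0 0 = 0" and "\<rho> > 0"
  obtains r where "r > 0" "\<And>s. 0 < s \<Longrightarrow> s \<le> r \<Longrightarrow> norm_le2 s X \<rho>"
proof -
  obtain C R where C: "C \<ge> 0" and R: "R \<ge> 1" and b: "\<And>i j. norm (coef X i j) \<le> C * R ^ (i + j)"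
    by (rule coef_bound[of X]) blast
  define t where "t = 1 / (2 * R)"
  have t: "t > 0" using R by (simp add: t_def)
  have base: "(\<Sum>a\<le>n. \<Sum>b\<le>n. norm (coef X a b) * t ^ (a + b)) \<le> 4 * C" for n
  proof -
    have "(\<Sum>a\<le>n. \<Sum>b\<le>n. norm (coef X a b) * t ^ (a + b))
        \<le> (\<Sum>a\<le>n. \<Sum>b\<le>n. (C * R ^ (a + b)) * t ^ (a + b))"
      using t by (intro sum_mono mult_right_mono b) auto
    also have "\<dots> = C * ((\<Sum>a\<le>n. (1/2) ^ a) * (\<Sum>b\<le>n. (1/2) ^ b))"
      unfolding sum_sum_mult_left[symmetric] using R
      by (intro sum.cong refl) (simp add: t_def power_add power_mult_distrib power_divide)
    also have "\<dots> \<le> C * (2 * 2)"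
      using C by (intro mult_left_mono mult_mono geometric_half_sum_le sum_nonneg) auto
    finally show ?thesis by simp
  qed
  \<comment> \<open>4C bounds the norm at radius t. The + 1 keeps the quotient defined for C = 0,
    and the cap 1 bounds the higher powers of \<epsilon> by \<epsilon>.\<close>
  define \<epsilon> where "\<epsilon> = min 1 (\<rho> / (4 * C + 1))"
  have \<epsilon>: "\<epsilon> > 0" "\<epsilon> \<le> 1" using C \<open>\<rho> > 0\<close> by (auto simp: \<epsilon>_def)
  show thesis
  proof (rule that[of "\<epsilon> * t"])
    fix s assume s: "0 < s" "s \<le> \<epsilon> * t"
    show "norm_le2 s X \<rho>"
      unfolding norm_le2_def
    proof
      fix n
      have "norm (coef X a b) * s ^ (a + b) \<le> \<epsilon> * (norm (coef X a b) * t ^ (a + b))" for a b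
      proof (cases "a + b")
        case (Suc k)
        have "s ^ (a + b) \<le> (\<epsilon> * t) ^ (a + b)" using s by (intro power_mono) auto
        also have "\<dots> = \<epsilon> ^ Suc k * t ^ (a + b)" by (simp add: power_mult_distrib Suc)
        also have "\<dots> \<le> \<epsilon> * t ^ (a + b)"
          using \<epsilon> t by (intro mult_right_mono) (auto simp: mult_le_cancel_left1 power_le_one)
        finally have "s ^ (a + b) \<le> \<epsilon> * t ^ (a + b)" .
        then have "norm (coef X a b) * s ^ (a + b) \<le> norm (coef X a b) * (\<epsilon> * t ^ (a + b))"
          by (intro mult_left_mono) auto
        then show ?thesis by (simp add: mult_ac)
      qed (use X0 in simp)
      then have "(\<Sum>a\<le>n. \<Sum>b\<le>n. norm (coef X a b) * s ^ (a + b))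
          \<le> \<epsilon> * (\<Sum>a\<le>n. \<Sum>b\<le>n. norm (coef X a b) * t ^ (a + b))"
        unfolding sum_distrib_left by (intro sum_mono)
      also have "\<dots> \<le> \<epsilon> * (4 * C)" using \<epsilon> base by (intro mult_left_mono) auto
      also have "\<dots> \<le> \<rho> / (4 * C + 1) * (4 * C)"
        using C by (intro mult_right_mono) (auto simp: \<epsilon>_def)
      also have "\<dots> \<le> \<rho>" using C \<open>\<rho> > 0\<close> by (simp add: field_simps)
      finally show "(\<Sum>a\<le>n. \<Sum>b\<le>n. norm (coef X a b) * s ^ (a + b)) \<le> \<rho>" .
    qed
  qed (use \<epsilon> t in auto)
qed

text \<open>At a radius where X and Y have norm at most 1/(2R), the monomial X^i Y^j has norm at
  most (1/(2R))^(i+j). This beats the growth C R^(i+j) of the coefficients of h and leaves a product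
  of two geometric series.\<close>

lemma convergent2_substitute:
  assumes "coef X 0 0 = 0" "coef Y 0 0 = 0"
  shows "convergent2 (substitute h X Y)"
proof -
  obtain C R where C: "C \<ge> 0" and R: "R \<ge> 1" and b: "\<And>i j. norm (coef h i j) \<le> C * R ^ (i + j)"
    by (rule coef_bound[of h]) blast
  define \<rho> where "\<rho> = 1 / (2 * R)"
  have \<rho>: "\<rho> > 0" using R by (simp add: \<rho>_def)
  obtain r1 where r1: "r1 > 0" "\<And>s. 0 < s \<Longrightarrow> s \<le> r1 \<Longrightarrow> norm_le2 s X \<rho>"
    by (rule norm_le2_small[OF assms(1) \<rho>]) blast
  obtain r2 where r2: "r2 > 0" "\<And>s. 0 < s \<Longrightarrow> s \<le> r2 \<Longrightarrow> norm_le2 s Y \<rho>"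
    by (rule norm_le2_small[OF assms(2) \<rho>]) blast
  define r where "r = min 1 (min r1 r2)"
  have r: "r > 0" "r \<le> 1" and XY: "norm_le2 r X \<rho>" "norm_le2 r Y \<rho>"
    using r1 r2 by (auto simp: r_def)
  show ?thesis
  proof (rule convergent2I[of "4 * C" "1 / r"])
    fix a b' :: nat
    define n where "n = a + b'"
    have m: "norm (coef (X ^ i * Y ^ j) a b') \<le> \<rho> ^ i * \<rho> ^ j * (1 / r) ^ n" for i j
    proof -
      have "norm (coef (X ^ i * Y ^ j) a b') * r ^ n \<le> \<rho> ^ i * \<rho> ^ j"
        unfolding n_def
        using norm_le2_coef[OF r(1) norm_le2_mult[OF r(1) norm_le2_power[OF r(1) XY(1)]
              norm_le2_power[OF r(1) XY(2)]]] .
      then show ?thesis using r by (simp add: field_simps)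
    qed
    have "norm (fps_nth (fps_nth (substitute h X Y) a) b')
        \<le> (\<Sum>i\<le>n. \<Sum>j\<le>n. (C * R ^ (i + j)) * (\<rho> ^ i * \<rho> ^ j * (1 / r) ^ n))"
      unfolding substitute_def fps_nth_Abs_fps n_def[symmetric]
      using C R by (intro sum_norm_le) (auto simp: norm_mult intro!: mult_mono b m)
    also have "\<dots> = (\<Sum>i\<le>n. \<Sum>j\<le>n. C * ((1/2) ^ i * (1/2) ^ j)) * (1 / r) ^ n"
      unfolding sum_distrib_right using R
      by (intro sum.cong refl) (simp add: \<rho>_def power_add power_mult_distrib power_divide)
    also have "\<dots> = C * ((\<Sum>i\<le>n. (1/2) ^ i) * (\<Sum>j\<le>n. (1/2) ^ j)) * (1 / r) ^ n"
      by (simp only: sum_sum_mult_left)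
    also have "\<dots> \<le> C * (2 * 2) * (1 / r) ^ n"
      using C r
      by (intro mult_right_mono mult_left_mono mult_mono geometric_half_sum_le sum_nonneg) auto
    finally show "norm (fps_nth (fps_nth (substitute h X Y) a) b') \<le> 4 * C * (1 / r) ^ (a + b')"
      by (simp add: n_def)
  qed (use C r in auto)
qed

subsection \<open>Substitution as a ring homomorphism\<close>

text \<open>Intended for X and Y without constant term, where \<open>substitute h X Y\<close> is
  known to converge; the context below fixes this situation.\<close>

definition subst :: "cps2 \<Rightarrow> cps2 \<Rightarrow> cps2 \<Rightarrow> cps2" where
  "subst h X Y = Abs_cps2 (substitute h X Y)"

lemma coef_eq_0_of_order: "ord_ge N F \<Longrightarrow> a + b < N \<Longrightarrow> coef F a b = 0"
  by (simp add: ord_ge_def)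

context
  fixes X Y :: cps2
  assumes X0: "coef X 0 0 = 0" and Y0: "coef Y 0 0 = 0"
begin

lemma series_subst: "series (subst h X Y) = substitute h X Y"
  unfolding subst_def using convergent2_substitute[OF X0 Y0] by (simp add: Abs_cps2_inverse)

lemma coef_subst:
  "coef (subst h X Y) a b = (\<Sum>i\<le>a + b. \<Sum>j\<le>a + b. coef h i j * coef (X ^ i * Y ^ j) a b)"
  by (simp add: coef.rep_eq series_subst substitute_def)

lemma ord_ge_monomial: "ord_ge (i + j) (X ^ i * Y ^ j)"
  using X0 Y0 by (intro ord_ge_mult ord_ge_power)

lemma subst_add: "subst (F + G) X Y = subst F X Y + subst G X Y"
  by (rule cps2_eqI) (simp add: coef_subst algebra_simps sum.distrib)

lemma ord_ge_subst: "ord_ge N F \<Longrightarrow> ord_ge N (subst F X Y)"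
  unfolding ord_ge_def[of N "subst F X Y"]
proof (intro allI impI)
  fix a b assume F: "ord_ge N F" and ab: "a + b < N"
  have "coef F i j * coef (X ^ i * Y ^ j) a b = 0" for i j
    using F ab coef_eq_0_of_order[OF ord_ge_monomial[of i j], of a b]
    by (cases "i + j < N") (auto simp: ord_ge_def)
  then show "coef (subst F X Y) a b = 0"
    unfolding coef_subst by (intro sum.neutral ballI)
qed

lemma subst_monomial: "subst (const c * (var_x ^ k * var_y ^ l)) X Y = const c * (X ^ k * Y ^ l)"
proof (rule cps2_eqI)
  fix a b :: nat
  define n where "n = a + b"
  have "coef (subst (const c * (var_x ^ k * var_y ^ l)) X Y) a b
      = (if k \<le> n \<and> l \<le> n then c * coef (X ^ k * Y ^ l) a b else 0)"
    unfolding coef_subst coef_monomial n_def by (rule sum_sum_delta)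
  also have "\<dots> = c * coef (X ^ k * Y ^ l) a b"
    using coef_eq_0_of_order[OF ord_ge_monomial[of k l], of a b] by (auto simp: n_def)
  finally show "coef (subst (const c * (var_x ^ k * var_y ^ l)) X Y) a b
      = coef (const c * (X ^ k * Y ^ l)) a b" by simp
qed

text \<open>The defect of multiplicativity is additive and continuous in each argument, so density
  is applied twice: with a monomial on the left, and then with an arbitrary left factor.\<close>

lemma subst_mult: "subst (F * G) X Y = subst F X Y * subst G X Y"
proof (rule cps2_eqI)
  fix a b :: nat
  define T where "T F G = coef (subst (F * G) X Y - subst F X Y * subst G X Y) a b" for F G
  have small: "T F G = 0" if "ord_ge (Suc (a + b)) F \<or> ord_ge (Suc (a + b)) G" for F G
  proof -
    have FG: "ord_ge (Suc (a + b)) (F * G)"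
      using that by (auto intro: ord_ge_mult_right ord_ge_mult_left)
    have "ord_ge (Suc (a + b)) (subst F X Y * subst G X Y)"
      using that by (auto intro: ord_ge_mult_right ord_ge_mult_left ord_ge_subst)
    then show ?thesis using ord_ge_subst[OF FG] by (simp add: T_def ord_ge_def)
  qed
  have mono: "T (const c * (var_x ^ i * var_y ^ j)) (const d * (var_x ^ k * var_y ^ l)) = 0"
    for c d i j k l
  proof -
    have "const c * (var_x ^ i * var_y ^ j) * (const d * (var_x ^ k * var_y ^ l))
        = const (c * d) * (var_x ^ (i + k) * var_y ^ (j + l))"
      by (simp add: const_mult power_add mult_ac)
    then have *: "subst (const c * (var_x ^ i * var_y ^ j) * (const d * (var_x ^ k * var_y ^ l))) X Y
        = const (c * d) * (X ^ (i + k) * Y ^ (j + l))" by (simp only: subst_monomial)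
    show ?thesis unfolding T_def subst_monomial * by (simp add: const_mult power_add mult_ac)
  qed
  have add: "T F (G + H) = T F G + T F H" "T (F + G) H = T F H + T G H" for F G H
    by (simp_all add: T_def subst_add algebra_simps)
  have "T (const c * (var_x ^ i * var_y ^ j)) G = 0" for c i j
    by (rule additive_eq_0_by_density[where T = "T (const c * (var_x ^ i * var_y ^ j))"
          and N = "Suc (a + b)"]) (auto intro: mono small add)
  have "T F G = 0"
    by (rule additive_eq_0_by_density[where T = "\<lambda>F. T F G" and N = "Suc (a + b)"])
      (auto intro: small add \<open>\<And>c i j. T (const c * (var_x ^ i * var_y ^ j)) G = 0\<close>)
  then show "coef (subst (F * G) X Y) a b = coef (subst F X Y * subst G X Y) a b"
    by (simp add: T_def)
qed

lemma subst_const: "subst (const c) X Y = const c"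
  using subst_monomial[of c 0 0] by simp

lemma subst_var_x: "subst var_x X Y = X"
  using subst_monomial[of 1 1 0] by simp

lemma subst_var_y: "subst var_y X Y = Y"
  using subst_monomial[of 1 0 1] by simp

lemma subst_0: "subst 0 X Y = 0"
  using subst_const[of 0] by simp

lemma subst_1: "subst 1 X Y = 1"
  using subst_const[of 1] by simp

lemma subst_uminus: "subst (- F) X Y = - subst F X Y"
  using subst_add[of F "- F"] by (simp add: subst_0 minus_unique)

lemma subst_diff: "subst (F - G) X Y = subst F X Y - subst G X Y"
  using subst_add[of F "- G"] by (simp add: subst_uminus)

lemma subst_power: "subst (F ^ k) X Y = subst F X Y ^ k"
  by (induction k) (simp_all add: subst_1 subst_mult)

lemma coef_subst_00: "coef (subst F X Y) 0 0 = coef F 0 0"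
  by (simp add: coef_subst coef_1)

lemma subst_dvd: "F dvd G \<Longrightarrow> subst F X Y dvd subst G X Y"
  by (auto simp: dvd_def subst_mult)

lemma subst_unit: "is_unit F \<Longrightarrow> is_unit (subst F X Y)"
  using subst_dvd[of F 1] by (simp add: subst_1)

text \<open>Both maps have the same values on monomials and respect the filtration, so density
  applies to their difference. The identity law and the composition law follow without any
  comparison of coefficient sums.\<close>

lemma subst_eqI:
  assumes "\<And>F G. \<Phi> (F + G) = \<Phi> F + \<Phi> G" "\<And>N F. ord_ge N F \<Longrightarrow> ord_ge N (\<Phi> F)"
    and "\<And>c i j. \<Phi> (const c * (var_x ^ i * var_y ^ j)) = const c * (X ^ i * Y ^ j)"
  shows "\<Phi> F = subst F X Y"
proof (rule cps2_eqI)
  fix a b :: nat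
  have "coef (\<Phi> F - subst F X Y) a b = 0"
  proof (rule additive_eq_0_by_density[where T = "\<lambda>F. coef (\<Phi> F - subst F X Y) a b"])
    fix F assume "ord_ge (Suc (a + b)) F"
    then have "ord_ge (Suc (a + b)) (\<Phi> F)" "ord_ge (Suc (a + b)) (subst F X Y)"
      by (auto intro: assms ord_ge_subst)
    then show "coef (\<Phi> F - subst F X Y) a b = 0" by (simp add: ord_ge_def)
  qed (simp_all add: assms subst_add subst_monomial)
  then show "coef (\<Phi> F) a b = coef (subst F X Y) a b" by simp
qed

lemma chain_rule:
  assumes D: "D = pdx \<or> D = pdy"
  shows "D (subst F X Y) = subst (pdx F) X Y * D X + subst (pdy F) X Y * D Y"
proof (rule cps2_eqI)
  fix a b :: nat
  have D_add: "D (F + G) = D F + D G" and D_mult: "D (F * G) = D F * G + F * D G"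
    and D_const: "D (const c) = 0" and D_ord: "ord_ge (Suc N) F \<Longrightarrow> ord_ge N (D F)" for F G c N
    using D by (auto simp: pdx_mult pdy_mult ord_ge_pdx ord_ge_pdy)
  define ok where
    "ok F \<longleftrightarrow> D (subst F X Y) = subst (pdx F) X Y * D X + subst (pdy F) X Y * D Y" for F
  have ok_mult: "ok (F * G)" if "ok F" "ok G" for F G
    using that unfolding ok_def
    by (simp add: subst_mult subst_add pdx_mult pdy_mult D_mult algebra_simps)
  have ok1: "ok 1" unfolding ok_def using D_const[of 1] by (simp add: subst_0 subst_1)
  have "ok var_x" "ok var_y" unfolding ok_def by (simp_all add: subst_0 subst_1 subst_var_x subst_var_y)
  then have "ok (var_x ^ i)" "ok (var_y ^ i)" for i
    by (induction i) (simp_all add: ok1 ok_mult)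
  moreover have "ok (const c)" for c
    unfolding ok_def by (simp add: subst_const subst_0 D_const)
  ultimately have mono: "ok (const c * (var_x ^ i * var_y ^ j))" for c i j
    by (intro ok_mult)
  define T where
    "T F = coef (D (subst F X Y) - (subst (pdx F) X Y * D X + subst (pdy F) X Y * D Y)) a b" for F
  have "T F = 0"
  proof (rule additive_eq_0_by_density[where T = T])
    \<comment> \<open>A derivation lowers the order by one, so one more degree is required here than
      for the other laws.\<close>
    fix F assume "ord_ge (Suc (Suc (a + b))) F"
    then have "ord_ge (Suc (a + b)) (D (subst F X Y))"
      "ord_ge (Suc (a + b)) (subst (pdx F) X Y * D X)"
      "ord_ge (Suc (a + b)) (subst (pdy F) X Y * D Y)"
      by (auto intro!: D_ord ord_ge_subst ord_ge_mult_right ord_ge_pdx ord_ge_pdy)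
    then show "T F = 0" by (simp add: T_def ord_ge_def)
  next
    show "T (const c * (var_x ^ i * var_y ^ j)) = 0" for c i j
      using mono[of c i j] by (simp add: T_def ok_def)
  qed (simp add: T_def subst_add D_add algebra_simps)
  then show "coef (D (subst F X Y)) a b
      = coef (subst (pdx F) X Y * D X + subst (pdy F) X Y * D Y) a b" by (simp add: T_def)
qed

end

lemma subst_id: "subst F var_x var_y = F"
  by (rule subst_eqI[symmetric, where \<Phi> = "\<lambda>F. F"]) (auto simp: coef_var_x coef_var_y)

lemma subst_subst:
  assumes XY: "coef X 0 0 = 0" "coef Y 0 0 = 0" and UV: "coef U 0 0 = 0" "coef V 0 0 = 0"
  shows "subst (subst F X Y) U V = subst F (subst X U V) (subst Y U V)"
proof (rule subst_eqI[where \<Phi> = "\<lambda>F. subst (subst F X Y) U V"])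
  show "ord_ge N (subst (subst F X Y) U V)" if "ord_ge N F" for N F
    by (intro ord_ge_subst UV XY that)
qed (simp_all add: XY UV coef_subst_00 subst_add subst_monomial subst_mult subst_const subst_power
    subst_var_x subst_var_y)

subsection \<open>Units\<close>

lift_definition geometric_x :: cps2 is "Abs_fps (\<lambda>_. 1)"
  by (rule convergent2I[of 1 1]) auto

lemma geometric_x_mult: "geometric_x * (1 - var_x) = 1"
proof (rule cps2_eqI)
  fix i j
  have c: "coef geometric_x i j = (if j = 0 then 1 else 0)" for i j
    by transfer simp
  have "geometric_x * (1 - var_x) = geometric_x - var_x * geometric_x"
    by (simp add: algebra_simps)
  then show "coef (geometric_x * (1 - var_x)) i j = coef 1 i j"
    by (auto simp: c coef_x_mult coef_1)
qed

text \<open>If c is the nonzero constant term, then F = c (1 - X) with X free of constant term, and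
  1/(1 - X) is the geometric series evaluated at X. Its convergence is that of substitution.\<close>

lemma is_unit_iff: "is_unit F \<longleftrightarrow> coef F 0 0 \<noteq> 0"
proof
  assume "is_unit F"
  then obtain G where "1 = F * G" by (auto simp: dvd_def)
  then have "coef F 0 0 * coef G 0 0 = 1" by (metis coef_mult_00 coef_1)
  then show "coef F 0 0 \<noteq> 0" by auto
next
  assume F: "coef F 0 0 \<noteq> 0"
  define c where "c = coef F 0 0"
  define X where "X = 1 - const (1 / c) * F"
  have X: "coef X 0 0 = 0" using F by (simp add: X_def c_def coef_1)
  have "subst geometric_x X 0 * (1 - X) = 1"
    using arg_cong[OF geometric_x_mult, of "\<lambda>h. subst h X 0"] X
    by (simp add: subst_mult subst_diff subst_1 subst_var_x)
  then have "F * (subst geometric_x X 0 * const (1 / c)) = 1"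
    by (simp add: X_def mult_ac)
  then show "is_unit F" by (metis dvd_triv_left)
qed

lemma is_unit_obtain:
  assumes "is_unit F"
  obtains G where "F * G = 1"
  using assms by (metis dvdE)

section \<open>Pullback along a parametrized curve\<close>

context
  fixes x y :: "complex fps"
  assumes x0: "fps_nth x 0 = 0" and y0: "fps_nth y 0 = 0"
begin

lemma nth_monomial_eq_0: "k < i + j \<Longrightarrow> fps_nth (x ^ i * y ^ j) k = 0"
proof -
  assume k: "k < i + j"
  have "fps_nth (x ^ i) a * fps_nth (y ^ j) (k - a) = 0" if "a \<le> k" for a
    using k that startsby_zero_power_prefix[OF x0, of i] startsby_zero_power_prefix[OF y0, of j]
    by (cases "a < i") auto
  then show ?thesis unfolding fps_mult_nth by (intro sum.neutral) auto
qed

lemma pullback_add: "pullback (F + G) x y = pullback F x y + pullback G x y"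
  by (rule fps_ext) (simp add: pullback_def algebra_simps sum.distrib)

lemma pullback_nth_eq_0:
  assumes "ord_ge N F" "k < N"
  shows "fps_nth (pullback F x y) k = 0"
proof -
  have "coef F i j * fps_nth (x ^ i * y ^ j) k = 0" for i j
    using assms nth_monomial_eq_0[of k i j] by (cases "i + j < N") (auto simp: ord_ge_def)
  then show ?thesis unfolding pullback_def fps_nth_Abs_fps by (intro sum.neutral ballI)
qed

lemma pullback_monomial:
  "pullback (const c * (var_x ^ k * var_y ^ l)) x y = fps_const c * (x ^ k * y ^ l)"
proof (rule fps_ext)
  fix n
  have "fps_nth (pullback (const c * (var_x ^ k * var_y ^ l)) x y) n
      = (if k \<le> n \<and> l \<le> n then c * fps_nth (x ^ k * y ^ l) n else 0)"
    unfolding pullback_def fps_nth_Abs_fps coef_monomial by (rule sum_sum_delta)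
  also have "\<dots> = c * fps_nth (x ^ k * y ^ l) n"
    using nth_monomial_eq_0[of n k l] by auto
  finally show "fps_nth (pullback (const c * (var_x ^ k * var_y ^ l)) x y) n
      = fps_nth (fps_const c * (x ^ k * y ^ l)) n" by simp
qed

lemma pullback_mult: "pullback (F * G) x y = pullback F x y * pullback G x y"
proof (rule fps_ext)
  fix n
  define T where "T F G = fps_nth (pullback (F * G) x y - pullback F x y * pullback G x y) n" for F G
  have small: "T F G = 0" if "ord_ge (Suc n) F \<or> ord_ge (Suc n) G" for F G
  proof -
    have FG: "ord_ge (Suc n) (F * G)"
      using that by (auto intro: ord_ge_mult_right ord_ge_mult_left)
    have "fps_nth (pullback F x y) i * fps_nth (pullback G x y) (n - i) = 0" if "i \<le> n" for i
      using that \<open>ord_ge (Suc n) F \<or> ord_ge (Suc n) G\<close> pullback_nth_eq_0[of "Suc n" F i]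
        pullback_nth_eq_0[of "Suc n" G "n - i"] by (auto simp: less_Suc_eq_le)
    then have "fps_nth (pullback F x y * pullback G x y) n = 0"
      unfolding fps_mult_nth by (intro sum.neutral) auto
    then show ?thesis using pullback_nth_eq_0[OF FG, of n] by (simp add: T_def)
  qed
  have mono: "T (const c * (var_x ^ i * var_y ^ j)) (const d * (var_x ^ k * var_y ^ l)) = 0"
    for c d i j k l
  proof -
    have "const c * (var_x ^ i * var_y ^ j) * (const d * (var_x ^ k * var_y ^ l))
        = const (c * d) * (var_x ^ (i + k) * var_y ^ (j + l))"
      by (simp add: const_mult power_add mult_ac)
    then have *: "pullback (const c * (var_x ^ i * var_y ^ j) * (const d * (var_x ^ k * var_y ^ l))) x y
        = fps_const (c * d) * (x ^ (i + k) * y ^ (j + l))" by (simp only: pullback_monomial)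
    show ?thesis unfolding T_def pullback_monomial *
      by (simp add: power_add mult_ac flip: fps_const_mult)
  qed
  have add: "T F (G + H) = T F G + T F H" "T (F + G) H = T F H + T G H" for F G H
    by (simp_all add: T_def pullback_add algebra_simps)
  have "T (const c * (var_x ^ i * var_y ^ j)) G = 0" for c i j
    by (rule additive_eq_0_by_density[where T = "T (const c * (var_x ^ i * var_y ^ j))"
          and N = "Suc n"]) (auto intro: mono small add)
  have "T F G = 0"
    by (rule additive_eq_0_by_density[where T = "\<lambda>F. T F G" and N = "Suc n"])
      (auto intro: small add \<open>\<And>c i j. T (const c * (var_x ^ i * var_y ^ j)) G = 0\<close>)
  then show "fps_nth (pullback (F * G) x y) n = fps_nth (pullback F x y * pullback G x y) n"
    by (simp add: T_def)
qed

lemma pullback_const: "pullback (const c) x y = fps_const c"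
  using pullback_monomial[of c 0 0] by simp

lemma pullback_var_x: "pullback var_x x y = x"
  using pullback_monomial[of 1 1 0] by simp

lemma pullback_var_y: "pullback var_y x y = y"
  using pullback_monomial[of 1 0 1] by simp

lemma pullback_0: "pullback 0 x y = 0"
  using pullback_const[of 0] by simp

lemma pullback_1: "pullback 1 x y = 1"
  using pullback_const[of 1] by simp

lemma pullback_uminus: "pullback (- F) x y = - pullback F x y"
  using pullback_add[of F "- F"] by (simp add: pullback_0 minus_unique)

lemma pullback_diff: "pullback (F - G) x y = pullback F x y - pullback G x y"
  using pullback_add[of F "- G"] by (simp add: pullback_uminus)

lemma pullback_power: "pullback (F ^ k) x y = pullback F x y ^ k"
  by (induction k) (simp_all add: pullback_1 pullback_mult)

lemma pullback_nth_0: "fps_nth (pullback F x y) 0 = coef F 0 0"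
  by (simp add: pullback_def)

end

lemma pullback_swap:
  assumes x0: "fps_nth x 0 = 0" and y0: "fps_nth y 0 = 0"
  shows "pullback (subst F var_y var_x) y x = pullback F x y"
proof (rule fps_ext)
  fix n
  define T where "T F = fps_nth (pullback (subst F var_y var_x) y x - pullback F x y) n" for F
  have [simp]: "coef var_x 0 0 = 0" "coef var_y 0 0 = 0" by (simp_all add: coef_var_x coef_var_y)
  have "T F = 0"
  proof (rule additive_eq_0_by_density[where T = T])
    show "T (F + G) = T F + T G" for F G
      by (simp add: T_def subst_add pullback_add[OF y0 x0] pullback_add[OF x0 y0])
    show "T F = 0" if "ord_ge (Suc n) F" for F
      using that pullback_nth_eq_0[OF x0 y0 that, of n]
        pullback_nth_eq_0[OF y0 x0 ord_ge_subst[OF _ _ that], of var_y var_x n]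
      by (simp add: T_def)
    fix c i j
    have "subst (const c * (var_x ^ i * var_y ^ j)) var_y var_x = const c * (var_x ^ j * var_y ^ i)"
      by (subst subst_monomial) (simp_all add: mult_ac)
    then show "T (const c * (var_x ^ i * var_y ^ j)) = 0"
      by (simp add: T_def pullback_monomial[OF y0 x0] pullback_monomial[OF x0 y0] mult_ac)
  qed
  then show "fps_nth (pullback (subst F var_y var_x) y x) n = fps_nth (pullback F x y) n"
    by (simp add: T_def)
qed


section \<open>Weierstrass division\<close>

definition norm_le1 :: "real \<Rightarrow> complex fps \<Rightarrow> real \<Rightarrow> bool" where
  "norm_le1 s f B \<longleftrightarrow> (\<forall>n. (\<Sum>j\<le>n. norm (fps_nth f j) * s ^ j) \<le> B)"

lemma norm_le1_mult:
  assumes s: "s > 0" and f: "norm_le1 s f B" and g: "norm_le1 s g C"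
  shows "norm_le1 s (f * g) (B * C)"
  unfolding norm_le1_def
proof
  fix n
  define u v where "u j = norm (fps_nth f j) * s ^ j" and "v j = norm (fps_nth g j) * s ^ j" for j
  have nonneg: "u j \<ge> 0" "v j \<ge> 0" for j using s by (auto simp: u_def v_def)
  have "norm (fps_nth (f * g) j) * s ^ j \<le> (\<Sum>k\<le>j. u k * v (j - k))" for j
  proof -
    have "norm (fps_nth (f * g) j) \<le> (\<Sum>k\<le>j. norm (fps_nth f k * fps_nth g (j - k)))"
      unfolding fps_mult_nth atLeast0AtMost by (rule norm_sum)
    then have "norm (fps_nth (f * g) j) * s ^ j
        \<le> (\<Sum>k\<le>j. norm (fps_nth f k * fps_nth g (j - k))) * s ^ j"
      using s by (intro mult_right_mono) auto
    also have "\<dots> = (\<Sum>k\<le>j. u k * v (j - k))"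
      unfolding sum_distrib_right
    proof (intro sum.cong refl)
      fix k assume "k \<in> {..j}"
      then have "s ^ j = s ^ k * s ^ (j - k)" by (simp flip: power_add)
      then show "norm (fps_nth f k * fps_nth g (j - k)) * s ^ j = u k * v (j - k)"
        by (simp add: u_def v_def norm_mult)
    qed
    finally show ?thesis .
  qed
  then have "(\<Sum>j\<le>n. norm (fps_nth (f * g) j) * s ^ j) \<le> (\<Sum>j\<le>n. \<Sum>k\<le>j. u k * v (j - k))"
    by (intro sum_mono)
  also have "\<dots> \<le> (\<Sum>k\<le>n. u k) * (\<Sum>k\<le>n. v k)"
    using nonneg by (intro Cauchy_product_partial_sums_le)
  also have "\<dots> \<le> B * C"
  proof (intro mult_mono)
    show "(\<Sum>k\<le>n. u k) \<le> B" "(\<Sum>k\<le>n. v k) \<le> C"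
      using f g by (auto simp: norm_le1_def u_def v_def)
    then show "0 \<le> B" "0 \<le> (\<Sum>k\<le>n. v k)"
      using nonneg by (meson order_trans sum_nonneg)+
  qed
  finally show "(\<Sum>j\<le>n. norm (fps_nth (f * g) j) * s ^ j) \<le> B * C" .
qed

lemma norm_le1_0: "norm_le1 s 0 0"
  by (simp add: norm_le1_def)

lemma norm_le1_add:
  assumes "s > 0" "norm_le1 s f B" "norm_le1 s g C"
  shows "norm_le1 s (f + g) (B + C)"
  unfolding norm_le1_def
proof
  fix n
  have "(\<Sum>j\<le>n. norm (fps_nth (f + g) j) * s ^ j)
      \<le> (\<Sum>j\<le>n. norm (fps_nth f j) * s ^ j + norm (fps_nth g j) * s ^ j)"
    using assms(1)
    by (intro sum_mono) (simp add: norm_triangle_ineq mult_right_mono flip: distrib_right)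
  also have "\<dots> \<le> B + C"
    using assms(2,3) by (auto simp: norm_le1_def sum.distrib intro: add_mono)
  finally show "(\<Sum>j\<le>n. norm (fps_nth (f + g) j) * s ^ j) \<le> B + C" .
qed

lemma norm_le1_uminus: "norm_le1 s (- f) B = norm_le1 s f B"
  by (simp add: norm_le1_def)

lemma norm_le1_sum:
  assumes "s > 0" "\<And>k. k \<in> A \<Longrightarrow> norm_le1 s (f k) (B k)"
  shows "norm_le1 s (sum f A) (sum B A)"
  using assms(2)
  by (induction A rule: infinite_finite_induct) (auto intro: norm_le1_0 norm_le1_add assms(1))

lemma norm_le1_shift:
  assumes s: "s > 0" and f: "norm_le1 s f B"
  shows "norm_le1 s (fps_shift d f) (B / s ^ d)"
  unfolding norm_le1_def
proof
  fix n
  let ?h = "\<lambda>j. norm (fps_nth f j) * s ^ j"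
  have "(\<Sum>j\<le>n. norm (fps_nth (fps_shift d f) j) * s ^ j) * s ^ d = (\<Sum>j=0..n. ?h (j + d))"
    unfolding atLeast0AtMost sum_distrib_right by (intro sum.cong refl) (simp add: power_add)
  also have "\<dots> = (\<Sum>j=0+d..n+d. ?h j)"
    by (rule sum.shift_bounds_cl_nat_ivl[symmetric])
  also have "\<dots> \<le> (\<Sum>j\<le>n+d. ?h j)"
    using s by (intro sum_mono2) auto
  also have "\<dots> \<le> B" using f by (simp add: norm_le1_def)
  finally show "(\<Sum>j\<le>n. norm (fps_nth (fps_shift d f) j) * s ^ j) \<le> B / s ^ d"
    using s by (simp add: pos_le_divide_eq)
qed

lemma norm_le1_nth:
  assumes "s > 0" "norm_le1 s f B"
  shows "norm (fps_nth f j) \<le> B * (1 / s) ^ j"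
proof -
  have "norm (fps_nth f j) * s ^ j \<le> (\<Sum>j\<le>j. norm (fps_nth f j) * s ^ j)"
    using assms(1) by (intro member_le_sum) auto
  also have "\<dots> \<le> B" using assms(2) by (simp add: norm_le1_def)
  finally show ?thesis using assms(1) by (simp add: field_simps)
qed

lemma norm_le1_row:
  assumes C: "C \<ge> 0" and R: "R \<ge> 1" and b: "\<And>j. norm (fps_nth f j) \<le> C * R ^ (i + j)"
  shows "norm_le1 (1 / (2 * R)) f (2 * C * R ^ i)"
  unfolding norm_le1_def
proof
  fix n
  have "(\<Sum>j\<le>n. norm (fps_nth f j) * (1 / (2 * R)) ^ j)
      \<le> (\<Sum>j\<le>n. C * R ^ (i + j) * (1 / (2 * R)) ^ j)"
    using R by (intro sum_mono mult_right_mono b) auto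
  also have "\<dots> = C * R ^ i * (\<Sum>j\<le>n. (1 / 2) ^ j)"
    unfolding sum_distrib_left using R
    by (intro sum.cong refl) (simp add: power_add power_divide power_mult_distrib)
  also have "\<dots> \<le> C * R ^ i * 2"
    using C R by (intro mult_left_mono geometric_half_sum_le) auto
  finally show "(\<Sum>j\<le>n. norm (fps_nth f j) * (1 / (2 * R)) ^ j) \<le> 2 * C * R ^ i"
    by simp
qed

lemma series_mult_row:
  "fps_nth (series (F * G)) i = (\<Sum>k\<le>i. fps_nth (series F) k * fps_nth (series G) (i - k))"
  by (simp add: times_cps2.rep_eq fps_mult_nth atLeast0AtMost)

text \<open>The rows in x of the solution Q of Q + shift(Q w) = P, where the shift drops the powers
  of y below d and lowers the others by d. If row 0 of w vanishes, row i of Q w involves only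
  earlier rows of Q, so the equation determines Q row by row.\<close>

fun shift_recursion ::
  "nat \<Rightarrow> (nat \<Rightarrow> complex fps) \<Rightarrow> (nat \<Rightarrow> complex fps) \<Rightarrow> nat \<Rightarrow> complex fps" where
  "shift_recursion d P w i = P i - fps_shift d (\<Sum>k<i. shift_recursion d P w k * w (i - k))"

declare shift_recursion.simps [simp del]

text \<open>Geometric growth persists with a larger ratio. With E = C / s^d, the ratio L = R (1 + E)
  is chosen so that L - R = R E; the sum produced by the recursion is then exactly the one in the
  factorization of L^i - R^i.\<close>

lemma norm_le1_shift_recursion:
  assumes s: "s > 0" and P: "\<And>i. norm_le1 s (P i) (D * R ^ i)"
    and w: "\<And>i. norm_le1 s (w i) (C * R ^ i)"
  shows "norm_le1 s (shift_recursion d P w i) (D * (R * (1 + C / s ^ d)) ^ i)"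
proof (induction i rule: less_induct)
  case (less i)
  define E where "E = C / s ^ d"
  define L where "L = R * (1 + E)"
  have "norm_le1 s (P i + - fps_shift d (\<Sum>k<i. shift_recursion d P w k * w (i - k)))
      (D * R ^ i + (\<Sum>k<i. (D * L ^ k) * (C * R ^ (i - k))) / s ^ d)"
    using less unfolding L_def E_def
    by (intro norm_le1_add s P norm_le1_uminus[THEN iffD2] norm_le1_shift norm_le1_sum norm_le1_mult w)
      auto
  moreover have "D * R ^ i + (\<Sum>k<i. (D * L ^ k) * (C * R ^ (i - k))) / s ^ d = D * L ^ i"
  proof -
    have "L ^ i - R ^ i = (L - R) * (\<Sum>k<i. R ^ (i - Suc k) * L ^ k)"
      by (rule power_diff_sumr2)
    also have "\<dots> = (\<Sum>k<i. L ^ k * (E * R ^ (i - k)))"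
      unfolding sum_distrib_left
    proof (intro sum.cong refl)
      fix k assume "k \<in> {..<i}"
      then have "R ^ (i - k) = R * R ^ (i - Suc k)" by (simp flip: power_Suc add: Suc_diff_Suc)
      then show "(L - R) * (R ^ (i - Suc k) * L ^ k) = L ^ k * (E * R ^ (i - k))"
        by (simp add: L_def algebra_simps)
    qed
    finally have "L ^ i = R ^ i + (\<Sum>k<i. L ^ k * (E * R ^ (i - k)))" by simp
    moreover have "(\<Sum>k<i. (D * L ^ k) * (C * R ^ (i - k))) / s ^ d
        = D * (\<Sum>k<i. L ^ k * (E * R ^ (i - k)))"
      by (simp add: sum_distrib_left sum_divide_distrib E_def mult_ac)
    ultimately show ?thesis by (simp add: algebra_simps)
  qed
  ultimately show ?case
    by (simp add: shift_recursion.simps[of d P w i] L_def E_def)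
qed

text \<open>The recursion solves the equation formally. At the radius s = 1/(2R) the rows of P and w
  have norms that grow geometrically, so the estimate for the recursion makes the solution
  convergent.\<close>

lemma exists_shift_fixed_point:
  assumes w0: "\<And>j. coef w 0 j = 0"
  shows "\<exists>Q. \<forall>i j. coef Q i j + coef (Q * w) i (j + d) = coef P i j"
proof -
  obtain C1 R1 where 1: "C1 \<ge> 0" "R1 \<ge> 1" "\<And>i j. norm (coef P i j) \<le> C1 * R1 ^ (i + j)"
    by (rule coef_bound[of P]) blast
  obtain C2 R2 where 2: "C2 \<ge> 0" "R2 \<ge> 1" "\<And>i j. norm (coef w i j) \<le> C2 * R2 ^ (i + j)"
    by (rule coef_bound[of w]) blast
  define R where "R = max R1 R2"
  define s where "s = 1 / (2 * R)"
  have R: "R \<ge> 1" "R1 \<le> R" "R2 \<le> R" using 1 2 by (auto simp: R_def)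
  have s: "s > 0" using R by (simp add: s_def)
  have mono: "C * S ^ (i + j) \<le> C * R ^ (i + j)" if "C \<ge> 0" "S \<ge> 1" "S \<le> R" for C S and i j :: nat
    using that by (intro mult_left_mono power_mono) auto
  define Q where "Q = shift_recursion d (\<lambda>i. fps_nth (series P) i) (\<lambda>i. fps_nth (series w) i)"
  define L where "L = R * (1 + 2 * C2 / s ^ d)"
  have Q: "norm_le1 s (Q i) (2 * C1 * L ^ i)" for i
    unfolding Q_def L_def
  proof (rule norm_le1_shift_recursion[OF s])
    show "norm_le1 s (fps_nth (series P) i) (2 * C1 * R ^ i)" for i
      unfolding s_def
      by (rule norm_le1_row[OF 1(1) R(1)])
        (unfold coef_series, rule order_trans[OF 1(3) mono[OF 1(1,2) R(2)]])
    show "norm_le1 s (fps_nth (series w) i) (2 * C2 * R ^ i)" for i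
      unfolding s_def
      by (rule norm_le1_row[OF 2(1) R(1)])
        (unfold coef_series, rule order_trans[OF 2(3) mono[OF 2(1,2) R(3)]])
  qed
  have L: "L \<ge> 1" using R 2 s by (simp add: L_def mult_ge1_I)
  define T where "T = max L (1 / s)"
  have T: "T \<ge> 1" "L \<le> T" "1 / s \<le> T" using L by (auto simp: T_def)
  have conv: "convergent2 (Abs_fps Q)"
  proof (rule convergent2I[of "2 * C1" T])
    fix i j
    have "norm (fps_nth (Q i) j) \<le> 2 * C1 * L ^ i * (1 / s) ^ j"
      by (rule norm_le1_nth[OF s Q])
    also have "\<dots> \<le> 2 * C1 * T ^ i * T ^ j"
      using 1 L T s by (intro mult_mono mult_left_mono power_mono) auto
    finally show "norm (fps_nth (fps_nth (Abs_fps Q) i) j) \<le> 2 * C1 * T ^ (i + j)"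
      by (simp add: power_add mult_ac)
  qed (use 1 T in auto)
  define Q' where "Q' = Abs_cps2 (Abs_fps Q)"
  have sQ': "series Q' = Abs_fps Q" using conv by (simp add: Q'_def Abs_cps2_inverse)
  have w0': "fps_nth (series w) 0 = 0"
    by (rule fps_ext) (simp add: coef_series w0)
  have "coef Q' i j + coef (Q' * w) i (j + d) = coef P i j" for i j
  proof -
    have "fps_nth (series (Q' * w)) i = (\<Sum>k<i. Q k * fps_nth (series w) (i - k))"
      by (simp add: series_mult_row sQ' w0' flip: lessThan_Suc_atMost)
    then have "Q i = fps_nth (series P) i - fps_shift d (fps_nth (series (Q' * w)) i)"
      by (simp add: Q_def shift_recursion.simps[of _ _ _ i])
    then have "fps_nth (Q i) j = coef P i j - coef (Q' * w) i (j + d)"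
      by (simp add: coef.rep_eq)
    then show ?thesis by (simp add: coef.rep_eq[of Q'] sQ')
  qed
  then show ?thesis by blast
qed

lift_definition shift_x :: "nat \<Rightarrow> cps2 \<Rightarrow> cps2" is
  "\<lambda>d F. Abs_fps (\<lambda>i. fps_nth F (i + d))"
proof -
  fix d F assume "convergent2 F"
  then obtain C R where F: "C \<ge> 0" "R \<ge> 1" "\<And>i j. norm (fps_nth (fps_nth F i) j) \<le> C * R ^ (i + j)"
    by (rule convergent2E) blast
  show "convergent2 (Abs_fps (\<lambda>i. fps_nth F (i + d)))"
  proof (rule convergent2I[of "C * R ^ d" R])
    show "norm (fps_nth (fps_nth (Abs_fps (\<lambda>i. fps_nth F (i + d))) i) j) \<le> C * R ^ d * R ^ (i + j)"
      for i j using F(3)[of "i + d" j] by (simp add: power_add mult_ac)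
  qed (use F in auto)
qed

lift_definition shift_y :: "nat \<Rightarrow> cps2 \<Rightarrow> cps2" is
  "\<lambda>d F. Abs_fps (\<lambda>i. fps_shift d (fps_nth F i))"
proof -
  fix d F assume "convergent2 F"
  then obtain C R where F: "C \<ge> 0" "R \<ge> 1" "\<And>i j. norm (fps_nth (fps_nth F i) j) \<le> C * R ^ (i + j)"
    by (rule convergent2E) blast
  show "convergent2 (Abs_fps (\<lambda>i. fps_shift d (fps_nth F i)))"
  proof (rule convergent2I[of "C * R ^ d" R])
    show "norm (fps_nth (fps_nth (Abs_fps (\<lambda>i. fps_shift d (fps_nth F i))) i) j)
        \<le> C * R ^ d * R ^ (i + j)"
      for i j using F(3)[of i "j + d"] by (simp add: power_add mult_ac)
  qed (use F in auto)
qed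

lemma coef_shift_x: "coef (shift_x d F) i j = coef F (i + d) j"
  by transfer simp

lemma coef_shift_y: "coef (shift_y d F) i j = coef F i (j + d)"
  by transfer simp

lemma x_power_dvdI: "(\<And>i j. i < k \<Longrightarrow> coef F i j = 0) \<Longrightarrow> F = var_x ^ k * shift_x k F"
  by (rule cps2_eqI) (simp add: coef_x_power_mult coef_shift_x)

definition y_regular :: "nat \<Rightarrow> cps2 \<Rightarrow> bool" where
  "y_regular d h \<longleftrightarrow> (\<forall>j<d. coef h 0 j = 0) \<and> coef h 0 d \<noteq> 0"

theorem Weierstrass_division:
  assumes h: "y_regular d h"
  shows "\<exists>q r. F = q * h + r \<and> (\<forall>i j. d \<le> j \<longrightarrow> coef r i j = 0)"
proof -
  define U where "U = shift_y d h"
  have "is_unit U" using h by (simp add: U_def is_unit_iff coef_shift_y y_regular_def)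
  then obtain V where UV: "U * V = 1" by (rule is_unit_obtain)
  \<comment> \<open>This splits h into y^d U and a part B with no powers of y from d on, which
    vanishes at x = 0. For q = Q V, the series F - q h has no powers y^j with j \<ge> d exactly when
    Q solves the shift equation with w = B V.\<close>
  define B where "B = h - var_y ^ d * U"
  have "coef B 0 j = 0" for j
    using h by (simp add: B_def U_def coef_y_power_mult coef_shift_y y_regular_def)
  then have "coef (B * V) 0 j = 0" for j by (simp add: coef_mult)
  then obtain Q where Q: "\<And>i j. coef Q i j + coef (Q * (B * V)) i (j + d) = coef (shift_y d F) i j"
    using exists_shift_fixed_point[of "B * V" d "shift_y d F"] by blast
  have "Q * V * h = Q * (B * V) + Q * V * (var_y ^ d * U)"
    by (simp add: B_def algebra_simps)
  also have "Q * V * (var_y ^ d * U) = var_y ^ d * Q * (U * V)" by (simp only: mult_ac)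
  finally have qh: "Q * V * h = Q * (B * V) + var_y ^ d * Q" by (simp add: UV)
  have "coef (F - Q * V * h) i j = 0" if "d \<le> j" for i j
  proof -
    have "coef F i j = coef Q i (j - d) + coef (Q * (B * V)) i j"
      using Q[of i "j - d"] that by (simp add: coef_shift_y)
    then show ?thesis using that by (simp add: qh coef_y_power_mult)
  qed
  then show ?thesis by (intro exI[of _ "Q * V"] exI[of _ "F - Q * V * h"]) auto
qed

text \<open>The first nonzero row of q, multiplied by h(0, y), which has order d, would produce a
  nonzero coefficient of q h at some y^j with j \<ge> d.\<close>

lemma Weierstrass_division_unique:
  assumes h: "y_regular d h" and qh: "\<And>i j. d \<le> j \<Longrightarrow> coef (q * h) i j = 0"
  shows "q = 0"
proof -
  have "fps_nth (series q) i = 0" for i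
  proof (induction i rule: less_induct)
    case (less i)
    show ?case
    proof (rule ccontr)
      assume nz: "fps_nth (series q) i \<noteq> 0"
      define h0 where "h0 = fps_nth (series h) 0"
      have "fps_nth h0 d \<noteq> 0" "\<And>j. j < d \<Longrightarrow> fps_nth h0 j = 0"
        using h by (auto simp: h0_def y_regular_def coef_series)
      then have h0: "subdegree h0 = d" "h0 \<noteq> 0" by (auto intro: subdegreeI)
      have "fps_nth (series (q * h)) i = fps_nth (series q) i * h0"
        using less by (simp add: series_mult_row h0_def flip: lessThan_Suc_atMost)
      moreover have "fps_nth (fps_nth (series q) i * h0) (subdegree (fps_nth (series q) i * h0)) \<noteq> 0"
        by (rule nth_subdegree_nonzero) (use nz h0 in simp)
      moreover have "subdegree (fps_nth (series q) i * h0) \<ge> d" using nz h0 by simp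
      ultimately show False using qh by (metis coef_series)
    qed
  qed
  then show ?thesis by (intro cps2_eqI) (metis coef_series fps_zero_nth coef_0)
qed

section \<open>Series in \<open>x\<close> alone\<close>

text \<open>A series that depends on \<open>x\<close> only is a series \<open>F\<close> with \<open>pdy F = 0\<close>.\<close>

lemma pdy_eq_0_iff: "pdy F = 0 \<longleftrightarrow> (\<forall>i j. j > 0 \<longrightarrow> coef F i j = 0)"
proof
  assume F: "pdy F = 0"
  have "coef F i j = 0" if "j > 0" for i j
    using arg_cong[OF F, of "\<lambda>F. coef F i (j - 1)"] that
    by (cases j) (simp_all add: coef_pdy of_nat_neq_0 del: of_nat_Suc)
  then show "\<forall>i j. j > 0 \<longrightarrow> coef F i j = 0" by blast
qed (auto intro!: cps2_eqI simp: coef_pdy)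

lemma x_series_eqI:
  assumes "pdy F = 0" "pdy G = 0" "\<And>i. coef F i 0 = coef G i 0"
  shows "F = G"
proof (rule cps2_eqI)
  show "coef F i j = coef G i j" for i j
    using assms by (cases j) (auto simp: pdy_eq_0_iff)
qed

text \<open>Only the powers Y^0 and Z^0 contribute. Hence \<open>subst F X 0\<close> serves below as
  the composition of series in one variable.\<close>

lemma subst_x_series:
  assumes "pdy F = 0" "coef X 0 0 = 0" "coef Y 0 0 = 0" "coef Z 0 0 = 0"
  shows "subst F X Y = subst F X Z"
proof (rule cps2_eqI)
  fix a b
  have "coef F i j * coef (X ^ i * Y ^ j) a b = coef F i j * coef (X ^ i * Z ^ j) a b" for i j
    using assms(1) by (cases j) (auto simp: pdy_eq_0_iff)
  then show "coef (subst F X Y) a b = coef (subst F X Z) a b"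
    by (simp only: coef_subst[OF assms(2,3)] coef_subst[OF assms(2,4)])
qed

lemma subst_x_series_id:
  assumes "pdy F = 0" "coef Y 0 0 = 0"
  shows "subst F var_x Y = F"
  using subst_x_series[OF assms(1) _ assms(2), of var_x var_y] by (simp add: subst_id coef_var_x coef_var_y)

lemma pdy_subst:
  assumes "pdy F = 0" "coef X 0 0 = 0" "coef Y 0 0 = 0" "pdy X = 0"
  shows "pdy (subst F X Y) = 0"
  using chain_rule[of X Y pdy F] assms by (simp add: subst_0)

lemma pdy_inverse:
  assumes "F * G = 1" "pdy F = 0"
  shows "pdy G = 0"
proof -
  have "F * pdy G = 0" using arg_cong[OF assms(1), of pdy] assms(2) by (simp add: pdy_mult)
  moreover have "F \<noteq> 0" using assms(1) by auto
  ultimately show ?thesis by simp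
qed

text \<open>The series in x form a discrete valuation ring with uniformizer \<open>var_x\<close>;
  all orders in x below are read off from this factorization.\<close>

lemma x_series_factorization:
  assumes "pdy F = 0" "F \<noteq> 0"
  obtains k U where "F = var_x ^ k * U" "pdy U = 0" "is_unit U"
proof -
  have ex: "\<exists>i. coef F i 0 \<noteq> 0"
    using assms x_series_eqI[of F 0] by auto
  define k where "k = (LEAST i. coef F i 0 \<noteq> 0)"
  have k: "coef F k 0 \<noteq> 0" unfolding k_def using ex by (rule LeastI_ex)
  have "coef F i j = 0" if "i < k" for i j
    using not_less_Least[of i "\<lambda>i. coef F i 0 \<noteq> 0"] that assms(1)
    by (cases j) (auto simp: k_def pdy_eq_0_iff)
  then have "F = var_x ^ k * shift_x k F" by (rule x_power_dvdI)
  moreover have "pdy (shift_x k F) = 0"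
    using assms(1) by (simp add: pdy_eq_0_iff coef_shift_x)
  moreover have "is_unit (shift_x k F)"
    using k by (simp add: is_unit_iff coef_shift_x)
  ultimately show thesis by (rule that)
qed

section \<open>Division of order one and two, with remainders over the series in x\<close>

lemma Weierstrass_division_1:
  assumes "y_regular 1 h"
  obtains q r where "F = q * h + r" "pdy r = 0"
proof -
  obtain q r where "F = q * h + r" "\<forall>i j. 1 \<le> j \<longrightarrow> coef r i j = 0"
    using Weierstrass_division[OF assms, of F] by blast
  then show thesis by (intro that[of q r]) (auto simp: pdy_eq_0_iff)
qed

lemma Weierstrass_division_2:
  assumes "y_regular 2 h"
  obtains q a b where "F = q * h + (a * var_y + b)" "pdy a = 0" "pdy b = 0"
proof -
  obtain q r where qr: "F = q * h + r" "\<And>i j. 2 \<le> j \<Longrightarrow> coef r i j = 0"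
    using Weierstrass_division[OF assms, of F] by blast
  define a where "a = shift_y 1 r"
  have "pdy a = 0" using qr(2) by (simp add: pdy_eq_0_iff a_def coef_shift_y)
  moreover have "pdy (r - a * var_y) = 0"
    unfolding pdy_eq_0_iff a_def mult.commute[of _ var_y]
    using qr(2) by (auto simp: coef_shift_y coef_y_mult)
  moreover have "F = q * h + (a * var_y + (r - a * var_y))" using qr(1) by simp
  ultimately show thesis using that by blast
qed

lemma linear_part_eq_0:
  assumes "a * var_y + b = 0" "pdy a = 0" "pdy b = 0"
  shows "a = 0" "b = 0"
proof -
  have "a = pdy (a * var_y + b)" using assms(2,3) by (simp add: pdy_mult)
  then show "a = 0" using assms(1) by simp
  then show "b = 0" using assms(1) by simp
qed

lemma Weierstrass_remainder_2_unique:
  assumes "y_regular 2 h" "q * h = a * var_y + b" "pdy a = 0" "pdy b = 0"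
  shows "q = 0" "a = 0" "b = 0"
proof -
  show "q = 0"
  proof (rule Weierstrass_division_unique[OF assms(1)])
    show "coef (q * h) i j = 0" if "2 \<le> j" for i j
      unfolding assms(2) using assms(3,4) that
      by (auto simp: pdy_eq_0_iff coef_y_mult mult.commute[of _ var_y])
  qed
  then have "a * var_y + b = 0" using assms(2) by simp
  then show "a = 0" "b = 0" using linear_part_eq_0 assms by blast+
qed

text \<open>Dividing y by h leaves a remainder r in x alone, and the coefficient of y shows that the
  quotient is a unit. So h is associated to y - r, and r is the implicit function.\<close>

theorem implicit_function:
  assumes "coef h 0 0 = 0" "coef h 0 1 \<noteq> 0"
  obtains u r where "h = u * (var_y - r)" "is_unit u" "pdy r = 0" "coef r 0 0 = 0"
proof -
  obtain q r where qr: "var_y = q * h + r" and r: "pdy r = 0"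
    using Weierstrass_division_1[of h] assms by (auto simp: y_regular_def)
  have r0: "coef r 0 0 = 0"
    using arg_cong[OF qr, of "\<lambda>F. coef F 0 0"] assms by (simp add: coef_var_y coef_mult)
  have "coef q 0 0 * coef h 0 1 = 1"
    using arg_cong[OF qr, of "\<lambda>F. coef F 0 1"] assms r
    by (simp add: coef_var_y coef_mult atMost_Suc pdy_eq_0_iff)
  then have "is_unit q" by (auto simp: is_unit_iff)
  then obtain u where u: "q * u = 1" by (rule is_unit_obtain)
  have "h = (q * u) * h" by (simp add: u)
  also have "\<dots> = u * (var_y - r)" by (subst qr) (simp add: algebra_simps)
  finally have h: "h = u * (var_y - r)" .
  have "is_unit u" using u by (metis dvd_triv_right)
  then show thesis using that h r r0 by blast
qed

text \<open>Let c be a k-th root of the constant term of U. The equation (c + y)^k = U can be solved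
  for y, since its y-derivative at the origin is k c^(k-1), which is nonzero.\<close>

lemma x_series_root:
  assumes "pdy U = 0" "is_unit U" "k > 0"
  obtains V where "pdy V = 0" "is_unit V" "V ^ k = U"
proof -
  obtain c where c: "coef U 0 0 = c ^ k"
    using assms(3) by (elim exists_complex_root[OF less_imp_neq[symmetric]])
  have c0: "c \<noteq> 0" using c assms by (auto simp: is_unit_iff)
  define h where "h = (const c + var_y) ^ k - U"
  have "coef h 0 0 = 0" by (simp add: h_def coef_power_00 coef_const coef_var_y c)
  moreover have "coef (pdy h) 0 0 \<noteq> 0"
    using c0 assms(1,3)
    by (simp add: h_def pdy_power coef_mult_00 coef_power_00 coef_const coef_var_y flip: const_of_nat)
  then have "coef h 0 1 \<noteq> 0" by (simp add: coef_pdy)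
  ultimately obtain u r where h: "h = u * (var_y - r)" and r: "pdy r = 0" "coef r 0 0 = 0"
    by (rule implicit_function)
  have vx: "coef var_x 0 0 = 0" by (simp add: coef_var_x)
  have "subst h var_x r = 0"
    unfolding h using r vx by (simp add: subst_mult subst_diff subst_var_y subst_x_series_id)
  then have "(const c + r) ^ k = U"
    using r vx assms(1)
    by (simp add: h_def subst_diff subst_power subst_add subst_const subst_var_y subst_x_series_id)
  moreover have "is_unit (const c + r)" using c0 r by (simp add: is_unit_iff coef_const)
  ultimately show thesis using that[of "const c + r"] r by simp
qed

text \<open>The series \<phi> is the solution y of \<psi>(y) = x. Its linear coefficient is again
  nonzero by the chain rule, so the construction can be repeated on \<phi>.\<close>

lemma x_series_right_inverse:
  assumes "pdy \<psi> = 0" "coef \<psi> 0 0 = 0" "coef \<psi> 1 0 \<noteq> 0"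
  obtains \<phi> where "pdy \<phi> = 0" "coef \<phi> 0 0 = 0" "coef \<phi> 1 0 \<noteq> 0" "subst \<psi> \<phi> 0 = var_x"
proof -
  have v: "coef var_x 0 0 = 0" "coef var_y 0 0 = 0" by (simp_all add: coef_var_x coef_var_y)
  define h where "h = subst \<psi> var_y 0 - var_x"
  have "coef h 0 0 = 0" using assms(2) v by (simp add: h_def coef_subst_00)
  moreover have "coef (pdy h) 0 0 \<noteq> 0"
    using assms(3) chain_rule[of var_y 0 pdy \<psi>] v by (simp add: h_def coef_subst_00 coef_pdx)
  then have "coef h 0 1 \<noteq> 0" by (simp add: coef_pdy)
  ultimately obtain u \<phi> where h: "h = u * (var_y - \<phi>)" and \<phi>: "pdy \<phi> = 0" "coef \<phi> 0 0 = 0"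
    by (rule implicit_function)
  have "subst h var_x \<phi> = 0"
    unfolding h using \<phi> v by (simp add: subst_mult subst_diff subst_var_y subst_x_series_id)
  then have inv: "subst \<psi> \<phi> 0 = var_x"
    using \<phi> v by (simp add: h_def subst_diff subst_subst subst_var_x subst_var_y subst_0)
  have "subst (pdx \<psi>) \<phi> 0 * pdx \<phi> = 1"
    using chain_rule[of \<phi> 0 pdx \<psi>] \<phi> by (simp add: inv)
  then have "coef (subst (pdx \<psi>) \<phi> 0) 0 0 * coef (pdx \<phi>) 0 0 = 1"
    by (metis coef_mult_00 coef_1)
  then have "coef \<phi> 1 0 \<noteq> 0" by (auto simp: coef_pdx)
  then show thesis using that \<phi> inv by blast
qed

text \<open>The right inverse \<phi> of \<psi> has a right inverse \<theta> of its own;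
  associativity gives \<theta> = \<psi>, so \<phi> is two-sided.\<close>

theorem x_series_inverse:
  assumes "pdy \<psi> = 0" "coef \<psi> 0 0 = 0" "coef \<psi> 1 0 \<noteq> 0"
  obtains \<phi> where "pdy \<phi> = 0" "coef \<phi> 0 0 = 0" "coef \<phi> 1 0 \<noteq> 0"
    "subst \<psi> \<phi> 0 = var_x" "subst \<phi> \<psi> 0 = var_x"
proof -
  obtain \<phi> where \<phi>: "pdy \<phi> = 0" "coef \<phi> 0 0 = 0" "coef \<phi> 1 0 \<noteq> 0" and inv: "subst \<psi> \<phi> 0 = var_x"
    using x_series_right_inverse[OF assms] .
  obtain \<theta> where \<theta>: "pdy \<theta> = 0" "coef \<theta> 0 0 = 0" and inv': "subst \<phi> \<theta> 0 = var_x"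
    using x_series_right_inverse[OF \<phi>] .
  have "\<psi> = subst \<psi> (subst \<phi> \<theta> 0) (subst 0 \<theta> 0)"
    using assms(1) \<theta> by (simp add: inv' subst_0 subst_x_series_id)
  also have "\<dots> = subst (subst \<psi> \<phi> 0) \<theta> 0" using \<phi> \<theta> by (simp add: subst_subst)
  also have "\<dots> = \<theta>" using \<theta> by (simp add: inv subst_var_x)
  finally show thesis using that[OF \<phi> inv] inv' by simp
qed


section \<open>Ideals and colengths\<close>

interpretation cps2_module: module "(*) :: cps2 \<Rightarrow> cps2 \<Rightarrow> cps2"
  by standard (simp_all only: distrib_left distrib_right mult.assoc mult_1_left)

interpretation cps2_vector_space: vector_space "\<lambda>c h. const c * h"
  by standard
    (simp_all only: const_add const_mult const_1 distrib_left distrib_right mult.assoc mult_1_left)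

lemma mem_ideal_of_1: "h \<in> ideal_of {a} \<longleftrightarrow> a dvd h"
  unfolding ideal_of_def cps2_module.span_singleton
  by (simp add: dvd_def image_iff mult.commute)

lemma mem_ideal_of_2: "h \<in> ideal_of {a, b} \<longleftrightarrow> (\<exists>p q. h = p * a + q * b)"
proof -
  have "h \<in> ideal_of {a, b} \<longleftrightarrow> (\<exists>p q. h - p * a = q * b)"
    unfolding ideal_of_def cps2_module.span_insert[of a] cps2_module.span_singleton by blast
  then show ?thesis by (simp add: diff_eq_eq add.commute)
qed

lemma mem_ideal_of_3: "h \<in> ideal_of {a, b, c} \<longleftrightarrow> (\<exists>p q r. h = p * a + q * b + r * c)"
proof -
  have 1: "h - p * a = q * b + r * c \<longleftrightarrow> h = p * a + q * b + r * c" for p q r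
    by (simp only: diff_eq_eq add_ac)
  have "h \<in> ideal_of {a, b, c} \<longleftrightarrow> (\<exists>p. h - p * a \<in> ideal_of {b, c})"
    unfolding ideal_of_def cps2_module.span_insert[of a] by blast
  then show ?thesis unfolding mem_ideal_of_2 1 .
qed

definition is_ideal :: "cps2 set \<Rightarrow> bool" where
  "is_ideal I \<longleftrightarrow> 0 \<in> I \<and> (\<forall>a\<in>I. \<forall>b\<in>I. a + b \<in> I) \<and> (\<forall>a\<in>I. \<forall>h. h * a \<in> I)"

lemma is_ideal_ideal_of: "is_ideal (ideal_of A)"
  unfolding is_ideal_def ideal_of_def
  by (auto intro: cps2_module.span_zero cps2_module.span_add cps2_module.span_scale)

context
  fixes I assumes I: "is_ideal I"
begin

lemma is_ideal_add: "a \<in> I \<Longrightarrow> b \<in> I \<Longrightarrow> a + b \<in> I"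
  using I by (auto simp: is_ideal_def)

lemma is_ideal_mult: "a \<in> I \<Longrightarrow> h * a \<in> I"
  using I by (auto simp: is_ideal_def)

lemma is_ideal_uminus: "a \<in> I \<Longrightarrow> - a \<in> I"
  using is_ideal_mult[of a "-1"] by simp

lemma is_ideal_diff: "a \<in> I \<Longrightarrow> b \<in> I \<Longrightarrow> a - b \<in> I"
  using is_ideal_add[of a "- b"] is_ideal_uminus[of b] by simp

lemma is_ideal_sum: "(\<And>k. k \<in> K \<Longrightarrow> f k \<in> I) \<Longrightarrow> sum f K \<in> I"
  using I by (induction K rule: infinite_finite_induct) (auto simp: is_ideal_def)

lemma inj_on_of_independent_modulo:
  assumes K: "finite K"
    and indep: "\<And>c. (\<Sum>k\<in>K. const (c k) * b k) \<in> I \<Longrightarrow> \<forall>k\<in>K. c k = 0"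
    and eq: "k \<in> K" "l \<in> K" "b k - b l \<in> I"
  shows "k = l"
proof (rule ccontr)
  assume kl: "k \<noteq> l"
  define c :: "'a \<Rightarrow> complex" where "c = (\<lambda>j. if j = k then 1 else if j = l then -1 else 0)"
  have "(\<Sum>j\<in>K. const (c j) * b j) = (\<Sum>j\<in>{k, l}. const (c j) * b j)"
    using K eq by (intro sum.mono_neutral_right) (auto simp: c_def)
  also have "\<dots> = b k - b l" using kl by (simp add: c_def const_uminus)
  finally have "\<forall>j\<in>K. c j = 0" using indep eq by simp
  then show False using eq by (auto simp: c_def)
qed

text \<open>In the proof, \<open>t\<close> replaces an element by a combination of B congruent to
  it. Independence modulo I makes the images of B' linearly independent inside the span of B, and
  the exchange lemma for complex vector spaces compares the cardinalities.\<close>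

lemma basis_modulo_card_le:
  assumes B: "basis_modulo I B" and B': "basis_modulo I B'"
  shows "card B' \<le> card B"
proof -
  have "\<forall>h. \<exists>c. h - (\<Sum>b\<in>B. const (c b) * b) \<in> I" using B by (simp add: basis_modulo_def)
  then obtain c where c: "\<And>h. h - (\<Sum>b\<in>B. const (c h b) * b) \<in> I" by metis
  define t where "t h = (\<Sum>b\<in>B. const (c h b) * b)" for h
  have t: "h - t h \<in> I" for h using c by (simp add: t_def)
  have fin: "finite B" "finite B'" and
    indep: "(\<Sum>b\<in>B'. const (u b) * b) \<in> I \<Longrightarrow> \<forall>b\<in>B'. u b = 0" for u
    using B B' by (auto simp: basis_modulo_def)
  have inj: "inj_on t B'"
  proof (rule inj_onI)
    fix k l assume kl: "k \<in> B'" "l \<in> B'" "t k = t l"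
    have "k - l = (k - t k) - (l - t l)" using kl by simp
    then have "k - l \<in> I" using t is_ideal_diff by metis
    then show "k = l" using inj_on_of_independent_modulo[where b = "\<lambda>b. b"] fin indep kl by blast
  qed
  have "cps2_vector_space.independent (t ` B')"
    unfolding cps2_vector_space.dependent_finite[OF finite_imageI[OF fin(2)]]
  proof safe
    fix u b assume "(\<Sum>v\<in>t ` B'. const (u v) * v) = 0" and b: "b \<in> B'" "u (t b) \<noteq> 0"
    then have "(\<Sum>v\<in>B'. const (u (t v)) * t v) = 0" by (simp add: sum.reindex[OF inj])
    then have "(\<Sum>v\<in>B'. const (u (t v)) * v) = (\<Sum>v\<in>B'. const (u (t v)) * (v - t v))"
      by (simp add: right_diff_distrib sum_subtractf)
    also have "\<dots> \<in> I" by (intro is_ideal_sum is_ideal_mult t)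
    finally show False using indep[of "\<lambda>v. u (t v)"] b by blast
  qed
  moreover have "t ` B' \<subseteq> cps2_vector_space.span B"
    unfolding t_def
    by (intro image_subsetI cps2_vector_space.span_sum cps2_vector_space.span_scale
        cps2_vector_space.span_base)
  ultimately have "card (t ` B') \<le> card B"
    using cps2_vector_space.independent_span_bound fin by blast
  then show ?thesis by (simp add: card_image inj)
qed

lemma quotient_dim_eqI:
  assumes "basis_modulo I B"
  shows "quotient_dim I = enat (card B)"
proof -
  have "basis_modulo I (SOME B. basis_modulo I B)" using assms by (rule someI)
  then have "card (SOME B. basis_modulo I B) = card B"
    using assms basis_modulo_card_le by (meson le_antisym)
  then show ?thesis using assms by (auto simp: quotient_dim_def)
qed

text \<open>Independence forces the members of the family to be distinct, so a family can stand for
  the set in \<open>basis_modulo\<close>.\<close>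

lemma quotient_dim_indexed:
  assumes K: "finite K"
    and indep: "\<And>c. (\<Sum>k\<in>K. const (c k) * b k) \<in> I \<Longrightarrow> \<forall>k\<in>K. c k = 0"
    and gen: "\<And>h. \<exists>c. h - (\<Sum>k\<in>K. const (c k) * b k) \<in> I"
  shows "quotient_dim I = enat (card K)"
proof -
  have inj: "inj_on b K"
    using inj_on_of_independent_modulo[OF K indep] I by (auto intro!: inj_onI simp: is_ideal_def)
  have "basis_modulo I (b ` K)"
    unfolding basis_modulo_def
  proof (intro conjI allI impI)
    fix c assume "(\<Sum>b\<in>b ` K. const (c b) * b) \<in> I"
    then have "(\<Sum>k\<in>K. const (c (b k)) * b k) \<in> I" by (simp add: sum.reindex[OF inj])
    then show "\<forall>b\<in>b ` K. c b = 0" using indep[of "\<lambda>k. c (b k)"] by auto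
  next
    fix h
    obtain c where "h - (\<Sum>k\<in>K. const (c k) * b k) \<in> I" using gen by blast
    moreover have "(\<Sum>k\<in>K. const (c k) * b k) = (\<Sum>v\<in>b ` K. const (c (inv_into K b v)) * v)"
      by (simp add: sum.reindex[OF inj] inv_into_f_f[OF inj])
    ultimately show "\<exists>c. h - (\<Sum>b\<in>b ` K. const (c b) * b) \<in> I"
      by (intro exI[of _ "\<lambda>v. c (inv_into K b v)"]) simp
  qed (use K in simp)
  then show ?thesis using quotient_dim_eqI card_image[OF inj] by metis
qed

end

lemma quotient_dim_basis:
  assumes "quotient_dim I = enat k"
  obtains B where "basis_modulo I B" "card B = k"
  using assms someI_ex[of "basis_modulo I"] by (auto simp: quotient_dim_def split: if_splits)

lemma x_series_truncation:
  assumes "pdy F = 0"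
  obtains G where "pdy G = 0" "F = (\<Sum>i<k. const (coef F i 0) * var_x ^ i) + var_x ^ k * G"
proof -
  define P where "P = (\<Sum>i<k. const (coef F i 0) * var_x ^ i)"
  have P: "coef P i j = (if i < k \<and> j = 0 then coef F i 0 else 0)" for i j
    unfolding P_def coef_sum coef_const_mult coef_x_power by (auto simp: if_distrib cong: if_cong)
  have "F - P = var_x ^ k * shift_x k (F - P)"
    by (rule x_power_dvdI) (use assms in \<open>auto simp: P pdy_eq_0_iff\<close>)
  moreover have "pdy (shift_x k (F - P)) = 0"
    using assms unfolding pdy_eq_0_iff by (simp add: coef_shift_x P)
  ultimately show thesis using that by (metis P_def add_diff_cancel_left' add_diff_eq)
qed

lemma coef_x_polynomial:
  "coef (\<Sum>i<k. const (c i) * var_x ^ i) a b = (if a < k \<and> b = 0 then c a else 0)"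
  unfolding coef_sum coef_const_mult coef_x_power by (auto simp: if_distrib cong: if_cong)

lemma quotient_dim_y_x_power: "quotient_dim (ideal_of {var_y, var_x ^ k}) = enat k"
proof -
  have "quotient_dim (ideal_of {var_y, var_x ^ k}) = enat (card {..<k})"
  proof (rule quotient_dim_indexed[where b = "\<lambda>i. var_x ^ i"])
    fix c :: "nat \<Rightarrow> complex"
    assume "(\<Sum>i<k. const (c i) * var_x ^ i) \<in> ideal_of {var_y, var_x ^ k}"
    then obtain p q where pq: "(\<Sum>i<k. const (c i) * var_x ^ i) = p * var_y + q * var_x ^ k"
      by (auto simp: mem_ideal_of_2)
    show "\<forall>i\<in>{..<k}. c i = 0"
    proof
      fix i assume i: "i \<in> {..<k}"
      have "coef (p * var_y + q * var_x ^ k) i 0 = 0"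
        using i by (simp add: coef_y_mult coef_x_power_mult mult.commute[of _ var_y]
            mult.commute[of _ "var_x ^ k"])
      then show "c i = 0" using coef_x_polynomial[of c k i 0] i by (simp only: pq) simp
    qed
  next
    fix h
    have "y_regular 1 var_y" by (simp add: y_regular_def coef_var_y)
    then obtain q r where h: "h = q * var_y + r" and "pdy r = 0"
      by (rule Weierstrass_division_1)
    then obtain G where "r = (\<Sum>i<k. const (coef r i 0) * var_x ^ i) + var_x ^ k * G"
      using x_series_truncation by blast
    then have "h - (\<Sum>i<k. const (coef r i 0) * var_x ^ i) = q * var_y + G * var_x ^ k"
      using h by (simp add: algebra_simps)
    then show "\<exists>c. h - (\<Sum>i<k. const (c i) * var_x ^ i) \<in> ideal_of {var_y, var_x ^ k}"
      unfolding mem_ideal_of_2 by (intro exI[of _ "\<lambda>i. coef r i 0"] exI)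
  qed (simp_all add: is_ideal_ideal_of)
  then show ?thesis by simp
qed

section \<open>Coordinate changes\<close>

text \<open>The inverse is part of the data, so that substitution has an explicit two-sided inverse
  whenever ideals are transported. The Jacobian condition of \<open>coordinate_change\<close> is
  derived from it.\<close>

definition inverse_coordinates :: "cps2 \<Rightarrow> cps2 \<Rightarrow> cps2 \<Rightarrow> cps2 \<Rightarrow> bool" where
  "inverse_coordinates X Y U V \<longleftrightarrow>
     coef X 0 0 = 0 \<and> coef Y 0 0 = 0 \<and> coef U 0 0 = 0 \<and> coef V 0 0 = 0 \<and>
     subst X U V = var_x \<and> subst Y U V = var_y \<and> subst U X Y = var_x \<and> subst V X Y = var_y"

lemma inverse_coordinates_sym: "inverse_coordinates X Y U V \<Longrightarrow> inverse_coordinates U V X Y"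
  by (auto simp: inverse_coordinates_def)

lemma inverse_coordinates_subst:
  "inverse_coordinates X Y U V \<Longrightarrow> subst (subst F X Y) U V = F"
  by (simp add: inverse_coordinates_def subst_subst subst_id)

lemma inverse_coordinates_comp:
  assumes XY: "inverse_coordinates X Y U V" and XY': "inverse_coordinates X' Y' U' V'"
  shows "inverse_coordinates (subst X X' Y') (subst Y X' Y') (subst U' U V) (subst V' U V)"
proof -
  have 0: "coef X 0 0 = 0" "coef Y 0 0 = 0" "coef U 0 0 = 0" "coef V 0 0 = 0"
    "coef X' 0 0 = 0" "coef Y' 0 0 = 0" "coef U' 0 0 = 0" "coef V' 0 0 = 0"
    using assms by (auto simp: inverse_coordinates_def)
  have 1: "subst (subst F X' Y') (subst U' U V) (subst V' U V) = subst F U V" for F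
    using inverse_coordinates_subst[OF XY', of F] 0
    by (simp add: subst_subst[symmetric] coef_subst_00)
  have 2: "subst (subst F U V) (subst X X' Y') (subst Y X' Y') = subst F X' Y'" for F
    using inverse_coordinates_subst[OF inverse_coordinates_sym[OF XY], of F] 0
    by (simp add: subst_subst[symmetric] coef_subst_00)
  show ?thesis
    using assms 0 by (simp add: inverse_coordinates_def 1 2 coef_subst_00)
qed

text \<open>At the origin the chain rule for X(U, V) = x and Y(U, V) = y says that the two Jacobian
  matrices multiply to the identity; so do their determinants to 1.\<close>

lemma inverse_coordinates_imp_coordinate_change:
  assumes "inverse_coordinates X Y U V"
  shows "coordinate_change X Y"
proof -
  have 0: "coef X 0 0 = 0" "coef Y 0 0 = 0" "coef U 0 0 = 0" "coef V 0 0 = 0"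
    and 1: "subst X U V = var_x" "subst Y U V = var_y"
    using assms by (auto simp: inverse_coordinates_def)
  have c: "coef (D (subst F U V)) 0 0 = coef F 1 0 * coef (D U) 0 0 + coef F 0 1 * coef (D V) 0 0"
    if "D = pdx \<or> D = pdy" for D F
    using chain_rule[OF 0(3,4) that, of F] 0 by (simp add: coef_mult_00 coef_subst_00 coef_pdx coef_pdy)
  have
    "coef X 1 0 * coef U 1 0 + coef X 0 1 * coef V 1 0 = 1"
    "coef X 1 0 * coef U 0 1 + coef X 0 1 * coef V 0 1 = 0"
    "coef Y 1 0 * coef U 1 0 + coef Y 0 1 * coef V 1 0 = 0"
    "coef Y 1 0 * coef U 0 1 + coef Y 0 1 * coef V 0 1 = 1"
    using c[of pdx X] c[of pdy X] c[of pdx Y] c[of pdy Y] 1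
    by (simp_all add: coef_pdx coef_pdy coef_1)
  then have "(coef X 1 0 * coef Y 0 1 - coef X 0 1 * coef Y 1 0)
      * (coef U 1 0 * coef V 0 1 - coef U 0 1 * coef V 1 0) = 1"
    by algebra
  then show ?thesis using 0 by (auto simp: coordinate_change_def)
qed

lemma inverse_coordinates_swap: "inverse_coordinates var_y var_x var_y var_x"
  by (simp add: inverse_coordinates_def coef_var_x coef_var_y subst_var_x subst_var_y)

context
  fixes X Y U V :: cps2
  assumes inv: "inverse_coordinates X Y U V"
begin

private lemma base_points:
  "coef X 0 0 = 0" "coef Y 0 0 = 0" "coef U 0 0 = 0" "coef V 0 0 = 0"
  using inv by (auto simp: inverse_coordinates_def)

private lemma inverse_subst: "subst (subst F X Y) U V = F" "subst (subst F U V) X Y = F"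
  using inv inverse_coordinates_subst inverse_coordinates_sym by blast+

lemma subst_sum: "subst (sum F A) X Y = (\<Sum>a\<in>A. subst (F a) X Y)"
  by (induction A rule: infinite_finite_induct) (simp_all add: subst_0 subst_add base_points)

lemma is_ideal_image_subst:
  assumes I: "is_ideal I"
  shows "is_ideal ((\<lambda>F. subst F X Y) ` I)"
  unfolding is_ideal_def
proof (intro conjI ballI allI)
  show "0 \<in> (\<lambda>F. subst F X Y) ` I"
    using I subst_0[OF base_points(1,2)] by (force simp: is_ideal_def)
  fix a assume "a \<in> (\<lambda>F. subst F X Y) ` I"
  then obtain F where F: "F \<in> I" "a = subst F X Y" by blast
  show "h * a \<in> (\<lambda>F. subst F X Y) ` I" for h
    using is_ideal_mult[OF I F(1), of "subst h U V"] F(2)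
    by (intro image_eqI[of _ _ "subst h U V * F"]) (simp_all add: subst_mult base_points inverse_subst)
  fix b assume "b \<in> (\<lambda>F. subst F X Y) ` I"
  then obtain G where "G \<in> I" "b = subst G X Y" by blast
  then show "a + b \<in> (\<lambda>F. subst F X Y) ` I"
    using is_ideal_add[OF I F(1)] F(2)
    by (intro image_eqI[of _ _ "F + G"]) (simp_all add: subst_add base_points)
qed

lemma quotient_dim_image_subst:
  assumes I: "is_ideal I" and dim: "quotient_dim I = enat k"
  shows "quotient_dim ((\<lambda>F. subst F X Y) ` I) = enat k"
proof -
  obtain B where B: "basis_modulo I B" "card B = k" using quotient_dim_basis[OF dim] .
  have mem: "subst F X Y \<in> (\<lambda>F. subst F X Y) ` I \<longleftrightarrow> F \<in> I" for F
    using inverse_subst(1) by (metis (no_types, lifting) imageE image_eqI)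
  have lin: "(\<Sum>b\<in>B. const (c b) * subst b X Y) = subst (\<Sum>b\<in>B. const (c b) * b) X Y" for c
    by (simp add: subst_sum subst_mult subst_const base_points)
  have "quotient_dim ((\<lambda>F. subst F X Y) ` I) = enat (card B)"
  proof (rule quotient_dim_indexed[OF is_ideal_image_subst[OF I], where b = "\<lambda>b. subst b X Y"])
    show "finite B" using B by (simp add: basis_modulo_def)
    show "\<forall>b\<in>B. c b = 0" if "(\<Sum>b\<in>B. const (c b) * subst b X Y) \<in> (\<lambda>F. subst F X Y) ` I" for c
      using that B unfolding lin mem by (simp add: basis_modulo_def)
    show "\<exists>c. h - (\<Sum>b\<in>B. const (c b) * subst b X Y) \<in> (\<lambda>F. subst F X Y) ` I" for h
    proof -
      obtain c where "subst h U V - (\<Sum>b\<in>B. const (c b) * b) \<in> I"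
        using B unfolding basis_modulo_def by blast
      then have "subst (subst h U V - (\<Sum>b\<in>B. const (c b) * b)) X Y \<in> (\<lambda>F. subst F X Y) ` I"
        by (simp add: mem)
      then have "h - (\<Sum>b\<in>B. const (c b) * subst b X Y) \<in> (\<lambda>F. subst F X Y) ` I"
        unfolding lin by (simp add: subst_diff base_points inverse_subst)
      then show ?thesis by blast
    qed
  qed
  then show ?thesis using B by simp
qed

lemma image_subst_ideal_of_2:
  "(\<lambda>F. subst F X Y) ` ideal_of {a, b} = ideal_of {subst a X Y, subst b X Y}"
proof (intro set_eqI iffI)
  fix h assume "h \<in> (\<lambda>F. subst F X Y) ` ideal_of {a, b}"
  then obtain F where "h = subst F X Y" "F \<in> ideal_of {a, b}" by blast
  then obtain p q where "h = subst (p * a + q * b) X Y" unfolding mem_ideal_of_2 by blast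
  then have "h = subst p X Y * subst a X Y + subst q X Y * subst b X Y"
    by (simp add: subst_add subst_mult base_points)
  then show "h \<in> ideal_of {subst a X Y, subst b X Y}"
    unfolding mem_ideal_of_2 by blast
next
  fix h assume "h \<in> ideal_of {subst a X Y, subst b X Y}"
  then obtain p q where "h = p * subst a X Y + q * subst b X Y" unfolding mem_ideal_of_2 by blast
  then have "h = subst (subst p U V * a + subst q U V * b) X Y"
    by (simp add: subst_add subst_mult base_points inverse_subst)
  then show "h \<in> (\<lambda>F. subst F X Y) ` ideal_of {a, b}"
    by (rule image_eqI) (unfold mem_ideal_of_2, blast)
qed

lemma intersection_number_subst:
  assumes "intersection_number a b = enat k"
  shows "intersection_number (subst a X Y) (subst b X Y) = enat k"
  using quotient_dim_image_subst[OF is_ideal_ideal_of, of "{a, b}" k] assms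
  by (simp add: intersection_number_def image_subst_ideal_of_2)

lemma irreducible_subst:
  assumes "irreducible g"
  shows "irreducible (subst g X Y)"
proof (rule irreducibleI)
  show "subst g X Y \<noteq> 0" "\<not> is_unit (subst g X Y)"
    using assms subst_0[of U V] inverse_subst(1)[of g] subst_unit[of U V "subst g X Y"] base_points
    by (auto simp: irreducible_def)
  fix a b assume "subst g X Y = a * b"
  then have "g = subst a U V * subst b U V"
    using inverse_subst(1)[of g] by (simp add: subst_mult base_points)
  then have "is_unit (subst a U V) \<or> is_unit (subst b U V)"
    using assms by (auto simp: irreducible_def)
  then show "is_unit a \<or> is_unit b"
    using subst_unit[of X Y] inverse_subst(2) base_points by metis
qed

end

subsection \<open>The Tjurina ideal\<close>

definition tjurina_ideal :: "cps2 \<Rightarrow> cps2 set" where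
  "tjurina_ideal f = ideal_of {f, pdx f, pdy f}"

lemma tjurina_ideal_mult_subset: "tjurina_ideal (u * f) \<subseteq> tjurina_ideal f"
proof
  fix h assume "h \<in> tjurina_ideal (u * f)"
  then obtain p q r where "h = p * (u * f) + q * pdx (u * f) + r * pdy (u * f)"
    by (auto simp: tjurina_ideal_def mem_ideal_of_3)
  then have "h = (p * u + q * pdx u + r * pdy u) * f + (q * u) * pdx f + (r * u) * pdy f"
    unfolding pdx_mult pdy_mult by algebra
  then show "h \<in> tjurina_ideal f" unfolding tjurina_ideal_def mem_ideal_of_3 by (intro exI)
qed

lemma tjurina_ideal_unit_mult:
  assumes "is_unit u"
  shows "tjurina_ideal (u * f) = tjurina_ideal f"
proof -
  obtain v where "u * v = 1" using assms by (rule is_unit_obtain)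
  then have "f = v * (u * f)" by (metis mult.assoc mult.commute mult_1)
  then show ?thesis using tjurina_ideal_mult_subset by (metis subset_antisym)
qed

text \<open>The chain rule expresses the new derivatives through the substituted old ones. The
  cofactors are themselves written as substitutions by means of the inverse coordinates.\<close>

lemma tjurina_ideal_subst_subset:
  assumes inv: "inverse_coordinates X Y U V"
  shows "tjurina_ideal (subst f X Y) \<subseteq> (\<lambda>F. subst F X Y) ` tjurina_ideal f"
proof
  have 0: "coef X 0 0 = 0" "coef Y 0 0 = 0" using inv by (auto simp: inverse_coordinates_def)
  fix h assume "h \<in> tjurina_ideal (subst f X Y)"
  then obtain p q r where h: "h = p * subst f X Y + q * pdx (subst f X Y) + r * pdy (subst f X Y)"
    by (auto simp: tjurina_ideal_def mem_ideal_of_3)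
  define p' where "p' a = subst a U V" for a
  have p': "a = subst (p' a) X Y" for a
    using inverse_coordinates_subst[OF inverse_coordinates_sym[OF inv]] by (simp add: p'_def)
  have "h = subst (p' p * f + p' (q * pdx X + r * pdy X) * pdx f + p' (q * pdx Y + r * pdy Y) * pdy f) X Y"
    unfolding h chain_rule[OF 0 disjI1[OF refl]] chain_rule[OF 0 disjI2[OF refl]]
      subst_add[OF 0] subst_mult[OF 0] p'[symmetric] by algebra
  then show "h \<in> (\<lambda>F. subst F X Y) ` tjurina_ideal f"
    by (rule image_eqI) (unfold tjurina_ideal_def mem_ideal_of_3, intro exI, rule refl)
qed

lemma tjurina_ideal_subst:
  assumes inv: "inverse_coordinates X Y U V"
  shows "tjurina_ideal (subst f X Y) = (\<lambda>F. subst F X Y) ` tjurina_ideal f"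
proof
  show "tjurina_ideal (subst f X Y) \<subseteq> (\<lambda>F. subst F X Y) ` tjurina_ideal f"
    by (rule tjurina_ideal_subst_subset[OF inv])
  have "tjurina_ideal f \<subseteq> (\<lambda>F. subst F U V) ` tjurina_ideal (subst f X Y)"
    using tjurina_ideal_subst_subset[OF inverse_coordinates_sym[OF inv], of "subst f X Y"]
    by (simp add: inverse_coordinates_subst[OF inv])
  then show "(\<lambda>F. subst F X Y) ` tjurina_ideal f \<subseteq> tjurina_ideal (subst f X Y)"
    using inverse_coordinates_subst[OF inverse_coordinates_sym[OF inv]] by fastforce
qed

lemma tjurina_transport:
  assumes inv: "inverse_coordinates X Y U V" and u: "is_unit u" "subst f X Y = u * f\<^sub>0"
    and "tjurina f\<^sub>0 = enat k"
  shows "tjurina f = enat k"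
proof -
  have "(\<lambda>F. subst F X Y) ` tjurina_ideal f = tjurina_ideal f\<^sub>0"
    using tjurina_ideal_subst[OF inv, of f] tjurina_ideal_unit_mult[OF u(1)] u(2) by simp
  then have "tjurina_ideal f = (\<lambda>F. subst F U V) ` tjurina_ideal f\<^sub>0"
    using inverse_coordinates_subst[OF inv] by (simp add: image_image flip: \<open>_ = tjurina_ideal f\<^sub>0\<close>)
  then show ?thesis
    using quotient_dim_image_subst[OF inverse_coordinates_sym[OF inv], of "tjurina_ideal f\<^sub>0" k]
      assms(4) is_ideal_ideal_of
    by (simp add: tjurina_def tjurina_ideal_def)
qed


section \<open>Branches of multiplicity two\<close>

lemma multiplicity_at_0_D:
  assumes "multiplicity_at_0 p = enat k"
  shows "ord_ge k p" "\<exists>i j. i + j = k \<and> coef p i j \<noteq> 0"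
proof -
  define A where "A = {enat (i + j) | i j. coef p i j \<noteq> 0}"
  have inf: "Inf A = enat k" using assms by (simp add: multiplicity_at_0_def A_def)
  show "ord_ge k p"
    unfolding ord_ge_def
  proof (intro allI impI, rule ccontr)
    fix i j assume ij: "i + j < k" "coef p i j \<noteq> 0"
    then have "enat (i + j) \<in> A" by (auto simp: A_def)
    then have "Inf A \<le> enat (i + j)" by (rule Inf_lower)
    then show False using ij inf by simp
  qed
  have "A \<noteq> {}" using inf by (auto simp: Inf_enat_def)
  then have "Inf A \<in> A" by (simp add: Inf_enat_def) (metis LeastI equals0I)
  then show "\<exists>i j. i + j = k \<and> coef p i j \<noteq> 0" using inf by (auto simp: A_def)
qed

text \<open>This form of the value semigroup is symmetric in the two components of the
  parametrization and refers to g by divisibility, so it survives the exchange of x and y.\<close>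

definition has_branch_orders :: "cps2 \<Rightarrow> nat set \<Rightarrow> bool" where
  "has_branch_orders g \<Gamma> \<longleftrightarrow> (\<exists>x y. fps_nth x 0 = 0 \<and> fps_nth y 0 = 0 \<and> (x, y) \<noteq> (0, 0) \<and>
     pullback g x y = 0 \<and> \<Gamma> = {subdegree (pullback h x y) | h. \<not> g dvd h})"

lemma has_value_semigroup_imp_branch_orders:
  "has_value_semigroup g \<Gamma> \<Longrightarrow> has_branch_orders g \<Gamma>"
  unfolding has_value_semigroup_def has_branch_orders_def primitive_parametrization_def
    parametrization_def mem_ideal_of_1 by blast

lemma subdegree_pullback_x_series:
  assumes "fps_nth x 0 = 0" "fps_nth y 0 = 0" "x \<noteq> 0" "is_unit U"
  shows "pullback (var_x ^ k * U) x y \<noteq> 0"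
    "subdegree (pullback (var_x ^ k * U) x y) = k * subdegree x"
proof -
  have U: "fps_nth (pullback U x y) 0 \<noteq> 0"
    using assms by (simp add: pullback_nth_0 is_unit_iff)
  then have "pullback U x y \<noteq> 0" by auto
  moreover have "subdegree (pullback U x y) = 0" using U by simp
  ultimately show "pullback (var_x ^ k * U) x y \<noteq> 0"
    "subdegree (pullback (var_x ^ k * U) x y) = k * subdegree x"
    using assms by (simp_all add: pullback_mult pullback_power pullback_var_x)
qed

lemma pullback_x_series_eq_0:
  assumes "pdy F = 0" "coef F 0 0 = 0" "fps_nth y 0 = 0"
  shows "pullback F 0 y = 0"
proof -
  have "coef F 0 j = 0" for j using assms by (cases j) (auto simp: pdy_eq_0_iff)
  then have "F = var_x ^ 1 * shift_x 1 F" by (intro x_power_dvdI) auto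
  then have "pullback F 0 y = pullback (var_x * shift_x 1 F) 0 y" by simp
  then show ?thesis using assms by (simp add: pullback_mult pullback_var_x)
qed

text \<open>Along a branch \<open>(y - A)\<^sup>2 = x\<^sup>k W\<close> with \<open>k\<close> odd, \<open>x\<close> has an even order \<open>2p\<close> and \<open>y - A\<close> the
  order \<open>kp\<close>, so the two terms of a remainder \<open>a (y - A) + c\<close> have different orders.\<close>

lemma branch_order_exponent:
  assumes g: "y_regular 2 g" "g = u * ((var_y - A)\<^sup>2 - D)" "is_unit u"
    and A: "pdy A = 0" "coef A 0 0 = 0" and D: "D = var_x ^ k * W" "pdy W = 0" "is_unit W"
    and k: "odd k" and n: "odd n" and orders: "has_branch_orders g (semigroup_gen2 2 n)"
  shows "k = n"
proof -
  obtain x y where x0: "fps_nth x 0 = 0" and y0: "fps_nth y 0 = 0" and xy: "(x, y) \<noteq> (0, 0)"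
    and gxy: "pullback g x y = 0"
    and \<Gamma>: "semigroup_gen2 2 n = {subdegree (pullback h x y) | h. \<not> g dvd h}"
    using orders unfolding has_branch_orders_def by blast
  define w where "w = pullback (var_y - A) x y"
  obtain u' where "u * u' = 1" using g(3) by (rule is_unit_obtain)
  then have "(var_y - A)\<^sup>2 - D = u' * g" unfolding g(2) by algebra
  then have "pullback ((var_y - A)\<^sup>2 - D) x y = 0"
    using x0 y0 by (simp add: pullback_mult gxy)
  then have wD: "w\<^sup>2 = pullback D x y"
    using x0 y0 by (simp add: w_def pullback_diff pullback_power)
  have "k \<noteq> 0" using odd_pos[OF k] by simp
  have x: "x \<noteq> 0"
  proof
    assume x: "x = 0"
    have "pullback D x y = 0"
      using x y0 \<open>k \<noteq> 0\<close> by (simp add: D(1) pullback_mult pullback_power pullback_var_x power_0_left)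
    then have "w = 0" using wD by simp
    then have "y = 0"
      using x y0 A pullback_x_series_eq_0[of A y] by (simp add: w_def pullback_diff pullback_var_y)
    then show False using x xy by simp
  qed
  have Dxy: "pullback D x y \<noteq> 0" "subdegree (pullback D x y) = k * subdegree x"
    unfolding D(1) using subdegree_pullback_x_series[OF x0 y0 x D(3)] by auto
  have w: "w \<noteq> 0" using wD Dxy by auto
  have "2 * subdegree w = k * subdegree x"
    using arg_cong[OF wD, of subdegree] Dxy by (simp add: subdegree_power)
  moreover from this have "even (subdegree x)" using k by (metis dvd_triv_left even_mult_iff)
  ultimately obtain p where p: "subdegree x = 2 * p" "subdegree w = k * p" by auto
  have "p \<noteq> 0" using p(1) x x0 nth_subdegree_nonzero[of x] by (metis mult_0_right)
  have orders_form: "\<exists>i j. subdegree (pullback h x y) = p * (2 * i + k * j)" if h: "\<not> g dvd h" for h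
  proof -
    obtain q a b where qab: "h = q * g + (a * var_y + b)" and a: "pdy a = 0" and b: "pdy b = 0"
      using Weierstrass_division_2[OF g(1)] .
    define c where "c = b + a * A"
    have c: "pdy c = 0" using a b A by (simp add: c_def pdy_mult)
    have h_eq: "h = q * g + (a * (var_y - A) + c)" unfolding qab c_def by algebra
    have hxy: "pullback h x y = pullback a x y * w + pullback c x y"
      using x0 y0 by (simp add: h_eq pullback_add pullback_mult gxy w_def)
    have series: "pullback F x y \<noteq> 0 \<and> (\<exists>i. subdegree (pullback F x y) = p * (2 * i))"
      if F: "pdy F = 0" "F \<noteq> 0" for F
    proof -
      obtain i U where "F = var_x ^ i * U" "pdy U = 0" "is_unit U" using x_series_factorization[OF F] .
      then show ?thesis using subdegree_pullback_x_series[OF x0 y0 x, of U i] p by auto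
    qed
    have "a \<noteq> 0 \<or> c \<noteq> 0" using h h_eq by auto
    then consider "a = 0" "c \<noteq> 0" | "a \<noteq> 0" "c = 0" | "a \<noteq> 0" "c \<noteq> 0"
      by blast
    then show ?thesis
    proof cases
      case 1
      then obtain i where "subdegree (pullback h x y) = p * (2 * i)"
        using series[OF c] hxy x0 y0 by (auto simp: pullback_0)
      then show ?thesis by (intro exI[of _ i] exI[of _ 0]) simp
    next
      case 2
      then obtain i where "subdegree (pullback a x y) = p * (2 * i)" "pullback a x y \<noteq> 0"
        using series[OF a] by blast
      then have "subdegree (pullback h x y) = p * (2 * i + k * 1)"
        using 2 hxy w p x0 y0 by (simp add: pullback_0 algebra_simps)
      then show ?thesis by blast
    next
      case 3
      obtain i where i: "subdegree (pullback a x y) = p * (2 * i)" "pullback a x y \<noteq> 0"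
        using series[OF a] 3 by blast
      obtain j where j: "subdegree (pullback c x y) = p * (2 * j)" "pullback c x y \<noteq> 0"
        using series[OF c] 3 by blast
      have aw: "subdegree (pullback a x y * w) = p * (2 * i + k)" "pullback a x y * w \<noteq> 0"
        using i w p by (simp_all add: algebra_simps)
      have "2 * i + k \<noteq> 2 * j" using k by presburger
      then have "subdegree (pullback a x y * w) < subdegree (pullback c x y) \<or>
          subdegree (pullback c x y) < subdegree (pullback a x y * w)"
        using \<open>p \<noteq> 0\<close> unfolding aw(1) j(1) by auto
      then have "subdegree (pullback h x y) = p * (2 * i + k * 1) \<or>
          subdegree (pullback h x y) = p * (2 * j + k * 0)"
        using aw j by (auto simp: hxy subdegree_add_eq1 subdegree_add_eq2)
      then show ?thesis by blast
    qed
  qed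
  \<comment> \<open>Every order along the branch is a multiple of p. As 2 and the odd number n are
    orders, p = 1. Now n lies in \<langle>2, k\<rangle>, and k, the order of y - A, lies in
    \<langle>2, n\<rangle>; since both are odd, each membership gives one inequality.\<close>
  have "2 \<in> semigroup_gen2 2 n" "n \<in> semigroup_gen2 2 n"
    by (auto simp: semigroup_gen2_def intro: exI[of _ 1] exI[of _ 0])
  then obtain i j i' j' where ij: "2 = p * (2 * i + k * j)" "n = p * (2 * i' + k * j')"
    using orders_form unfolding \<Gamma> by fastforce
  have "p dvd 2" "p dvd n" using ij by (metis dvd_triv_left)+
  then have "p \<le> 2" "p \<noteq> 2" using n by (auto dest: dvd_imp_le)
  then have p1: "p = 1" using \<open>p \<noteq> 0\<close> by simp
  have "k \<le> n"
  proof -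
    have "j' \<noteq> 0"
    proof
      assume "j' = 0"
      then have "n = 2 * i'" using ij(2) p1 by simp
      then show False using n by simp
    qed
    then obtain l where "j' = Suc l" using not0_implies_Suc by blast
    then show ?thesis using ij(2) p1 by simp
  qed
  moreover have "n \<le> k"
  proof -
    have "\<not> g dvd var_y - A"
      using w gxy x0 y0 by (auto simp: dvd_def w_def pullback_mult)
    then have "k \<in> semigroup_gen2 2 n"
      unfolding \<Gamma> using p p1 by (auto simp: w_def intro!: exI[of _ "var_y - A"])
    then obtain a b where ab: "k = a * 2 + b * n" by (auto simp: semigroup_gen2_def)
    have "b \<noteq> 0"
    proof
      assume "b = 0"
      then have "k = a * 2" using ab by simp
      then show False using k by simp
    qed
    then obtain l where "b = Suc l" using not0_implies_Suc by blast
    then show ?thesis using ab by simp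
  qed
  ultimately show ?thesis by simp
qed

text \<open>Otherwise (y - A)^2 - D would split into the non-units y - A - E and y - A + E.\<close>

lemma irreducible_imp_not_square:
  assumes "irreducible g" "g = u * ((var_y - A)\<^sup>2 - D)" "is_unit u" "coef A 0 0 = 0" "coef D 0 0 = 0"
  shows "D \<noteq> E\<^sup>2"
proof
  assume D: "D = E\<^sup>2"
  then have "coef E 0 0 = 0" using assms(5) by (simp add: coef_power_00)
  then have "\<not> is_unit (u * (var_y - A - E))" "\<not> is_unit (var_y - A + E)"
    using assms(4) by (simp_all add: is_unit_iff coef_mult_00 coef_var_y)
  moreover have "g = (u * (var_y - A - E)) * (var_y - A + E)" unfolding assms(2) D by algebra
  ultimately show False using assms(1) by (auto simp: irreducible_def)
qed

text \<open>Dividing y^2 by g leaves a y + b, and the quotient is a unit because g(0, y) has order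
  exactly 2. So g is a unit times y^2 - a y - b, and A = a/2 completes the square.\<close>

lemma complete_square:
  assumes "y_regular 2 g"
  obtains u A D where "g = u * ((var_y - A)\<^sup>2 - D)" "is_unit u" "pdy A = 0" "pdy D = 0"
    "coef A 0 0 = 0" "coef D 0 0 = 0"
proof -
  obtain q a b where qab: "var_y\<^sup>2 = q * g + (a * var_y + b)" and a: "pdy a = 0" and b: "pdy b = 0"
    using Weierstrass_division_2[OF assms] .
  have g: "coef g 0 0 = 0" "coef g 0 1 = 0" "coef g 0 2 \<noteq> 0"
    using assms by (auto simp: y_regular_def)
  have y2: "coef (var_y\<^sup>2) 0 j = (if j = 2 then 1 else 0)" for j
    using coef_y_power_mult[of 2 1 0 j] by (auto simp: coef_1)
  have ay: "coef (a * var_y) i j = (if j = 0 then 0 else coef a i (j - 1))" for i j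
    by (simp add: mult.commute[of a] coef_y_mult)
  have b00: "coef b 0 0 = 0"
    using arg_cong[OF qab, of "\<lambda>F. coef F 0 0"] g y2[of 0] by (simp add: coef_mult_00 coef_var_y)
  have "coef (q * g) 0 1 = 0" using g by (simp add: coef_mult atMost_Suc)
  then have a00: "coef a 0 0 = 0"
    using arg_cong[OF qab, of "\<lambda>F. coef F 0 1"] b y2[of 1] by (simp add: ay pdy_eq_0_iff)
  have "coef (q * g) 0 2 = coef q 0 0 * coef g 0 2"
    using g by (simp add: coef_mult atMost_Suc numeral_2_eq_2)
  then have "coef q 0 0 * coef g 0 2 = 1"
    using arg_cong[OF qab, of "\<lambda>F. coef F 0 2"] a b y2[of 2] by (simp add: ay pdy_eq_0_iff)
  then have "is_unit q" by (auto simp: is_unit_iff)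
  then obtain u where qu: "q * u = 1" by (rule is_unit_obtain)
  define A where "A = const (1 / 2) * a"
  have "const (1 / 2) * const 2 = 1" unfolding const_mult[symmetric] by simp
  then have "a = 2 * A" unfolding A_def const_numeral by algebra
  then have "g = u * ((var_y - A)\<^sup>2 - (A\<^sup>2 + b))" using qab qu by algebra
  moreover have "is_unit u" using qu by (metis dvd_triv_right)
  ultimately show thesis
    using a b a00 b00 by (intro that[of u A "A\<^sup>2 + b"]) (simp_all add: A_def pdy_mult pdy_power coef_power_00)
qed

section \<open>The normal form\<close>

lemma x_power_unit_cancel:
  assumes "var_x ^ i * U = var_x ^ j * V" "is_unit U" "is_unit V"
  shows "i = j"
proof -
  have le: "i \<le> j" if "var_x ^ i * U = var_x ^ j * V" "is_unit V" for i j U V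
    using arg_cong[OF that(1), of "\<lambda>F. coef F j 0"] that(2)
    by (auto simp: coef_x_power_mult is_unit_iff split: if_splits)
  show ?thesis using le[OF assms(1,3)] le[OF assms(1)[symmetric] assms(2)] by simp
qed

text \<open>Used to reduce the ideal of the two shifted curves to (y, x^l), where l is the order of
  \<alpha>^2 - D.\<close>

lemma ideal_of_2_units:
  assumes "is_unit u" "is_unit v" "is_unit w"
  shows "ideal_of {u * a, v * (a * c + w * b)} = ideal_of {a, b}"
proof (intro set_eqI iffI)
  fix h assume "h \<in> ideal_of {u * a, v * (a * c + w * b)}"
  then obtain p q where "h = p * (u * a) + q * (v * (a * c + w * b))"
    unfolding mem_ideal_of_2 by blast
  then have "h = (p * u + q * v * c) * a + (q * v * w) * b" by algebra
  then show "h \<in> ideal_of {a, b}" unfolding mem_ideal_of_2 by blast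
next
  fix h assume "h \<in> ideal_of {a, b}"
  then obtain p q where h: "h = p * a + q * b" unfolding mem_ideal_of_2 by blast
  obtain u' where u': "u * u' = 1" using assms(1) by (rule is_unit_obtain)
  obtain v' where v': "v * v' = 1" using assms(2) by (rule is_unit_obtain)
  obtain w' where w': "w * w' = 1" using assms(3) by (rule is_unit_obtain)
  have "h = ((p - q * w' * c) * u') * (u * a) + (q * w' * v') * (v * (a * c + w * b))"
    using h u' v' w' by algebra
  then show "h \<in> ideal_of {u * a, v * (a * c + w * b)}" unfolding mem_ideal_of_2 by blast
qed

lemma inverse_coordinates_shift:
  assumes "pdy r = 0" "coef r 0 0 = 0"
  shows "inverse_coordinates var_x (var_y + r) var_x (var_y - r)"
  using assms
  by (simp add: inverse_coordinates_def coef_var_x coef_var_y subst_var_x subst_var_y subst_add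
      subst_diff subst_x_series_id)

text \<open>The map (x, y) \<mapsto> (\<phi>(x), v(x) y) is undone by \<psi> on the first component;
  the second must then be divided by v at \<psi>(x), not at x.\<close>

lemma inverse_coordinates_scale:
  assumes \<phi>: "pdy \<phi> = 0" "coef \<phi> 0 0 = 0" and \<psi>: "pdy \<psi> = 0" "coef \<psi> 0 0 = 0"
    and inv: "subst \<psi> \<phi> 0 = var_x" "subst \<phi> \<psi> 0 = var_x"
    and v: "v * v' = 1" "pdy v = 0"
  shows "inverse_coordinates \<phi> (v * var_y) \<psi> (subst v' \<psi> 0 * var_y)"
proof -
  have v': "pdy v' = 0" using pdy_inverse v by blast
  have vv: "subst v F 0 * subst v' F 0 = 1" if "coef F 0 0 = 0" for F
    using v(1) that by (simp add: subst_mult[symmetric] subst_1)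
  define Y V where "Y = v * var_y" and "V = subst v' \<psi> 0 * var_y"
  have YV: "coef Y 0 0 = 0" "coef V 0 0 = 0" by (simp_all add: Y_def V_def coef_mult_00 coef_var_y)
  have 1: "subst v \<psi> V = subst v \<psi> 0" "subst \<phi> \<psi> V = subst \<phi> \<psi> 0" "subst \<psi> \<phi> Y = subst \<psi> \<phi> 0"
    using v \<phi> \<psi> YV by (auto intro: subst_x_series)
  have "subst Y \<psi> V = subst v \<psi> 0 * V"
    using \<psi> YV by (simp add: Y_def subst_mult subst_var_y 1)
  also have "\<dots> = var_y" using vv[OF \<psi>(2)] unfolding V_def by algebra
  finally have a: "subst Y \<psi> V = var_y" .
  have "subst V \<phi> Y = subst v' (subst \<psi> \<phi> Y) 0 * Y"
    using \<phi> \<psi> YV by (simp add: V_def subst_mult subst_var_y subst_subst subst_0)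
  also have "\<dots> = v' * Y"
    using v' by (simp add: 1 inv subst_x_series_id)
  also have "\<dots> = var_y" using v(1) unfolding Y_def by algebra
  finally show ?thesis
    unfolding Y_def[symmetric] V_def[symmetric]
    using a \<phi> \<psi> inv YV by (simp add: inverse_coordinates_def 1)
qed

lemma normal_form_y_regular:
  assumes f1: "coef f\<^sub>1 0 0 = 0" "coef f\<^sub>1 0 1 \<noteq> 0"
    and g: "y_regular 2 g" "irreducible g" "has_branch_orders g (semigroup_gen2 2 n)"
    and int: "intersection_number f\<^sub>1 g = enat (2 * m)" and n: "odd n" and mn: "2 * m < n"
  shows "\<exists>X Y U V u. inverse_coordinates X Y U V \<and> is_unit u \<and>
    subst (f\<^sub>1 * g) X Y = u * (var_y * ((var_y - var_x ^ m)\<^sup>2 - var_x ^ n))"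
proof -
  have v0: "coef var_x 0 0 = 0" "coef var_y 0 0 = 0" by (simp_all add: coef_var_x coef_var_y)
  obtain u1 r where u1: "f\<^sub>1 = u1 * (var_y - r)" "is_unit u1" and r: "pdy r = 0" "coef r 0 0 = 0"
    using implicit_function[OF f1] .
  obtain u2 A D where u2: "g = u2 * ((var_y - A)\<^sup>2 - D)" "is_unit u2"
    and AD: "pdy A = 0" "pdy D = 0" "coef A 0 0 = 0" "coef D 0 0 = 0"
    using complete_square[OF g(1)] .
  have not_square: "D \<noteq> E\<^sup>2" for E
    using irreducible_imp_not_square[OF g(2) u2 AD(3,4)] .
  then have "D \<noteq> 0" using not_square[of 0] by simp
  then obtain k W where D: "D = var_x ^ k * W" "pdy W = 0" "is_unit W"
    using x_series_factorization AD(2) by blast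
  have "odd k"
  proof
    assume "even k"
    then obtain e where e: "k = 2 * e" by blast
    obtain S where S: "S\<^sup>2 = W" using x_series_root[of W 2] D by auto
    have "D = (var_x ^ e * S)\<^sup>2" by (simp add: D(1) e S power_mult_distrib power_even_eq)
    then show False using not_square by blast
  qed
  then have kn: "k = n"
    using branch_order_exponent[OF g(1) u2 AD(1,3) D _ n g(3)] by blast
  define \<alpha> where "\<alpha> = A - r"
  define Y1 where "Y1 = var_y + r"
  have Y1: "coef Y1 0 0 = 0" using r v0 by (simp add: Y1_def)
  have inv1: "inverse_coordinates var_x Y1 var_x (var_y - r)"
    unfolding Y1_def using r by (rule inverse_coordinates_shift)
  define w1 w2 where "w1 = subst u1 var_x Y1" and "w2 = subst u2 var_x Y1"
  have w: "is_unit w1" "is_unit w2"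
    using u1(2) u2(2) v0 Y1 by (simp_all add: w1_def w2_def subst_unit)
  have f1': "subst f\<^sub>1 var_x Y1 = w1 * var_y"
    using v0 Y1 r
    by (simp add: u1(1) w1_def subst_mult subst_diff subst_var_y subst_x_series_id) (simp add: Y1_def)
  have "subst g var_x Y1 = w2 * ((Y1 - A)\<^sup>2 - D)"
    using v0 Y1 AD
    by (simp add: u2(1) w2_def subst_mult subst_diff subst_power subst_var_y subst_x_series_id)
  then have g': "subst g var_x Y1 = w2 * ((var_y - \<alpha>)\<^sup>2 - D)"
    by (simp add: Y1_def \<alpha>_def algebra_simps)
  have \<alpha>: "pdy \<alpha> = 0" using r AD by (simp add: \<alpha>_def)
  have "\<alpha>\<^sup>2 - D \<noteq> 0" using not_square[of \<alpha>] by auto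
  moreover have "pdy (\<alpha>\<^sup>2 - D) = 0" using \<alpha> AD by (simp add: pdy_power)
  ultimately obtain l B where B: "\<alpha>\<^sup>2 - D = var_x ^ l * B" "pdy B = 0" "is_unit B"
    using x_series_factorization by blast
  have "intersection_number (subst f\<^sub>1 var_x Y1) (subst g var_x Y1) = enat (2 * m)"
    by (rule intersection_number_subst[OF inv1 int])
  moreover have "subst g var_x Y1 = w2 * (var_y * (var_y - 2 * \<alpha>) + B * var_x ^ l)"
  proof -
    have "(var_y - \<alpha>)\<^sup>2 - D = var_y * (var_y - 2 * \<alpha>) + (\<alpha>\<^sup>2 - D)" by algebra
    then show ?thesis by (simp only: g' B(1) mult.commute)
  qed
  ultimately have "quotient_dim (ideal_of {var_y, var_x ^ l}) = enat (2 * m)"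
    using w B(3) by (simp add: f1' intersection_number_def ideal_of_2_units)
  then have lm: "l = 2 * m" by (simp add: quotient_dim_y_x_power)
  have "var_x ^ n = var_x ^ (2 * m) * var_x ^ (n - 2 * m)"
    using mn by (simp flip: power_add)
  then have \<alpha>sq: "\<alpha>\<^sup>2 = var_x ^ (2 * m) * (B + var_x ^ (n - 2 * m) * W)"
  proof -
    have "a\<^sup>2 - d = p * b \<Longrightarrow> d = p * q * w \<Longrightarrow> a\<^sup>2 = p * (b + q * w)" for a b d p q w :: cps2
      by algebra
    then show ?thesis using B(1) D(1) \<open>var_x ^ n = _\<close> unfolding lm kn by metis
  qed
  \<comment> \<open>Since n - 2m > 0, the constant term is that of B. Hence \<alpha>^2 has order 2m,
    whatever W is.\<close>
  have BW: "is_unit (B + var_x ^ (n - 2 * m) * W)"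
    using B(3) mn by (simp add: is_unit_iff coef_x_power_mult)
  have "\<alpha> \<noteq> 0"
  proof
    assume "\<alpha> = 0"
    then have "D = var_x ^ (2 * m) * (- B)" using B(1) lm by (simp add: minus_equation_iff[of D])
    then have "n = 2 * m"
      using x_power_unit_cancel[of k W "2 * m" "- B"] D B(3) kn by simp
    then show False using mn by simp
  qed
  then obtain e a0 where a0: "\<alpha> = var_x ^ e * a0" "pdy a0 = 0" "is_unit a0"
    using x_series_factorization \<alpha> by blast
  have "var_x ^ (2 * e) * a0\<^sup>2 = var_x ^ (2 * m) * (B + var_x ^ (n - 2 * m) * W)"
    using \<alpha>sq by (simp add: a0(1) power_mult_distrib power_even_eq)
  then have "2 * e = 2 * m"
    using x_power_unit_cancel BW a0(3) by (metis is_unit_power_iff)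
  then have em: "e = m" by simp
  obtain b0 where b0: "a0 * b0 = 1" using a0(3) by (rule is_unit_obtain)
  have b0': "pdy b0 = 0" "is_unit b0"
    using pdy_inverse[OF b0 a0(2)] b0 by (auto intro: dvdI[of _ _ a0] simp: mult.commute)
  \<comment> \<open>As \<open>b0\<close> is the inverse of \<open>a0\<close>, the unit part of D /
    \<alpha>^2 is W \<open>b0\<close>^2. Taking its root makes \<psi> = x T satisfy \<psi>^(n - 2m)
    = D / \<alpha>^2.\<close>
  obtain T where T: "pdy T = 0" "is_unit T" "T ^ (n - 2 * m) = W * b0\<^sup>2"
  proof (rule x_series_root[of "W * b0\<^sup>2" "n - 2 * m"])
    show "pdy (W * b0\<^sup>2) = 0" "is_unit (W * b0\<^sup>2)"
      using D b0' by (simp_all add: pdy_mult pdy_power is_unit_iff coef_mult_00 coef_power_00)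
  qed (use mn in auto)
  define \<psi> where "\<psi> = var_x * T"
  have \<psi>: "pdy \<psi> = 0" "coef \<psi> 0 0 = 0" "coef \<psi> 1 0 \<noteq> 0"
    using T by (simp_all add: \<psi>_def pdy_mult coef_x_mult is_unit_iff)
  obtain \<phi> where \<phi>: "pdy \<phi> = 0" "coef \<phi> 0 0 = 0" "coef \<phi> 1 0 \<noteq> 0"
    and inv\<phi>: "subst \<psi> \<phi> 0 = var_x" "subst \<phi> \<psi> 0 = var_x"
    using x_series_inverse[OF \<psi>] .
  have D_eq: "D = \<alpha>\<^sup>2 * \<psi> ^ (n - 2 * m)"
  proof -
    have "(p * a)\<^sup>2 * (q * (w * b\<^sup>2)) = p\<^sup>2 * q * w * (a * b)\<^sup>2" for a b p q w :: cps2
      by algebra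
    then have "\<alpha>\<^sup>2 * \<psi> ^ (n - 2 * m) = (var_x ^ (2 * m) * var_x ^ (n - 2 * m)) * W * (a0 * b0)\<^sup>2"
      unfolding a0(1) em \<psi>_def power_mult_distrib[of var_x T] T(3) power_even_eq[of var_x m] .
    then show ?thesis using mn by (simp add: D(1) kn b0 flip: power_add)
  qed
  have "coef \<phi> 0 j = 0" for j using \<phi> by (cases j) (auto simp: pdy_eq_0_iff)
  then have \<phi>_eq: "\<phi> = var_x ^ 1 * shift_x 1 \<phi>" by (intro x_power_dvdI) auto
  \<comment> \<open>Since \<phi> is x times \<open>shift_x 1 \<phi>\<close>, this is
    \<alpha>(\<phi>(x)) / x^m, the rescaling factor for y.\<close>
  define v where "v = shift_x 1 \<phi> ^ m * subst a0 \<phi> 0"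
  have "is_unit v"
    using \<phi> a0(3) by (simp add: v_def is_unit_iff coef_mult_00 coef_power_00 coef_shift_x coef_subst_00)
  then obtain v' where v': "v * v' = 1" by (rule is_unit_obtain)
  have "pdy (shift_x 1 \<phi>) = 0" using \<phi>(1) by (simp add: pdy_eq_0_iff coef_shift_x)
  then have v: "pdy v = 0"
    using \<phi> a0(2) by (simp add: v_def pdy_mult pdy_power pdy_subst)
  have "subst \<alpha> \<phi> 0 = \<phi> ^ m * subst a0 \<phi> 0"
    using \<phi> by (simp add: a0(1) em subst_mult subst_power subst_var_x)
  also have "\<phi> ^ m = var_x ^ m * shift_x 1 \<phi> ^ m"
    using arg_cong[OF \<phi>_eq, of "\<lambda>F. F ^ m"] by (simp add: power_mult_distrib)
  also have "\<dots> * subst a0 \<phi> 0 = var_x ^ m * v" by (simp only: v_def mult.assoc)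
  finally have \<alpha>\<phi>: "subst \<alpha> \<phi> 0 = var_x ^ m * v" .
  have "subst D \<phi> 0 = (var_x ^ m * v)\<^sup>2 * var_x ^ (n - 2 * m)"
    using \<phi> by (simp add: D_eq subst_mult subst_power \<alpha>\<phi> inv\<phi>)
  also have "\<dots> = v\<^sup>2 * (var_x ^ (2 * m) * var_x ^ (n - 2 * m))"
    by (simp add: power_mult_distrib power_even_eq)
  finally have D\<phi>: "subst D \<phi> 0 = v\<^sup>2 * var_x ^ n"
    using mn by (simp flip: power_add)
  define Y2 where "Y2 = v * var_y"
  have Y2: "coef Y2 0 0 = 0" using v0 by (simp add: Y2_def coef_mult_00)
  have inv2: "inverse_coordinates \<phi> Y2 \<psi> (subst v' \<psi> 0 * var_y)"
    unfolding Y2_def using \<phi> \<psi> inv\<phi> v' v by (intro inverse_coordinates_scale)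
  have series: "subst F \<phi> Y2 = subst F \<phi> 0" if "pdy F = 0" for F
    using that \<phi> Y2 by (intro subst_x_series) simp_all
  \<comment> \<open>One factor v comes from the line y = 0 and two from the quadratic
    factor.\<close>
  define u where "u = subst (w1 * w2) \<phi> Y2 * v ^ 3"
  have "is_unit u"
    using w \<open>is_unit v\<close> \<phi> Y2
    by (simp add: u_def is_unit_iff coef_mult_00 coef_power_00 coef_subst_00)
  have "subst (f\<^sub>1 * g) var_x Y1 = (w1 * w2) * (var_y * ((var_y - \<alpha>)\<^sup>2 - D))"
    by (simp only: subst_mult[OF v0(1) Y1] f1' g' mult_ac)
  then have "subst (subst (f\<^sub>1 * g) var_x Y1) \<phi> Y2
      = subst (w1 * w2) \<phi> Y2 * (Y2 * ((Y2 - subst \<alpha> \<phi> Y2)\<^sup>2 - subst D \<phi> Y2))"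
    using \<phi> Y2 by (simp add: subst_mult subst_diff subst_power subst_var_y)
  also have "\<dots> = subst (w1 * w2) \<phi> Y2 * (Y2 * ((Y2 - var_x ^ m * v)\<^sup>2 - v\<^sup>2 * var_x ^ n))"
    by (simp add: series \<alpha> AD(2) \<alpha>\<phi> D\<phi>)
  also have "\<dots> = u * (var_y * ((var_y - var_x ^ m)\<^sup>2 - var_x ^ n))"
  proof -
    have "w * ((v * y) * ((v * y - p * v)\<^sup>2 - v\<^sup>2 * q)) = (w * v ^ 3) * (y * ((y - p)\<^sup>2 - q))"
      for w y p q :: cps2 by algebra
    then show ?thesis unfolding u_def Y2_def .
  qed
  finally have "subst (f\<^sub>1 * g) (subst var_x \<phi> Y2) (subst Y1 \<phi> Y2)
      = u * (var_y * ((var_y - var_x ^ m)\<^sup>2 - var_x ^ n))"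
    using v0 Y1 Y2 \<phi> by (simp add: subst_subst)
  then show ?thesis
    using inverse_coordinates_comp[OF inv1 inv2] \<open>is_unit u\<close> by blast
qed

section \<open>Exchanging the coordinates to make both factors y-regular\<close>

lemma coef_swap: "coef (subst F var_y var_x) i j = coef F j i"
proof -
  have "coef (var_y ^ k * var_x ^ l) i j = (if k = j \<and> l = i then 1 else 0)" for k l
    using coef_monomial[of 1 l k i j] by (auto simp: mult.commute)
  then have "coef (subst F var_y var_x) i j
      = (\<Sum>k\<le>i + j. \<Sum>l\<le>i + j. (if k = j \<and> l = i then 1 else 0) * coef F k l)"
    by (simp add: coef_subst coef_var_x coef_var_y mult.commute)
  then show ?thesis unfolding sum_sum_delta by simp
qed

lemma has_branch_orders_swap:
  assumes "has_branch_orders g \<Gamma>"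
  shows "has_branch_orders (subst g var_y var_x) \<Gamma>"
proof -
  define \<sigma> where "\<sigma> F = subst F var_y var_x" for F
  have \<sigma>\<sigma>: "\<sigma> (\<sigma> F) = F" for F
    unfolding \<sigma>_def by (rule inverse_coordinates_subst[OF inverse_coordinates_swap])
  have dvd: "\<sigma> F dvd \<sigma> G" if "F dvd G" for F G
    using that unfolding \<sigma>_def by (rule subst_dvd[rotated 2]) (simp_all add: coef_var_x coef_var_y)
  then have dvd_iff: "\<sigma> F dvd \<sigma> G \<longleftrightarrow> F dvd G" for F G
    using \<sigma>\<sigma> by metis
  obtain x y where xy: "fps_nth x 0 = 0" "fps_nth y 0 = 0" "(x, y) \<noteq> (0, 0)" "pullback g x y = 0"
    and \<Gamma>: "\<Gamma> = {subdegree (pullback h x y) | h. \<not> g dvd h}"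
    using assms unfolding has_branch_orders_def by blast
  have swap: "pullback (\<sigma> h) y x = pullback h x y" for h
    unfolding \<sigma>_def by (rule pullback_swap[OF xy(1,2)])
  have "{subdegree (pullback h y x) | h. \<not> \<sigma> g dvd h} = {subdegree (pullback (\<sigma> h) y x) | h. \<not> \<sigma> g dvd \<sigma> h}"
    using \<sigma>\<sigma> by metis
  also have "\<dots> = \<Gamma>" unfolding swap dvd_iff \<Gamma> ..
  finally show ?thesis
    unfolding has_branch_orders_def \<sigma>_def[symmetric] using xy swap[of g]
    by (intro exI[of _ y] exI[of _ x]) auto
qed

text \<open>The point (0, 1) avoids the tangent cone of the first factor when its coefficient of y
  is nonzero, and that of g when its coefficient of y^2 is; similarly (1, 0) tests x and x^2. Since
  the cones agree, both factors are regular in the same coordinate.\<close>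

lemma normal_form:
  assumes mult: "multiplicity_at_0 f\<^sub>1 = 1" "multiplicity_at_0 g = 2"
    and g: "irreducible g" "has_value_semigroup g (semigroup_gen2 2 n)"
    and tangent: "tangent_cone f\<^sub>1 = tangent_cone g"
    and int: "intersection_number f\<^sub>1 g = enat (2 * m)" and n: "odd n" and mn: "2 * m < n"
  shows "\<exists>X Y U V u. inverse_coordinates X Y U V \<and> is_unit u \<and>
    subst (f\<^sub>1 * g) X Y = u * (var_y * ((var_y - var_x ^ m)\<^sup>2 - var_x ^ n))"
proof -
  have ord: "ord_ge 1 f\<^sub>1" "ord_ge 2 g" and "\<exists>i j. i + j = 1 \<and> coef f\<^sub>1 i j \<noteq> 0"
    using multiplicity_at_0_D[of f\<^sub>1 1] multiplicity_at_0_D[of g 2] mult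
    by (auto simp: one_enat_def numeral_eq_enat)
  then obtain i j where "i + j = 1" "coef f\<^sub>1 i j \<noteq> 0" by blast
  then have f1: "coef f\<^sub>1 0 1 \<noteq> 0 \<or> coef f\<^sub>1 1 0 \<noteq> 0" by (cases i) auto
  have cone: "(a, b) \<in> tangent_cone f\<^sub>1 \<longleftrightarrow> coef f\<^sub>1 0 1 * b + coef f\<^sub>1 1 0 * a = 0"
    "(a, b) \<in> tangent_cone g \<longleftrightarrow> coef g 0 2 * b\<^sup>2 + coef g 1 1 * a * b + coef g 2 0 * a\<^sup>2 = 0" for a b
    using mult by (simp_all add: tangent_cone_def one_enat_def numeral_eq_enat numeral_2_eq_2 atMost_Suc
        algebra_simps)
  have branch: "has_branch_orders g (semigroup_gen2 2 n)"
    using g(2) by (rule has_value_semigroup_imp_branch_orders)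
  have coef0: "coef f\<^sub>1 0 0 = 0" "coef g 0 0 = 0" "coef g 0 1 = 0" "coef g 1 0 = 0"
    using ord by (auto simp: ord_ge_def)
  show ?thesis
  proof (cases "coef f\<^sub>1 0 1 = 0")
    case False
    then have "coef g 0 2 \<noteq> 0"
      using cone[of 0 1] tangent by simp
    then have "y_regular 2 g"
      using coef0 by (auto simp: y_regular_def less_2_cases_iff)
    then show ?thesis
      using normal_form_y_regular[OF coef0(1) False _ g(1) branch int n mn] by blast
  next
    case True
    define \<sigma> where "\<sigma> F = subst F var_y var_x" for F
    have "coef g 2 0 \<noteq> 0"
      using cone[of 1 0] tangent True f1 by simp
    then have "y_regular 2 (\<sigma> g)"
      using coef0 by (auto simp: y_regular_def less_2_cases_iff \<sigma>_def coef_swap)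
    moreover have "coef (\<sigma> f\<^sub>1) 0 0 = 0" "coef (\<sigma> f\<^sub>1) 0 1 \<noteq> 0"
      using coef0 True f1 by (auto simp: \<sigma>_def coef_swap)
    moreover have "irreducible (\<sigma> g)"
      unfolding \<sigma>_def by (rule irreducible_subst[OF inverse_coordinates_swap g(1)])
    moreover have "has_branch_orders (\<sigma> g) (semigroup_gen2 2 n)"
      unfolding \<sigma>_def by (rule has_branch_orders_swap[OF branch])
    moreover have "intersection_number (\<sigma> f\<^sub>1) (\<sigma> g) = enat (2 * m)"
      unfolding \<sigma>_def by (rule intersection_number_subst[OF inverse_coordinates_swap int])
    ultimately obtain X Y U V u where inv: "inverse_coordinates X Y U V" and "is_unit u"
      and eq: "subst (\<sigma> f\<^sub>1 * \<sigma> g) X Y = u * (var_y * ((var_y - var_x ^ m)\<^sup>2 - var_x ^ n))"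
      using normal_form_y_regular[OF _ _ _ _ _ _ n mn, of "\<sigma> f\<^sub>1" "\<sigma> g"] by blast
    have XY: "coef X 0 0 = 0" "coef Y 0 0 = 0" using inv by (auto simp: inverse_coordinates_def)
    have v0: "coef var_x 0 0 = 0" "coef var_y 0 0 = 0" by (simp_all add: coef_var_x coef_var_y)
    have "subst (\<sigma> f\<^sub>1 * \<sigma> g) X Y = subst (f\<^sub>1 * g) (subst var_y X Y) (subst var_x X Y)"
      using v0 XY by (simp add: \<sigma>_def subst_mult[symmetric] subst_subst)
    then show ?thesis
      using inverse_coordinates_comp[OF inverse_coordinates_swap inv] eq \<open>is_unit u\<close> by metis
  qed
qed


section \<open>Saito's criterion\<close>

definition wedge :: "form \<Rightarrow> form \<Rightarrow> cps2" where
  "wedge \<omega> \<eta> = fst \<omega> * snd \<eta> - snd \<omega> * fst \<eta>"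

text \<open>The first assumption would follow from unique factorization in \<^typ>\<open>cps2\<close>. For a product of
  two elements that are known to be prime it needs much less.\<close>

context
  fixes f :: cps2
  assumes Gauss: "\<And>c h. coprime c f \<Longrightarrow> f dvd c * h \<Longrightarrow> f dvd h"
    and coprime_pdy: "coprime (pdy f) f"
begin

text \<open>Wedging with df removes the multiple of df, and the multiplier is cancelled by Gauss.
  Conversely f_y serves as multiplier for every form: if \<omega> = A dx + B dy and A f_y - B f_x =
  f k, then f_y \<omega> = B df + f k dx.\<close>

lemma mem_saito_module_iff: "\<omega> \<in> saito_module f \<longleftrightarrow> f dvd wedge \<omega> (differential f)"
proof
  assume "\<omega> \<in> saito_module f"
  then obtain c p \<eta> where c: "coprime c f"
    and eq: "form_scale c \<omega> = form_scale p (differential f) + form_scale f \<eta>"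
    unfolding saito_module_def F_module_def by blast
  have "c * fst \<omega> = p * pdx f + f * fst \<eta>" "c * snd \<omega> = p * pdy f + f * snd \<eta>"
    using arg_cong[OF eq, of fst] arg_cong[OF eq, of snd]
    by (simp_all add: form_scale_def differential_def)
  then have "c * wedge \<omega> (differential f) = f * (fst \<eta> * pdy f - snd \<eta> * pdx f)"
    unfolding wedge_def differential_def fst_conv snd_conv by algebra
  then have "f dvd c * wedge \<omega> (differential f)" by (rule dvdI)
  then show "f dvd wedge \<omega> (differential f)" by (rule Gauss[OF c])
next
  assume "f dvd wedge \<omega> (differential f)"
  then obtain k where "fst \<omega> * pdy f - snd \<omega> * pdx f = f * k"
    by (auto simp: dvd_def wedge_def differential_def)
  then have "pdy f * fst \<omega> = snd \<omega> * pdx f + f * k" by algebra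
  then have "form_scale (pdy f) \<omega> = form_scale (snd \<omega>) (differential f) + form_scale f (k, 0)"
    by (simp add: form_scale_def differential_def mult.commute)
  then show "\<omega> \<in> saito_module f"
    unfolding saito_module_def F_module_def using coprime_pdy by blast
qed

text \<open>After multiplication by f_y both forms are multiples of df modulo f, and df \<and> df =
  0; the factor f_y is then cancelled.\<close>

lemma dvd_wedge_saito_module:
  assumes "\<omega> \<in> saito_module f" "\<eta> \<in> saito_module f"
  shows "f dvd wedge \<omega> \<eta>"
proof -
  obtain k l where "wedge \<omega> (differential f) = f * k" "wedge \<eta> (differential f) = f * l"
    using assms unfolding mem_saito_module_iff dvd_def by blast
  then have "pdy f * wedge \<omega> \<eta> = f * (k * snd \<eta> - l * snd \<omega>)"
    unfolding wedge_def differential_def fst_conv snd_conv by algebra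
  then have "f dvd pdy f * wedge \<omega> \<eta>" by (rule dvdI)
  then show ?thesis by (rule Gauss[OF coprime_pdy])
qed

text \<open>Cramer's rule: the coordinates of \<omega> are \<omega> \<and>
  \<open>\<omega>\<^sub>2\<close> and \<open>\<omega>\<^sub>1\<close> \<and> \<omega>, each divided
  by \<open>\<omega>\<^sub>1\<close> \<and> \<open>\<omega>\<^sub>2\<close>. The numerators are
  divisible by f, and the denominator is f times a unit.\<close>

theorem saito_basis_criterion:
  assumes mem: "\<omega>\<^sub>1 \<in> saito_module f" "\<omega>\<^sub>2 \<in> saito_module f"
    and w: "wedge \<omega>\<^sub>1 \<omega>\<^sub>2 = u * f" and u: "is_unit u" and "f \<noteq> 0"
  shows "saito_basis f \<omega>\<^sub>1 \<omega>\<^sub>2"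
proof -
  have nz: "wedge \<omega>\<^sub>1 \<omega>\<^sub>2 \<noteq> 0" using w u \<open>f \<noteq> 0\<close> by auto
  have neq: "\<omega>\<^sub>1 \<noteq> \<omega>\<^sub>2" using nz by (auto simp: wedge_def mult.commute)
  have indep: "forms.independent {\<omega>\<^sub>1, \<omega>\<^sub>2}"
  proof
    assume "forms.dependent {\<omega>\<^sub>1, \<omega>\<^sub>2}"
    then obtain t c where t: "finite t" "t \<subseteq> {\<omega>\<^sub>1, \<omega>\<^sub>2}" "(\<Sum>v\<in>t. form_scale (c v) v) = 0"
      and c: "\<exists>v\<in>t. c v \<noteq> 0"
      unfolding forms.dependent_explicit by blast
    define d where "d v = (if v \<in> t then c v else 0)" for v
    have "(\<Sum>v\<in>{\<omega>\<^sub>1, \<omega>\<^sub>2}. form_scale (d v) v) = (\<Sum>v\<in>t. form_scale (d v) v)"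
      using t by (intro sum.mono_neutral_right) (auto simp: d_def)
    also have "\<dots> = 0" using t(3) by (simp add: d_def)
    finally have sum0: "form_scale (d \<omega>\<^sub>1) \<omega>\<^sub>1 + form_scale (d \<omega>\<^sub>2) \<omega>\<^sub>2 = 0" using neq by simp
    have comp: "d \<omega>\<^sub>1 * fst \<omega>\<^sub>1 + d \<omega>\<^sub>2 * fst \<omega>\<^sub>2 = 0" "d \<omega>\<^sub>1 * snd \<omega>\<^sub>1 + d \<omega>\<^sub>2 * snd \<omega>\<^sub>2 = 0"
      using arg_cong[OF sum0, of fst] arg_cong[OF sum0, of snd] by (simp_all add: form_scale_def)
    have "d \<omega>\<^sub>1 * wedge \<omega>\<^sub>1 \<omega>\<^sub>2 = 0" "d \<omega>\<^sub>2 * wedge \<omega>\<^sub>1 \<omega>\<^sub>2 = 0"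
      using comp unfolding wedge_def by algebra+
    then have "d \<omega>\<^sub>1 = 0" "d \<omega>\<^sub>2 = 0" using nz by simp_all
    then show False using c t(2) unfolding d_def by (metis empty_iff insert_iff subsetD)
  qed
  have span: "\<omega> \<in> forms.span {\<omega>\<^sub>1, \<omega>\<^sub>2}
      \<longleftrightarrow> (\<exists>a b. \<omega> = form_scale a \<omega>\<^sub>1 + form_scale b \<omega>\<^sub>2)" for \<omega>
  proof -
    have "\<omega> \<in> forms.span {\<omega>\<^sub>1, \<omega>\<^sub>2} \<longleftrightarrow> (\<exists>a b. \<omega> - form_scale a \<omega>\<^sub>1 = form_scale b \<omega>\<^sub>2)"
      unfolding forms.span_insert[of \<omega>\<^sub>1] forms.span_singleton by blast
    then show ?thesis by (simp add: diff_eq_eq add.commute)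
  qed
  have "forms.span {\<omega>\<^sub>1, \<omega>\<^sub>2} = saito_module f"
  proof (intro set_eqI iffI)
    fix \<omega> assume "\<omega> \<in> forms.span {\<omega>\<^sub>1, \<omega>\<^sub>2}"
    then obtain a b where \<omega>: "\<omega> = form_scale a \<omega>\<^sub>1 + form_scale b \<omega>\<^sub>2" unfolding span by blast
    have "wedge \<omega> (differential f) = a * wedge \<omega>\<^sub>1 (differential f) + b * wedge \<omega>\<^sub>2 (differential f)"
      unfolding \<omega> wedge_def form_scale_def fst_add snd_add fst_conv snd_conv by algebra
    then show "\<omega> \<in> saito_module f"
      using mem unfolding mem_saito_module_iff by simp
  next
    fix \<omega> assume \<omega>: "\<omega> \<in> saito_module f"
    obtain a b where ab: "wedge \<omega> \<omega>\<^sub>2 = f * a" "wedge \<omega>\<^sub>1 \<omega> = f * b"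
      using dvd_wedge_saito_module[OF \<omega> mem(2)] dvd_wedge_saito_module[OF mem(1) \<omega>]
      by (auto simp: dvd_def)
    obtain v where v: "u * v = 1" using u by (rule is_unit_obtain)
    have cancel: "p = q" if "f * p = f * q" for p q using that \<open>f \<noteq> 0\<close> by simp
    have "fst \<omega> = (v * a) * fst \<omega>\<^sub>1 + (v * b) * fst \<omega>\<^sub>2"
      by (rule cancel) (use ab w v in \<open>unfold wedge_def, algebra\<close>)
    moreover have "snd \<omega> = (v * a) * snd \<omega>\<^sub>1 + (v * b) * snd \<omega>\<^sub>2"
      by (rule cancel) (use ab w v in \<open>unfold wedge_def, algebra\<close>)
    ultimately have "\<omega> = form_scale (v * a) \<omega>\<^sub>1 + form_scale (v * b) \<omega>\<^sub>2"
      by (simp add: form_scale_def prod_eq_iff)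
    then show "\<omega> \<in> forms.span {\<omega>\<^sub>1, \<omega>\<^sub>2}" unfolding span by blast
  qed
  then show ?thesis using neq indep by (simp add: saito_basis_def)
qed

end

text \<open>Neither prime divides c, as it would be a common divisor of c and p q. So p, and after
  cancelling it q, passes from c h to h.\<close>

lemma product_of_primes_Gauss:
  fixes p q c h :: cps2
  assumes p: "prime_elem p" and q: "prime_elem q" and c: "coprime c (p * q)" and "p * q dvd c * h"
  shows "p * q dvd h"
proof -
  have np: "\<not> p dvd c" and nq: "\<not> q dvd c"
    using p q coprime_common_divisor[OF c] by (auto simp: prime_elem_def)
  have "p dvd c * h" using assms(4) by (rule dvd_mult_left)
  then obtain h' where h': "h = p * h'" using np p by (auto simp: prime_elem_dvd_mult_iff)
  have "p * q dvd p * (c * h')" using assms(4) by (simp add: h' mult.left_commute)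
  then have "q dvd c * h'" using p by (simp add: prime_elem_def)
  then show ?thesis using nq q by (simp add: h' prime_elem_dvd_mult_iff)
qed

text \<open>Neither prime divides a common divisor d, so both pass to the cofactor of d in p q.
  Cancelling them leaves 1 as a multiple of d.\<close>

lemma coprime_product_of_primes:
  fixes p q c :: cps2
  assumes p: "prime_elem p" and q: "prime_elem q" and "\<not> p dvd c" "\<not> q dvd c"
  shows "coprime c (p * q)"
proof (rule coprimeI)
  fix d assume dc: "d dvd c" and "d dvd p * q"
  then obtain e where e: "p * q = d * e" by (auto simp: dvd_def)
  have "\<not> p dvd d" "\<not> q dvd d" using assms(3,4) dc by (meson dvd_trans)+
  have "p dvd d * e" using e by (metis dvd_triv_left)
  then obtain e' where e': "e = p * e'" using p \<open>\<not> p dvd d\<close> by (auto simp: prime_elem_dvd_mult_iff)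
  have "p * q = p * (d * e')" using e e' by (simp add: mult.left_commute)
  then have q_eq: "q = d * e'" using p by (simp add: prime_elem_def)
  then have "q dvd d * e'" by simp
  then obtain e'' where "e' = q * e''" using q \<open>\<not> q dvd d\<close> by (auto simp: prime_elem_dvd_mult_iff)
  then have "q * 1 = q * (d * e'')" using q_eq by (metis mult.left_commute mult_1_right)
  then have "1 = d * e''" using q by (simp add: prime_elem_def)
  then show "is_unit d" by (rule dvdI)
qed

text \<open>Pullback is a ring homomorphism into a domain that maps 1 to 1, so its kernel is a prime
  ideal.\<close>

lemma prime_elem_if_kernel:
  assumes x0: "fps_nth x 0 = 0" and y0: "fps_nth y 0 = 0"
    and kernel: "\<And>h. p dvd h \<longleftrightarrow> pullback h x y = 0" and "p \<noteq> 0"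
  shows "prime_elem p"
proof (rule prime_elemI)
  have "pullback 1 x y = 1" by (rule pullback_1[OF x0 y0])
  then show "\<not> is_unit p" unfolding kernel by simp
qed (use assms in \<open>auto simp: pullback_mult\<close>)

section \<open>The curve \<open>y ((y - x\<^sup>m)\<^sup>2 - x\<^sup>n) = 0\<close>\<close>

lemma x_series_pullback_eq_0_iff:
  assumes "pdy F = 0" "fps_nth x 0 = 0" "fps_nth y 0 = 0" "x \<noteq> 0"
  shows "pullback F x y = 0 \<longleftrightarrow> F = 0"
proof
  show "F = 0" if "pullback F x y = 0"
  proof (rule ccontr)
    assume "F \<noteq> 0"
    then obtain k U where "F = var_x ^ k * U" "pdy U = 0" "is_unit U"
      using x_series_factorization[OF assms(1)] by metis
    then show False using subdegree_pullback_x_series(1)[of x y U k] assms that by simp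
  qed
qed (use assms in \<open>simp add: pullback_0\<close>)

lemma var_y_dvd_iff: "var_y dvd h \<longleftrightarrow> pullback h fps_X 0 = 0"
proof -
  have "y_regular 1 var_y" by (simp add: y_regular_def coef_var_y)
  then obtain q r where h: "h = q * var_y + r" and r: "pdy r = 0" by (rule Weierstrass_division_1)
  have "pullback h fps_X 0 = pullback r fps_X 0"
    by (simp add: h pullback_add pullback_mult pullback_var_y)
  also have "\<dots> = 0 \<longleftrightarrow> r = 0" using r by (simp add: x_series_pullback_eq_0_iff)
  finally show ?thesis
    using r h by (auto simp: x_series_pullback_eq_0_iff pullback_mult pullback_var_y dvd_def)
qed

lemma prime_elem_var_y: "prime_elem var_y"
proof (rule prime_elem_if_kernel[of fps_X 0])
  show "var_y \<noteq> 0" using coef_var_y[of 0 1] by auto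
qed (simp_all add: var_y_dvd_iff)

context
  fixes n m :: nat
  assumes n: "odd n" and m: "m > 0" and mn: "2 * m < n"
begin

private definition g0 :: cps2 where "g0 = (var_y - var_x ^ m)\<^sup>2 - var_x ^ n"
text \<open>(T, S) = (t^2, t^(2m) + t^n) parametrizes \<open>g0\<close> = 0: along it y - x^m
  becomes t^n, whose square is x^n.\<close>

private definition T :: "complex fps" where "T = fps_X\<^sup>2"
private definition S :: "complex fps" where "S = fps_X ^ (2 * m) + fps_X ^ n"

private lemma T0: "fps_nth T 0 = 0" and S0: "fps_nth S 0 = 0"
  using m mn by (simp_all add: T_def S_def power_0_left)

private lemma pullback_w: "pullback (var_y - var_x ^ m) T S = fps_X ^ n"
  using T0 S0
  by (simp add: pullback_diff pullback_power pullback_var_x pullback_var_y)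
    (simp add: T_def S_def power_mult)

private lemma pullback_g0: "pullback g0 T S = 0"
  unfolding g0_def pullback_diff[OF T0 S0, of "(var_y - var_x ^ m)\<^sup>2"] pullback_power[OF T0 S0]
    pullback_w pullback_var_x[OF T0 S0]
  by (simp add: T_def power_mult[symmetric] mult.commute[of n])

private lemma y_regular_g0: "y_regular 2 g0"
proof -
  have g0: "g0 = var_y ^ 2 * 1 - var_x ^ m * (2 * var_y - var_x ^ m) - var_x ^ n * 1"
    unfolding g0_def by algebra
  have "coef g0 0 j = (if j = 2 then 1 else 0)" for j
    unfolding g0 using m mn
    by (simp only: coef_diff coef_x_power_mult coef_y_power_mult) (auto simp: coef_1)
  then show ?thesis by (simp add: y_regular_def)
qed

text \<open>The remainder of h modulo \<open>g0\<close> is a (y - x^m) + c with a and c in x alone.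
  Along the curve, c has even order in t and the other summand odd order, as n is odd; they cancel
  only if both vanish.\<close>

private lemma g0_dvd_iff: "g0 dvd h \<longleftrightarrow> pullback h T S = 0"
proof
  assume "g0 dvd h"
  then show "pullback h T S = 0" by (auto simp: dvd_def pullback_mult T0 S0 pullback_g0)
next
  assume h0: "pullback h T S = 0"
  obtain q a b where qab: "h = q * g0 + (a * var_y + b)" and a: "pdy a = 0" and b: "pdy b = 0"
    using Weierstrass_division_2[OF y_regular_g0] .
  define c where "c = b + a * var_x ^ m"
  have c: "pdy c = 0" using a b by (simp add: c_def pdy_mult pdy_power)
  have h_eq: "h = q * g0 + (a * (var_y - var_x ^ m) + c)"
    unfolding qab c_def by (simp only: right_diff_distrib) simp
  have T: "T \<noteq> 0" "subdegree T = 2" by (simp_all add: T_def subdegree_power)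
  have sum0: "pullback a T S * fps_X ^ n + pullback c T S = 0"
    using h0 T0 S0 unfolding h_eq
    by (simp add: pullback_add pullback_mult pullback_g0 pullback_w)
  have "a = 0"
  proof (rule ccontr)
    assume "a \<noteq> 0"
    then obtain i U where "a = var_x ^ i * U" "pdy U = 0" "is_unit U"
      using x_series_factorization[OF a] by metis
    then have a': "pullback a T S \<noteq> 0" "subdegree (pullback a T S) = i * 2"
      using subdegree_pullback_x_series[OF T0 S0 T(1), of U i] T(2) by auto
    have c_eq: "pullback c T S = - (pullback a T S * fps_X ^ n)"
      using sum0 by (simp add: eq_neg_iff_add_eq_0 add.commute)
    have "c \<noteq> 0" using c_eq a' T0 S0 by (auto simp: pullback_0)
    then obtain j V where "c = var_x ^ j * V" "pdy V = 0" "is_unit V"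
      using x_series_factorization[OF c] by metis
    then have "subdegree (pullback c T S) = j * 2"
      using subdegree_pullback_x_series[OF T0 S0 T(1), of V j] T(2) by auto
    moreover have "subdegree (pullback c T S) = i * 2 + n"
      using a' by (simp add: c_eq subdegree_power)
    ultimately show False using n by (metis dvd_triv_right even_add)
  qed
  moreover from this have "c = 0"
    using sum0 c T0 S0 T by (simp add: pullback_0 x_series_pullback_eq_0_iff)
  ultimately show "g0 dvd h" by (simp add: h_eq)
qed

private lemma prime_elem_g0: "prime_elem g0"
proof (rule prime_elem_if_kernel[OF T0 S0 g0_dvd_iff])
  show "g0 \<noteq> 0" using y_regular_g0 by (auto simp: y_regular_def)
qed

text \<open>With w = y - x^m the second form is y (2x dw - n w dx). Its second factor is, up to a
  factor, the logarithmic differential of w^2 / x^n, which is constant along the singular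
  branch.\<close>

lemma saito_basis_normal_form:
  fixes x y N M f\<^sub>0 :: cps2
  defines "x \<equiv> var_x" and "y \<equiv> var_y" and "N \<equiv> of_nat n" and "M \<equiv> of_nat m"
  defines "f\<^sub>0 \<equiv> y * ((y - x ^ m)\<^sup>2 - x ^ n)"
  shows "saito_basis f\<^sub>0
    (y * (N\<^sup>2 * x ^ (n - m - 1) - 4 * M\<^sup>2 * x ^ (m - 1)),
     2 * ((2 * M - N) * y + N * x ^ m - N * x ^ (n - m)))
    (- (y * (N * y + (2 * M - N) * x ^ m)), 2 * x * y)"
    (is "saito_basis _ ?\<eta>\<^sub>1 ?\<eta>\<^sub>2")
proof -
  define a b where "a = x ^ (m - 1)" and "b = x ^ (n - m - 1)"
  have "m = Suc (m - 1)" "n - m = Suc (n - m - 1)" using m mn by simp_all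
  then have xm: "x ^ m = x * a" and xnm: "x ^ (n - m) = x * b"
    unfolding a_def b_def by (metis power_Suc)+
  have xn1: "x ^ (n - 1) = x * a * b"
  proof -
    have "n - 1 = Suc ((m - 1) + (n - m - 1))" using m mn by simp
    then show ?thesis unfolding a_def b_def by (simp only: power_Suc power_add mult.assoc)
  qed
  have xn: "x ^ n = x * (x * a * b)"
    using mn by (simp add: xn1[symmetric] flip: power_Suc)
  have f: "f\<^sub>0 = y * ((y - x * a)\<^sup>2 - x * (x * a * b))"
    by (simp only: f\<^sub>0_def xm xn)
  have pd_w: "pdx (y - x ^ m) = - (M * a)" "pdy (y - x ^ m) = 1"
    by (simp_all add: x_def y_def M_def a_def pdx_power pdy_power)
  have pd_xn: "pdx (x ^ n) = N * (x * a * b)" "pdy (x ^ n) = 0"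
    using xn1 by (simp_all add: x_def N_def pdx_power pdy_power)
  have pd_y: "pdx y = 0" "pdy y = 1" by (simp_all add: y_def)
  have fx: "pdx f\<^sub>0 = y * (2 * (y - x * a) * (- (M * a)) - N * (x * a * b))"
    unfolding f\<^sub>0_def pdx_mult pdx_diff[of "(y - x ^ m)\<^sup>2"] pdx_power[of "y - x ^ m" 2] pd_w pd_xn pd_y
    by (simp add: xm)
  have fy: "pdy f\<^sub>0 = (y - x * a)\<^sup>2 - x * (x * a * b) + y * (2 * (y - x * a))"
    unfolding f\<^sub>0_def pdy_mult pdy_diff[of "(y - x ^ m)\<^sup>2"] pdy_power[of "y - x ^ m" 2] pd_w pd_xn pd_y
    by (simp add: xm xn)
  have f_g0: "f\<^sub>0 = var_y * g0" by (simp add: f\<^sub>0_def g0_def x_def y_def)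
  have fy_g0: "pdy f\<^sub>0 = g0 + var_y * (2 * (var_y - var_x ^ m))"
    unfolding fy g0_def by (simp add: xm[unfolded x_def] xn[unfolded x_def] x_def y_def)
  \<comment> \<open>Modulo y, f_y is \<open>g0\<close>, which on the line y = 0 becomes x^(2m) -
    x^n.\<close>
  have "\<not> var_y dvd pdy f\<^sub>0"
  proof
    assume "var_y dvd pdy f\<^sub>0"
    then have "var_y dvd g0" unfolding fy_g0 by (simp add: dvd_add_left_iff)
    then have "fps_X ^ (2 * m) - fps_X ^ n = (0 :: complex fps)"
      unfolding var_y_dvd_iff g0_def
      using m by (simp add: pullback_diff pullback_power pullback_var_x pullback_var_y power_mult_distrib
          power_mult mult.commute[of 2])
    then have "fps_nth (fps_X ^ (2 * m) - fps_X ^ n) (2 * m) = (0 :: complex)" by simp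
    then show False using mn by simp
  qed
  \<comment> \<open>Modulo \<open>g0\<close>, f_y is 2 y (y - x^m), which pulls back to 2 S
    t^n.\<close>
  moreover have "\<not> g0 dvd pdy f\<^sub>0"
  proof
    assume "g0 dvd pdy f\<^sub>0"
    then have "g0 dvd var_y * (2 * (var_y - var_x ^ m))" unfolding fy_g0 by (simp add: dvd_add_right_iff)
    then have "S * (pullback 2 T S * fps_X ^ n) = 0"
      unfolding g0_dvd_iff by (simp only: pullback_mult[OF T0 S0] pullback_var_y[OF T0 S0] pullback_w)
    moreover have "pullback 2 T S = 2"
      using pullback_const[OF T0 S0, of 2] by (simp add: const_numeral numeral_fps_const)
    ultimately have "S = 0" by simp
    then have "fps_nth S n = 0" by simp
    then show False using mn by (simp add: S_def)
  qed
  ultimately have coprime: "coprime (pdy f\<^sub>0) f\<^sub>0"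
    unfolding f_g0 by (intro coprime_product_of_primes prime_elem_var_y prime_elem_g0)
  have Gauss: "f\<^sub>0 dvd h" if "coprime c f\<^sub>0" "f\<^sub>0 dvd c * h" for c h
    using that product_of_primes_Gauss[OF prime_elem_var_y prime_elem_g0] unfolding f_g0 by blast
  have mem: "\<omega> \<in> saito_module f\<^sub>0" if "fst \<omega> * pdy f\<^sub>0 - snd \<omega> * pdx f\<^sub>0 = f\<^sub>0 * k" for \<omega> k
  proof (rule mem_saito_module_iff[THEN iffD2])
    show "f\<^sub>0 dvd wedge \<omega> (differential f\<^sub>0)"
      using that by (simp add: wedge_def differential_def)
  qed (fact Gauss coprime)+
  show ?thesis
  proof (rule saito_basis_criterion)
    show "f\<^sub>0 dvd h" if "coprime c f\<^sub>0" "f\<^sub>0 dvd c * h" for c h using that by (rule Gauss)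
    show "coprime (pdy f\<^sub>0) f\<^sub>0" by (rule coprime)
    show "?\<eta>\<^sub>1 \<in> saito_module f\<^sub>0"
      \<comment> \<open>The curve equation is monic of degree 3 in y, so both cofactors k are found
        by comparing the highest powers of y.\<close>
      by (rule mem[where k = "3 * N\<^sup>2 * b - 4 * M\<^sup>2 * a - 4 * M * N * a"])
        (unfold fst_conv snd_conv fx fy, unfold f a_def[symmetric] b_def[symmetric] xm xnm, algebra)
    show "?\<eta>\<^sub>2 \<in> saito_module f\<^sub>0"
      by (rule mem[where k = "(N - 2 * M) * (x * a) - 3 * N * y"])
        (unfold fst_conv snd_conv fx fy, unfold f xm, algebra)
    \<comment> \<open>The constant is the coefficient of y^3 on the left, the curve equation being
      monic in y. It is nonzero because 0 < 2m < n.\<close>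
    show "wedge ?\<eta>\<^sub>1 ?\<eta>\<^sub>2 = (2 * N * (2 * M - N)) * f\<^sub>0"
      unfolding wedge_def fst_conv snd_conv f a_def[symmetric] b_def[symmetric] xm xnm by algebra
    have "2 * N * (2 * M - N) = const (2 * of_nat n * (2 * of_nat m - of_nat n))"
      by (simp add: N_def M_def const_mult const_of_nat const_numeral const_add const_uminus
          diff_conv_add_uminus del: add_uminus_conv_diff)
    moreover have "of_nat (2 * m) \<noteq> (of_nat n :: complex)" "of_nat n \<noteq> (0 :: complex)"
      unfolding of_nat_eq_iff of_nat_eq_0_iff using mn by simp_all
    ultimately show "is_unit (2 * N * (2 * M - N))" by (simp add: is_unit_const)
    show "f\<^sub>0 \<noteq> 0" using prime_elem_var_y prime_elem_g0 by (simp add: f_g0 prime_elem_def)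
  qed
qed

end


section \<open>The Tjurina number of the normal form\<close>

text \<open>Modulo \<open>f\<^sub>y\<close>, which is a quadratic polynomial in \<open>y\<close>, the Tjurina ideal is the module over the
  series in \<open>x\<close> generated by \<open>b = 3 f\<^sub>x + 2 m x\<^sup>m\<^sup>-\<^sup>1 f\<^sub>y\<close>, whose coefficient of \<open>y\<close> is
  \<open>x\<^sup>2\<^sup>m\<^sup>-\<^sup>1\<close> times a unit, and by \<open>x\<^sup>n\<^sup>+\<^sup>m\<close>. Hence the monomials \<open>x\<^sup>i\<close> with \<open>i < n + m\<close> and \<open>x\<^sup>j y\<close>
  with \<open>j < 2m - 1\<close> form a basis of the quotient.\<close>

lemma tjurina_normal_form:
  fixes n m :: nat and x y :: cps2
  assumes m: "m > 0" and mn: "2 * m < n"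
  defines "x \<equiv> var_x" and "y \<equiv> var_y"
  shows "tjurina (y * ((y - x ^ m)\<^sup>2 - x ^ n)) = enat (n + 3 * m - 1)"
proof -
  define N M :: cps2 where "N = of_nat n" and "M = of_nat m"
  define s a e where "s = x ^ m" and "a = x ^ (m - 1)" and "e = x ^ (n - 2 * m)"
  define f where "f = y * ((y - x ^ m)\<^sup>2 - x ^ n)"
  have xa: "x * a = s"
    unfolding a_def s_def using m by (metis Suc_diff_1 power_Suc)
  have as: "a * s = x ^ (2 * m - 1)"
    unfolding a_def s_def power_add[symmetric] using m by (intro arg_cong[of _ _ "\<lambda>k. x ^ k"]) simp
  have xn: "x ^ n = s * s * e"
    unfolding s_def e_def power_add[symmetric] using mn by (intro arg_cong[of _ _ "\<lambda>k. x ^ k"]) simp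
  have xn1: "x ^ (n - 1) = a * s * e"
    unfolding a_def s_def e_def power_add[symmetric]
    using m mn by (intro arg_cong[of _ _ "\<lambda>k. x ^ k"]) simp
  have xnm: "s ^ 3 * e = x ^ (n + m)"
    unfolding s_def e_def power_add[symmetric] power_mult[symmetric]
    using mn by (intro arg_cong[of _ _ "\<lambda>k. x ^ k"]) simp
  have pd_w: "pdx (y - x ^ m) = - (M * a)" "pdy (y - x ^ m) = 1"
    by (simp_all add: x_def y_def M_def a_def pdx_power pdy_power)
  have pd_xn: "pdx (x ^ n) = N * (a * s * e)" "pdy (x ^ n) = 0"
    using xn1 by (simp_all add: x_def N_def pdx_power pdy_power)
  have pd_y: "pdx y = 0" "pdy y = 1" by (simp_all add: y_def)
  have f: "f = y * ((y - s)\<^sup>2 - s * s * e)"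
    unfolding f_def xn s_def ..
  define fx fy where "fx = pdx f" and "fy = pdy f"
  have fx: "fx = y * (2 * (y - s) * (- (M * a)) - N * (a * s * e))"
    unfolding fx_def f_def pdx_mult pdx_diff[of "(y - x ^ m)\<^sup>2"] pdx_power[of "y - x ^ m" 2] pd_w pd_xn pd_y
    by (simp add: s_def)
  have fy: "fy = (y - s)\<^sup>2 - s * s * e + y * (2 * (y - s))"
    unfolding fy_def f_def pdy_mult pdy_diff[of "(y - x ^ m)\<^sup>2"] pdy_power[of "y - x ^ m" 2] pd_w pd_xn pd_y
    by (simp add: s_def xn[unfolded s_def])
  have pdy_x: "pdy (x ^ k) = 0" for k by (simp add: x_def pdy_power)
  have pdy_N: "pdy N = 0" "pdy M = 0" by (simp_all add: N_def M_def)
  have pdy_s: "pdy s = 0" "pdy a = 0" "pdy e = 0" by (simp_all add: s_def a_def e_def pdy_x)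
  have x1: "pdy x = 0" using pdy_x[of 1] by simp
  have reg: "y_regular 2 fy"
  proof -
    have "fy = var_y ^ 2 * const 3 - var_x ^ m * (4 * y - s + s * e)"
      unfolding fy s_def[symmetric, unfolded x_def] y_def[symmetric] const_numeral by algebra
    then have "coef fy 0 j = (if j = 2 then 3 else 0)" for j
      using m by (simp only: coef_diff coef_x_power_mult coef_y_power_mult) (auto simp: coef_const)
    then show ?thesis by (simp add: y_regular_def)
  qed
  have M_const: "M = const (of_nat m)" and N_const: "N = const (of_nat n)"
    by (simp_all add: M_def N_def const_of_nat)
  have e0: "coef e 0 0 = 0" using mn by (simp add: e_def x_def coef_x_power)
  have M0: "coef M 0 0 \<noteq> 0" using m by (simp add: M_const coef_const)
  \<comment> \<open>These are the coefficients left over by the eliminations below. The constant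
    \<open>k1\<close> is nonzero as n and 2m differ; \<open>k2\<close> and \<open>k3\<close> take
    the value 2m at the origin, where e vanishes.\<close>
  define k1 k2 k3 where "k1 = 3 * (N - 2 * M)" and "k2 = 2 * M * (1 - e)" and "k3 = 2 * M + 3 * N * e"
  have num: "coef (numeral k) 0 0 = (numeral k :: complex)" for k
    by (simp add: coef_const flip: const_numeral)
  have "of_nat (2 * m) \<noteq> (of_nat n :: complex)" unfolding of_nat_eq_iff using mn by simp
  then have "is_unit k1"
    by (auto simp: k1_def is_unit_iff coef_mult_00 M_const N_const coef_const num)
  then obtain k1' where k1': "k1 * k1' = 1" by (rule is_unit_obtain)
  have "is_unit k2" using M0 by (simp add: k2_def is_unit_iff coef_mult_00 num e0 coef_1)
  then obtain k2' where k2': "k2 * k2' = 1" by (rule is_unit_obtain)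
  have k3: "is_unit k3" using M0 by (simp add: k3_def is_unit_iff coef_mult_00 num e0)
  then obtain k3' where k3': "k3 * k3' = 1" by (rule is_unit_obtain)
  have "is_unit (9 * M)" using M0 by (simp add: is_unit_iff coef_mult_00 num)
  then obtain k4 where k4: "9 * M * k4 = 1" by (rule is_unit_obtain)
  have "is_unit (3 :: cps2)" by (simp add: is_unit_iff num)
  then obtain k5 where k5: "(3 :: cps2) * k5 = 1" by (rule is_unit_obtain)
  have pdy_k: "pdy k2 = 0" "pdy k3 = 0" "pdy k1 = 0"
    by (simp_all add: k1_def k2_def k3_def pdy_mult pdy_N pdy_s)
  have pdy_k3': "pdy k3' = 0" using pdy_inverse[OF k3' pdy_k(2)] .
  have pdy_k45: "pdy k4 = 0" "pdy k5 = 0"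
    using pdy_inverse[OF k4] pdy_inverse[OF k5] by (simp_all add: pdy_mult pdy_N)
  \<comment> \<open>Here c = x^(n+m) and g = x^n y. Eliminating y^2 from f_x and f_y gives b;
    eliminating y^3 and y^2 from f by f_y, and the term free of y by x b, gives g; eliminating y
    from b and g gives c.\<close>
  define b c g where "b = a * s * (k2 * s - k3 * y)" and "c = s ^ 3 * e" and "g = e * s\<^sup>2 * y"
  have c_x: "c = var_x ^ (n + m)" unfolding c_def xnm x_def ..
  have b_eq: "b = 3 * fx + 2 * M * a * fy"
    unfolding b_def fx fy k2_def k3_def by algebra
  have g_eq: "k1 * g = 9 * M * f + (2 * M * s - 3 * M * y) * fy - x * b"
    unfolding g_def b_def f fy k1_def k2_def k3_def xa[symmetric] by algebra
  have c_eq: "k2 * c = x * e * b + k3 * g"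
    unfolding g_def b_def c_def xa[symmetric] by algebra
  have yb_eq: "3 * (y * b) = s * b - a * s * k3 * fy - (9 * N + 6 * M) * a * g + 3 * N * (1 - e) * a * c"
    unfolding g_def b_def c_def fy k2_def k3_def by algebra
  have yc_eq: "y * c = s * g" unfolding c_def g_def by algebra
  define J where "J = tjurina_ideal f"
  have J: "is_ideal J" by (simp add: J_def tjurina_ideal_def is_ideal_ideal_of)
  note J_intros = is_ideal_add[OF J] is_ideal_diff[OF J] is_ideal_mult[OF J]
  have mem: "f \<in> J" "fx \<in> J" "fy \<in> J"
    unfolding J_def tjurina_ideal_def ideal_of_def fx_def fy_def
    by (auto intro: cps2_module.span_base)
  have b: "b \<in> J" unfolding b_eq by (intro J_intros mem)
  have "k1 * g \<in> J" unfolding g_eq by (intro J_intros mem b)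
  then have "k1' * (k1 * g) \<in> J" by (rule J_intros)
  moreover have "k1' * (k1 * g) = g" using k1' by algebra
  ultimately have g: "g \<in> J" by metis
  have "k2 * c \<in> J" unfolding c_eq by (intro J_intros b g)
  then have "k2' * (k2 * c) \<in> J" by (rule J_intros)
  moreover have "k2' * (k2 * c) = c" using k2' by algebra
  ultimately have c: "c \<in> J" by metis
  \<comment> \<open>This module will turn out to contain J. To see that it is an ideal, stability
    under y is enough: modulo f_y every factor is linear in y with coefficients in x. The equations
    for y b and y c provide it.\<close>
  define T where "T h \<longleftrightarrow> (\<exists>q \<beta> \<gamma>. pdy \<beta> = 0 \<and> pdy \<gamma> = 0 \<and> h = q * fy + \<beta> * b + \<gamma> * c)" for h
  have TI: "T h" if "pdy \<beta> = 0" "pdy \<gamma> = 0" "h = q * fy + \<beta> * b + \<gamma> * c" for h q \<beta> \<gamma>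
    using that unfolding T_def by blast
  have T_add: "T (h + h')" if h: "T h" "T h'" for h h'
  proof -
    obtain q \<beta> \<gamma> where 1: "pdy \<beta> = 0" "pdy \<gamma> = 0" "h = q * fy + \<beta> * b + \<gamma> * c"
      using h(1) unfolding T_def by blast
    obtain q' \<beta>' \<gamma>' where 2: "pdy \<beta>' = 0" "pdy \<gamma>' = 0" "h' = q' * fy + \<beta>' * b + \<gamma>' * c"
      using h(2) unfolding T_def by blast
    show ?thesis
      by (rule TI[of "\<beta> + \<beta>'" "\<gamma> + \<gamma>'" _ "q + q'"]) (simp add: 1 2, simp add: 1 2, unfold 1 2, algebra)
  qed
  have T_x: "T (p * h)" if h: "T h" and p: "pdy p = 0" for h p
  proof -
    obtain q \<beta> \<gamma> where 1: "pdy \<beta> = 0" "pdy \<gamma> = 0" "h = q * fy + \<beta> * b + \<gamma> * c"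
      using h unfolding T_def by blast
    show ?thesis
      by (rule TI[of "p * \<beta>" "p * \<gamma>" _ "p * q"])
        (simp add: 1 p pdy_mult, simp add: 1 p pdy_mult, unfold 1, algebra)
  qed
  have T_fy: "T (q * fy)" for q by (rule TI[of 0 0 _ q]) simp_all
  have T_b: "T b" by (rule TI[of 1 0 _ 0]) simp_all
  have T_c: "T c" by (rule TI[of 0 1 _ 0]) simp_all
  have "k3' * (k3 * g) = g" using k3' by algebra
  moreover have "k3 * g = k2 * c + (- (x * e)) * b" using c_eq by algebra
  moreover have "T (k3' * (k2 * c + (- (x * e)) * b))"
    by (intro T_x T_add T_b T_c) (simp_all add: pdy_k pdy_k3' pdy_mult pdy_s x1)
  ultimately have T_g: "T g" by metis
  have "f = k4 * (x * b + k1 * g) + (k4 * (- (2 * M * s - 3 * M * y))) * fy"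
    using g_eq k4 by algebra
  moreover have "T (k4 * (x * b + k1 * g) + (k4 * (- (2 * M * s - 3 * M * y))) * fy)"
    by (intro T_add T_x T_b T_g T_fy) (simp_all add: pdy_k45 pdy_k x1)
  ultimately have T_f: "T f" by metis
  have "fx = k5 * b + (k5 * (- (2 * M * a))) * fy" using b_eq k5 by algebra
  moreover have "T (k5 * b + (k5 * (- (2 * M * a))) * fy)"
    by (intro T_add T_x T_b T_fy) (simp add: pdy_k45)
  ultimately have T_fx: "T fx" by metis
  have "y * b = k5 * (s * b + (- (9 * N + 6 * M) * a) * g + (3 * N * (1 - e) * a) * c)
      + (k5 * (- (a * s * k3))) * fy"
    using yb_eq k5 by algebra
  moreover have "T (k5 * (s * b + (- (9 * N + 6 * M) * a) * g + (3 * N * (1 - e) * a) * c)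
      + (k5 * (- (a * s * k3))) * fy)"
    by (intro T_add T_x T_b T_g T_c T_fy) (simp_all add: pdy_k45 pdy_s pdy_mult pdy_N)
  ultimately have T_yb: "T (y * b)" by metis
  have T_yc: "T (y * c)" unfolding yc_eq by (intro T_x T_g pdy_s)
  have T_y: "T (y * h)" if h: "T h" for h
  proof -
    obtain q \<beta> \<gamma> where 1: "pdy \<beta> = 0" "pdy \<gamma> = 0" "h = q * fy + \<beta> * b + \<gamma> * c"
      using h unfolding T_def by blast
    have "y * h = (y * q) * fy + \<beta> * (y * b) + \<gamma> * (y * c)" unfolding 1 by algebra
    moreover have "T ((y * q) * fy + \<beta> * (y * b) + \<gamma> * (y * c))"
      by (intro T_add T_x T_fy T_yb T_yc 1)
    ultimately show ?thesis by metis
  qed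
  have T_mult: "T (F * h)" if h: "T h" for F h
  proof -
    obtain q p r where qpr: "F = q * fy + (p * y + r)" "pdy p = 0" "pdy r = 0"
      using Weierstrass_division_2[OF reg, of F] unfolding y_def by blast
    have "F * h = (q * h) * fy + p * (y * h) + r * h" unfolding qpr by algebra
    moreover have "T ((q * h) * fy + p * (y * h) + r * h)"
      by (intro T_add T_x T_fy T_y h qpr)
    ultimately show ?thesis by metis
  qed
  have J_T: "T h" if h: "h \<in> J" for h
  proof -
    obtain p q r where "h = p * f + q * fx + r * fy"
      using h unfolding J_def tjurina_ideal_def fx_def fy_def mem_ideal_of_3 by blast
    then show ?thesis using T_add T_mult T_fy T_f T_fx by metis
  qed
  define K :: "(nat + nat) set" where "K = {..<n + m} <+> {..<2 * m - 1}"
  define v where "v = case_sum (\<lambda>i. x ^ i) (\<lambda>j. x ^ j * y)"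
  define C where "C u = (\<Sum>i<n + m. const (u (Inl i)) * var_x ^ i)" for u :: "nat + nat \<Rightarrow> complex"
  define D where "D u = (\<Sum>i<2 * m - 1. const (u (Inr i)) * var_x ^ i)" for u :: "nat + nat \<Rightarrow> complex"
  have sum_v: "(\<Sum>k\<in>K. const (u k) * v k) = C u + D u * y" for u
    unfolding K_def C_def D_def v_def x_def sum.Plus[OF finite_lessThan finite_lessThan]
    by (simp only: sum.case o_def sum_distrib_right mult.assoc)
  have coef_C: "coef (C u) i j = (if i < n + m \<and> j = 0 then u (Inl i) else 0)"
    and coef_D: "coef (D u) i j = (if i < 2 * m - 1 \<and> j = 0 then u (Inr i) else 0)" for u i j
    unfolding C_def D_def by (rule coef_x_polynomial)+
  have pdy_CD: "pdy (C u) = 0" "pdy (D u) = 0" for u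
    by (simp_all add: pdy_eq_0_iff coef_C coef_D)
  have "quotient_dim J = enat (card K)"
  proof (rule quotient_dim_indexed[OF J, where b = v])
    show "finite K" by (simp add: K_def)
    fix u assume "(\<Sum>k\<in>K. const (u k) * v k) \<in> J"
    then obtain q \<beta> \<gamma> where \<beta>\<gamma>: "pdy \<beta> = 0" "pdy \<gamma> = 0"
      and eq: "C u + D u * y = q * fy + \<beta> * b + \<gamma> * c"
      using J_T unfolding sum_v T_def by blast
    \<comment> \<open>Uniqueness of the remainder modulo f_y separates the coefficients.
      \<open>D u\<close> has degree below 2m - 1 in x but is divisible by x^(2m - 1), so it
      vanishes, and \<beta> with it; \<open>C u\<close> is then divisible by x^(n+m) and vanishes
      likewise.\<close>
    have "q * fy = (D u + \<beta> * (a * s) * k3) * var_y + (C u - \<beta> * (a * s) * (k2 * s) - \<gamma> * c)"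
      using eq unfolding b_def y_def by algebra
    then have 0: "D u + \<beta> * (a * s) * k3 = 0" "C u - \<beta> * (a * s) * (k2 * s) - \<gamma> * c = 0"
      by (rule Weierstrass_remainder_2_unique[OF reg];
          simp add: pdy_mult pdy_CD \<beta>\<gamma> pdy_s pdy_k c_def pdy_power)+
    have D: "D u = var_x ^ (2 * m - 1) * (- (\<beta> * k3))"
      using 0(1) unfolding as[symmetric, unfolded x_def] by algebra
    have uD: "u (Inr i) = 0" if "i < 2 * m - 1" for i
      using arg_cong[OF D, of "\<lambda>F. coef F i 0"] that unfolding coef_D coef_x_power_mult by simp
    then have "D u = 0" by (intro cps2_eqI) (simp add: coef_D)
    then have "var_x ^ (2 * m - 1) * (- (\<beta> * k3)) = 0" using D by simp
    moreover have "var_x \<noteq> 0" using coef_var_x[of 1 0] by auto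
    ultimately have "\<beta> = 0" using k3 by auto
    then have C: "C u = var_x ^ (n + m) * \<gamma>"
      using 0(2) by (simp add: c_x mult.commute[of \<gamma>])
    have uC: "u (Inl i) = 0" if "i < n + m" for i
      using arg_cong[OF C, of "\<lambda>F. coef F i 0"] that unfolding coef_C coef_x_power_mult by simp
    show "\<forall>k\<in>K. u k = 0" using uC uD by (auto simp: K_def)
  next
    fix h
    obtain q p r where qpr: "h = q * fy + (p * y + r)" "pdy p = 0" "pdy r = 0"
      using Weierstrass_division_2[OF reg, of h] unfolding y_def by blast
    obtain p' where p': "pdy p' = 0"
      "p = (\<Sum>i<2 * m - 1. const (coef p i 0) * var_x ^ i) + var_x ^ (2 * m - 1) * p'"
      using x_series_truncation[OF qpr(2)] by blast
    \<comment> \<open>The part a s p' y of p y is removed by subtracting a multiple of b. As b has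
      the y-coefficient - a s \<open>k3\<close>, this adds p' a s \<open>k2\<close> s /
      \<open>k3\<close> to the part free of y.\<close>
    define r' where "r' = r + p' * k3' * (a * s) * (k2 * s)"
    have "pdy r' = 0" by (simp add: r'_def pdy_mult p' qpr pdy_k pdy_k3' pdy_s)
    then obtain r'' where r'':
      "r' = (\<Sum>i<n + m. const (coef r' i 0) * var_x ^ i) + var_x ^ (n + m) * r''"
      using x_series_truncation by blast
    define u where "u = case_sum (\<lambda>i. coef r' i 0) (\<lambda>j. coef p j 0)"
    have p_eq: "p = D u + a * s * p'" using p'(2) by (simp add: D_def u_def as x_def)
    have "r' = C u + c * r''" using r'' by (simp add: C_def u_def c_x)
    then have r_eq: "r = C u + c * r'' - p' * k3' * (a * s) * (k2 * s)"
      unfolding r'_def by algebra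
    have "h - (C u + D u * y) = q * fy - (p' * k3') * b + r'' * c"
      unfolding qpr(1) p_eq r_eq b_def using k3' by algebra
    moreover have "q * fy - (p' * k3') * b + r'' * c \<in> J"
      by (intro J_intros mem b c)
    ultimately show "\<exists>u. h - (\<Sum>k\<in>K. const (u k) * v k) \<in> J"
      unfolding sum_v by metis
  qed
  moreover have "card K = n + 3 * m - 1"
    unfolding K_def using m by (simp add: card_Plus)
  ultimately show ?thesis
    by (simp add: tjurina_def J_def tjurina_ideal_def f_def)
qed

theorem mainTheorem3:
  fixes n m :: nat and f f\<^sub>1 g :: cps2
  assumes "odd n" and "m \<ge> 2" and "2 * m < n"
    and "f = f\<^sub>1 * g"
    and "multiplicity_at_0 f\<^sub>1 = 1"
    and "irreducible g" and "multiplicity_at_0 g = 2"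
    and "has_value_semigroup g (semigroup_gen2 2 n)"
    and "tangent_cone f\<^sub>1 = tangent_cone g"
    and "intersection_number f\<^sub>1 g = enat (2 * m)"
  shows
    "let x = var_x; y = var_y; N = of_nat n :: cps2; M = of_nat m :: cps2;
         f\<^sub>0 = y * ((y - x ^ m)\<^sup>2 - x ^ n);
         \<eta>\<^sub>1 = (y * (N\<^sup>2 * x ^ (n - m - 1) - 4 * M\<^sup>2 * x ^ (m - 1)),
               2 * ((2 * M - N) * y + N * x ^ m - N * x ^ (n - m)));
         \<eta>\<^sub>2 = (- (y * (N * y + (2 * M - N) * x ^ m)),
               2 * x * y)
     in (\<exists>X Y u. coordinate_change X Y \<and> is_unit u \<and> substitute f X Y = series (u * f\<^sub>0)) \<and>
        saito_basis f\<^sub>0 \<eta>\<^sub>1 \<eta>\<^sub>2 \<and>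
        tjurina f = enat (n + 3 * m - 1) \<and>
        tjurina f\<^sub>0 = enat (n + 3 * m - 1)"
proof -
  define f\<^sub>0 where "f\<^sub>0 = var_y * ((var_y - var_x ^ m)\<^sup>2 - var_x ^ n)"
  have "m > 0" using assms(2) by simp
  obtain X Y U V u where inv: "inverse_coordinates X Y U V" and u: "is_unit u"
    and eq: "subst f X Y = u * f\<^sub>0"
    using normal_form[OF assms(5,7,6,8,9,10,1,3)] unfolding assms(4) f\<^sub>0_def by blast
  have "coef X 0 0 = 0" "coef Y 0 0 = 0" using inv by (auto simp: inverse_coordinates_def)
  then have "substitute f X Y = series (u * f\<^sub>0)" using series_subst[of X Y f] eq by simp
  moreover have "coordinate_change X Y" using inv by (rule inverse_coordinates_imp_coordinate_change)
  moreover have tjurina0: "tjurina f\<^sub>0 = enat (n + 3 * m - 1)"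
    unfolding f\<^sub>0_def using \<open>m > 0\<close> assms(3) by (rule tjurina_normal_form)
  moreover have "tjurina f = enat (n + 3 * m - 1)"
    using tjurina_transport[OF inv u eq tjurina0] .
  moreover note saito_basis_normal_form[OF assms(1) \<open>m > 0\<close> assms(3)]
  ultimately show ?thesis unfolding Let_def f\<^sub>0_def using u by blast
qed

end
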